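(* Consider the linear quadratic control problem with state equation $$X_{n+1}=X_n+A_nX_n+B_nu_n+[C_nX_n+D_nu_n]\xi^H_n,\quad 0\le n\le N-1,\qquad X_0=x,$$ and cost function $$J(u)=\frac12\,\mathbb E\Big[\sum_{n=0}^{N-1}\big(Q_nX_n^2+R_nu_n^2\big)+GX_N^2\Big],$$ to be minimized over $u\in\mathbb U$, where $Q_n\ge0$, $G\ge0$ and $R_n>0$ for $n=0,1,\dots,N-1$. Let $(p,q)$ be the solution of the backward stochastic difference equation $$\begin{cases} p_n+q_n\eta_n=p_{n+1}+A_{n+1}p_{n+1}+\beta(n+1,n+1)C_{n+1}q_{n+1}\\ \qquad\qquad\quad+\,Q_{n+1}X^*_{n+1}+C_{n+1}p_{n+1}\xi^H_{n+1},\qquad 0\le n\le N-1,\\ p_N=GX_N^*,\\ q_N=0,\\ A_N=C_N=Q_N=0,\end{cases}$$ where $X^*$ is the state process corresponding to the control $u^*$ defined by $$u_n^*=-R_n^{-1}\Big[B_np_n+D_np_n\sum_{k=0}^{n-1}c(n,k)\xi^H_k+\beta(n,n)D_nq_n\Big],\quad 0\le n\le N-1,$$ with $c(n,k)=\sum_{l=0}^{n-1}\beta(n,l)\alpha(l,k)$. Then $u^*$ is the unique optimal control of this problem; that is, $u^*\in\mathbb U$, $J(u^* )=\inf_{u\in\mathbb U}J(u)$, and $u^*$ is the only element of $\mathbb U$ (up to almost sure equality) attaining the infimum.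
   Context: Fix $H\in(0,1)$, $a>1$ and an integer $N\ge1$; all processes are scalar. $B^H$ is a fractional Brownian motion with Hurst parameter $H$ (continuous centered Gaussian, $\mathbb E[B^H(t)B^H(s)]=\frac12(t^{2H}+s^{2H}-|t-s|^{2H})$) on a probability space $(\Omega,\mathcal F,P)$, and $\xi^H_n=B^H(n+1)-B^H(n)$, $n\ge0$. $\mathcal F_0\subset\mathcal F$ is a sub-$\sigma$-algebra and $\mathcal F_n=\mathcal F_0\vee\sigma(\xi^H_0,\dots,\xi^H_{n-1})$. The initial value $x$ is $\mathcal F_0$-measurable with $\mathbb E|x|^{2a}<\infty$ and is independent of $(\xi^H_n)$. $\mathbb U$ is the set of progressively measurable (with respect to $(\mathcal F_n)$) processes $u=(u_n)_{0\le n\le N-1}$ with values in a given closed convex set $\mathbf U\subset\mathbb R$ and $\mathbb E\sum_{n=0}^{N-1}|u_n|^{2a}<\infty$. The problem is the special case $b(n,x,u)=A_nx+B_nu$, $\sigma(n,x,u)=C_nx+D_nu$, $l(n,x,u)=\frac12(Q_nx^2+R_nu^2)$, $\Phi(x)=\frac12Gx^2$ of the control problem with state equation $X_{n+1}=X_n+b(n,X_n,u_n)+\sigma(n,X_n,u_n)\xi^H_n$, $X_0=x$, and cost $\mathbb E[\sum_{n=0}^{N-1}l(n,X_n,u_n)+\Phi(X_N)]$, whose standing assumptions are: for all $x,u\in\mathbb R$, $b(\cdot,x,u)$ and $\sigma(\cdot,x,u)$ are $(\mathcal F_n)$-adapted processes on $\{0,\dots,N-1\}$ with finite $2a$-th moments;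 $b,\sigma$ are differentiable in $(x,u)$, and $b,\sigma,b_x,\sigma_x,b_u,\sigma_u$ are Lipschitz in $(x,u)$ with a constant $L>0$ uniform in $n$; $l,\Phi$ are differentiable with $|l_x(n,x,u)|+|\Phi_x(x)|\le L(1+|x|+|u|)$; and $b(N,x,u)=\sigma(N,x,u)=l(N,x,u)=0$. White noise. Let $\rho(n,k)=\mathbb E[\xi^H_n\xi^H_k]=\frac12(|n-k+1|^{2H}+|n-k-1|^{2H}-2|n-k|^{2H})$. Let $\beta(n,k)$, $n,k\ge0$, be the lower triangular array ($\beta(n,k)=0$ for $k>n$) with positive diagonal determined by $\beta(n,k)=\big(\rho(n,k)-\sum_{j=0}^{k-1}\beta(n,j)\beta(k,j)\big)/\beta(k,k)$ for $k\le n$ (for $k=n$: $\beta(n,n)^2=\rho(n,n)-\sum_{j<n}\beta(n,j)^2$), and let $\alpha(n,k)$ be its lower triangular inverse. Put $\eta_n=\sum_{k=0}^n\alpha(n,k)\xi^H_k$, so that $\xi^H_n=\sum_{k=0}^n\beta(n,k)\eta_k$. A solution $(p,q)$ of the backward equation is a pair of square-integrable $(\mathcal F_n)$-adapted processes satisfying it almost surely.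
   Formalization: The formal theorem additionally assumes that the whole σ-algebra F_0 (not only x) is independent of the noise (ξ_n), and that the control u* given by the formula takes values in the set U; without either of these the claim is false. *)

theory Defs
  imports "HOL-Probability.Probability"
begin

section \<open>Fractional Brownian motion and fractional noise\<close>

text \<open>Constants count as (degenerate) Gaussian variables; this is needed at time \<open>0\<close>.\<close>

definition gaussian_rv :: "'w measure \<Rightarrow> ('w \<Rightarrow> real) \<Rightarrow> bool" where
  "gaussian_rv M Y \<longleftrightarrow> Y \<in> borel_measurable M \<and>
     ((\<exists>\<mu>. AE \<omega> in M. Y \<omega> = \<mu>) \<or>
      (\<exists>\<mu> \<sigma>. 0 < \<sigma> \<and> distributed M lborel Y (normal_density \<mu> \<sigma>)))"

definition gaussian_process :: "'w measure \<Rightarrow> 't set \<Rightarrow> ('t \<Rightarrow> 'w \<Rightarrow> real) \<Rightarrow> bool" where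
  "gaussian_process M T Y \<longleftrightarrow>
     (\<forall>I r. finite I \<and> I \<subseteq> T \<longrightarrow> gaussian_rv M (\<lambda>\<omega>. \<Sum>t\<in>I. r t * Y t \<omega>))"

definition fractional_brownian_motion ::
    "'w measure \<Rightarrow> real \<Rightarrow> (real \<Rightarrow> 'w \<Rightarrow> real) \<Rightarrow> bool" where
  "fractional_brownian_motion M H W \<longleftrightarrow>
     gaussian_process M {0..} W \<and>
     (AE \<omega> in M. continuous_on {0..} (\<lambda>t. W t \<omega>)) \<and>
     (\<forall>t\<ge>0. (\<integral>\<omega>. W t \<omega> \<partial>M) = 0) \<and>
     (\<forall>t\<ge>0. \<forall>s\<ge>0. (\<integral>\<omega>. W t \<omega> * W s \<omega> \<partial>M) =
        1/2 * (t powr (2 * H) + s powr (2 * H) - \<bar>t - s\<bar> powr (2 * H)))"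

definition fractional_noise :: "(real \<Rightarrow> 'w \<Rightarrow> real) \<Rightarrow> nat \<Rightarrow> 'w \<Rightarrow> real" where
  "fractional_noise W n \<omega> = W (real n + 1) \<omega> - W (real n) \<omega>"

definition noise_cov :: "real \<Rightarrow> nat \<Rightarrow> nat \<Rightarrow> real" where
  "noise_cov H n k =
     1/2 * (\<bar>real n - real k + 1\<bar> powr (2 * H) + \<bar>real n - real k - 1\<bar> powr (2 * H)
            - 2 * \<bar>real n - real k\<bar> powr (2 * H))"


section \<open>Whitening of the noise\<close>

text \<open>For \<open>k = n\<close> the recursion is the implicit relation
  \<open>\<beta>(n,n)\<^sup>2 = \<rho>(n,n) - (\<Sum>j<n. \<beta>(n,j)\<^sup>2)\<close>; the positive sign of the diagonal makes it determine \<open>\<beta>\<close>.\<close>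

definition whitening_factor :: "(nat \<Rightarrow> nat \<Rightarrow> real) \<Rightarrow> (nat \<Rightarrow> nat \<Rightarrow> real) \<Rightarrow> bool" where
  "whitening_factor \<rho> \<beta> \<longleftrightarrow>
     (\<forall>n k. n < k \<longrightarrow> \<beta> n k = 0) \<and>
     (\<forall>n. 0 < \<beta> n n) \<and>
     (\<forall>n k. k \<le> n \<longrightarrow> \<beta> n k = (\<rho> n k - (\<Sum>j<k. \<beta> n j * \<beta> k j)) / \<beta> k k)"

definition lower_triangular_inverse :: "(nat \<Rightarrow> nat \<Rightarrow> real) \<Rightarrow> (nat \<Rightarrow> nat \<Rightarrow> real) \<Rightarrow> bool" where
  "lower_triangular_inverse \<beta> \<alpha> \<longleftrightarrow>
     (\<forall>n k. n < k \<longrightarrow> \<alpha> n k = 0) \<and>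
     (\<forall>n m. (\<Sum>k\<le>n. \<alpha> n k * \<beta> k m) = (if n = m then 1 else 0))"

definition white_noise ::
    "(nat \<Rightarrow> nat \<Rightarrow> real) \<Rightarrow> (nat \<Rightarrow> 'w \<Rightarrow> real) \<Rightarrow> nat \<Rightarrow> 'w \<Rightarrow> real" where
  "white_noise \<alpha> \<xi> n \<omega> = (\<Sum>k\<le>n. \<alpha> n k * \<xi> k \<omega>)"

definition pred_coeff :: "(nat \<Rightarrow> nat \<Rightarrow> real) \<Rightarrow> (nat \<Rightarrow> nat \<Rightarrow> real) \<Rightarrow> nat \<Rightarrow> nat \<Rightarrow> real" where
  "pred_coeff \<beta> \<alpha> n k = (\<Sum>l<n. \<beta> n l * \<alpha> l k)"


section \<open>Filtration, admissible controls, state equation\<close>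

definition noise_events :: "'w measure \<Rightarrow> (nat \<Rightarrow> 'w \<Rightarrow> real) \<Rightarrow> nat set \<Rightarrow> 'w set set" where
  "noise_events M \<xi> K = (\<Union>k\<in>K. {\<xi> k -` S \<inter> space M |S. S \<in> sets borel})"

definition noise_filtration ::
    "'w measure \<Rightarrow> 'w measure \<Rightarrow> (nat \<Rightarrow> 'w \<Rightarrow> real) \<Rightarrow> nat \<Rightarrow> 'w measure" where
  "noise_filtration M F0 \<xi> n = sigma (space M) (sets F0 \<union> noise_events M \<xi> {..<n})"

definition adapted_on :: "nat set \<Rightarrow> (nat \<Rightarrow> 'w measure) \<Rightarrow> (nat \<Rightarrow> 'w \<Rightarrow> real) \<Rightarrow> bool" where
  "adapted_on T F Y \<longleftrightarrow> (\<forall>n\<in>T. Y n \<in> borel_measurable (F n))"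

definition progressively_measurable_on ::
    "nat set \<Rightarrow> (nat \<Rightarrow> 'w measure) \<Rightarrow> (nat \<Rightarrow> 'w \<Rightarrow> real) \<Rightarrow> bool" where
  "progressively_measurable_on T F Y \<longleftrightarrow>
     (\<forall>n\<in>T. (\<lambda>(k, \<omega>). Y k \<omega>) \<in> borel_measurable (count_space {..n} \<Otimes>\<^sub>M F n))"

definition admissible_controls ::
    "'w measure \<Rightarrow> (nat \<Rightarrow> 'w measure) \<Rightarrow> nat \<Rightarrow> real \<Rightarrow> real set \<Rightarrow> (nat \<Rightarrow> 'w \<Rightarrow> real) set" where
  "admissible_controls M F N a U =
     {u. progressively_measurable_on {..<N} F u \<and>
         (\<forall>n<N. \<forall>\<omega>\<in>space M. u n \<omega> \<in> U) \<and>
         integrable M (\<lambda>\<omega>. \<Sum>n<N. \<bar>u n \<omega>\<bar> powr (2 * a))}"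

text \<open>Coefficients of the state equation are functions of time, state, control and \<open>\<omega>\<close>.\<close>

type_synonym 'w coeff = "nat \<Rightarrow> real \<Rightarrow> real \<Rightarrow> 'w \<Rightarrow> real"

primrec state ::
    "'w coeff \<Rightarrow> 'w coeff \<Rightarrow> (nat \<Rightarrow> 'w \<Rightarrow> real) \<Rightarrow> ('w \<Rightarrow> real) \<Rightarrow> (nat \<Rightarrow> 'w \<Rightarrow> real)
     \<Rightarrow> nat \<Rightarrow> 'w \<Rightarrow> real" where
  "state b \<sigma> \<xi> x u 0 = x"
| "state b \<sigma> \<xi> x u (Suc n) =
     (\<lambda>\<omega>. state b \<sigma> \<xi> x u n \<omega> + b n (state b \<sigma> \<xi> x u n \<omega>) (u n \<omega>) \<omega>
          + \<sigma> n (state b \<sigma> \<xi> x u n \<omega>) (u n \<omega>) \<omega> * \<xi> n \<omega>)"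

definition smooth_lipschitz :: "real \<Rightarrow> (real \<Rightarrow> real \<Rightarrow> real) \<Rightarrow> bool" where
  "smooth_lipschitz L f \<longleftrightarrow>
     (\<forall>z. (\<lambda>(x, u). f x u) differentiable (at z)) \<and>
     L-lipschitz_on UNIV (\<lambda>(x, u). f x u) \<and>
     L-lipschitz_on UNIV (\<lambda>(x, u). deriv (\<lambda>y. f y u) x) \<and>
     L-lipschitz_on UNIV (\<lambda>(x, u). deriv (\<lambda>v. f x v) u)"

definition standing_assumptions ::
    "'w measure \<Rightarrow> (nat \<Rightarrow> 'w measure) \<Rightarrow> nat \<Rightarrow> real \<Rightarrow> real \<Rightarrow> 'w coeff \<Rightarrow> 'w coeff
     \<Rightarrow> (nat \<Rightarrow> real \<Rightarrow> real \<Rightarrow> real) \<Rightarrow> (real \<Rightarrow> real) \<Rightarrow> bool" where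
  "standing_assumptions M F N a L b \<sigma> l \<Phi> \<longleftrightarrow>
     (\<forall>x u. adapted_on {..<N} F (\<lambda>n. b n x u) \<and> adapted_on {..<N} F (\<lambda>n. \<sigma> n x u)) \<and>
     (\<forall>x u. \<forall>n<N. integrable M (\<lambda>\<omega>. \<bar>b n x u \<omega>\<bar> powr (2 * a)) \<and>
                  integrable M (\<lambda>\<omega>. \<bar>\<sigma> n x u \<omega>\<bar> powr (2 * a))) \<and>
     (AE \<omega> in M. \<forall>n<N. smooth_lipschitz L (\<lambda>x u. b n x u \<omega>) \<and>
                       smooth_lipschitz L (\<lambda>x u. \<sigma> n x u \<omega>)) \<and>
     (\<forall>n<N. \<forall>z. (\<lambda>(x, u). l n x u) differentiable (at z)) \<and>
     (\<forall>x. \<Phi> differentiable (at x)) \<and>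
     (\<forall>n<N. \<forall>x u. \<bar>deriv (\<lambda>y. l n y u) x\<bar> + \<bar>deriv \<Phi> x\<bar> \<le> L * (1 + \<bar>x\<bar> + \<bar>u\<bar>)) \<and>
     (AE \<omega> in M. \<forall>x u. b N x u \<omega> = 0 \<and> \<sigma> N x u \<omega> = 0) \<and>
     (\<forall>x u. l N x u = 0)"


section \<open>The linear quadratic problem\<close>

definition lin_coeff :: "(nat \<Rightarrow> 'w \<Rightarrow> real) \<Rightarrow> (nat \<Rightarrow> 'w \<Rightarrow> real) \<Rightarrow> 'w coeff" where
  "lin_coeff A B n x u \<omega> = A n \<omega> * x + B n \<omega> * u"

definition quad_running :: "(nat \<Rightarrow> real) \<Rightarrow> (nat \<Rightarrow> real) \<Rightarrow> nat \<Rightarrow> real \<Rightarrow> real \<Rightarrow> real" where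
  "quad_running Q R n x u = 1/2 * (Q n * x\<^sup>2 + R n * u\<^sup>2)"

definition quad_terminal :: "real \<Rightarrow> real \<Rightarrow> real" where
  "quad_terminal G x = 1/2 * G * x\<^sup>2"

definition lq_cost ::
    "'w measure \<Rightarrow> nat \<Rightarrow> (nat \<Rightarrow> real) \<Rightarrow> (nat \<Rightarrow> real) \<Rightarrow> real
     \<Rightarrow> (nat \<Rightarrow> 'w \<Rightarrow> real) \<Rightarrow> (nat \<Rightarrow> 'w \<Rightarrow> real) \<Rightarrow> real" where
  "lq_cost M N Q R G X u =
     1/2 * (\<integral>\<omega>. (\<Sum>n<N. Q n * (X n \<omega>)\<^sup>2 + R n * (u n \<omega>)\<^sup>2) + G * (X N \<omega>)\<^sup>2 \<partial>M)"

definition lq_bsde_solution ::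
    "'w measure \<Rightarrow> (nat \<Rightarrow> 'w measure) \<Rightarrow> nat \<Rightarrow> (nat \<Rightarrow> nat \<Rightarrow> real)
     \<Rightarrow> (nat \<Rightarrow> 'w \<Rightarrow> real) \<Rightarrow> (nat \<Rightarrow> 'w \<Rightarrow> real)
     \<Rightarrow> (nat \<Rightarrow> 'w \<Rightarrow> real) \<Rightarrow> (nat \<Rightarrow> 'w \<Rightarrow> real) \<Rightarrow> (nat \<Rightarrow> real) \<Rightarrow> real
     \<Rightarrow> (nat \<Rightarrow> 'w \<Rightarrow> real) \<Rightarrow> (nat \<Rightarrow> 'w \<Rightarrow> real) \<Rightarrow> (nat \<Rightarrow> 'w \<Rightarrow> real) \<Rightarrow> bool" where
  "lq_bsde_solution M F N \<beta> \<xi> \<eta> A C Q G X p q \<longleftrightarrow>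
     adapted_on {..N} F p \<and> adapted_on {..N} F q \<and>
     (\<forall>n\<le>N. integrable M (\<lambda>\<omega>. (p n \<omega>)\<^sup>2) \<and> integrable M (\<lambda>\<omega>. (q n \<omega>)\<^sup>2)) \<and>
     (\<forall>n<N. AE \<omega> in M.
        p n \<omega> + q n \<omega> * \<eta> n \<omega> =
          p (n+1) \<omega> + A (n+1) \<omega> * p (n+1) \<omega>
          + \<beta> (n+1) (n+1) * C (n+1) \<omega> * q (n+1) \<omega>
          + Q (n+1) * X (n+1) \<omega> + C (n+1) \<omega> * p (n+1) \<omega> * \<xi> (n+1) \<omega>) \<and>
     (AE \<omega> in M. p N \<omega> = G * X N \<omega>) \<and>
     (AE \<omega> in M. q N \<omega> = 0) \<and>
     (AE \<omega> in M. A N \<omega> = 0 \<and> C N \<omega> = 0) \<and> Q N = 0"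

end

theory Submission
  imports Defs
begin

text \<open>
  Write \<open>\<xi>\<^sub>n = \<mu>\<^sub>n + \<beta>\<^sub>n \<eta>\<^sub>n\<close>, where \<open>\<mu>\<^sub>n\<close> is a linear combination of the past noise and \<open>\<beta>\<^sub>n = \<beta>(n,n)\<close>.
  Everything rests on one fact about Gaussian variables: \<open>\<eta>\<^sub>n\<close> is uncorrelated with the past noise,
  hence standard normal and independent of \<open>\<F>\<^sub>n\<close> (\<open>white_noise_indep_past\<close>). One step of the controlled
  system is then \<open>X\<^sub>n\<^sub>+\<^sub>1 = m + s \<eta>\<^sub>n\<close> with \<open>m\<close> and \<open>s\<close> known at time \<open>n\<close>, and the adjoint equation reads
  \<open>p\<^sub>n + q\<^sub>n \<eta>\<^sub>n = P\<^sub>n\<^sub>+\<^sub>1\<close>, where \<open>P\<^sub>n\<close> abbreviates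
  \<open>(1 + A\<^sub>n + C\<^sub>n \<mu>\<^sub>n) p\<^sub>n + \<beta>\<^sub>n C\<^sub>n q\<^sub>n + Q\<^sub>n X\<^sup>*\<^sub>n\<close> and \<open>P\<^sub>N = G X\<^sup>*\<^sub>N\<close>. The equation is stated with \<open>\<xi>\<^sub>n\<^sub>+\<^sub>1\<close> in
  place of \<open>\<mu>\<^sub>n\<^sub>+\<^sub>1\<close>. The two forms agree: all other terms are known at time \<open>n + 1\<close>, so the coefficient
  \<open>C\<^sub>n\<^sub>+\<^sub>1 p\<^sub>n\<^sub>+\<^sub>1\<close> of \<open>\<xi>\<^sub>n\<^sub>+\<^sub>1\<close> has to vanish (\<open>adjoint_noise_coupling\<close>).

  Optimality is duality followed by completion of squares. Because \<open>\<eta>\<^sub>n\<close> has mean \<open>0\<close> and variance \<open>1\<close>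
  given \<open>\<F>\<^sub>n\<close>, the expectation of \<open>P\<^sub>n\<^sub>+\<^sub>1 (X\<^sub>n\<^sub>+\<^sub>1 - X\<^sup>*\<^sub>n\<^sub>+\<^sub>1)\<close> equals that of
  \<open>P\<^sub>n (X\<^sub>n - X\<^sup>*\<^sub>n) - Q\<^sub>n X\<^sup>*\<^sub>n (X\<^sub>n - X\<^sup>*\<^sub>n) - R\<^sub>n u\<^sup>*\<^sub>n (u\<^sub>n - u\<^sup>*\<^sub>n)\<close>; the formula for \<open>u\<^sup>*\<close> is exactly what turns the
  coefficient of \<open>u\<^sub>n - u\<^sup>*\<^sub>n\<close> into \<open>- R\<^sub>n u\<^sup>*\<^sub>n\<close>. Summing over \<open>n\<close>, the linear part of \<open>J(u) - J(u\<^sup>*)\<close> vanishes,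
  and what remains is a nonnegative quadratic form in which \<open>(u\<^sub>n - u\<^sup>*\<^sub>n)\<^sup>2\<close> has the positive weight \<open>R\<^sub>n / 2\<close>.

  The delicate part is integrability. A solution \<open>(p, q)\<close> is only square integrable and determines \<open>X\<^sup>*\<close>
  itself, while admissibility of \<open>u\<^sup>*\<close> asks for moments of order \<open>2 a > 2\<close> and the duality multiplies
  \<open>p\<^sub>n\<close>, \<open>\<mu>\<^sub>n\<close> and states. The way out is an a priori bound that uses no expectation (\<open>feedback_step\<close>): by backward
  induction \<open>P\<^sub>n X\<^sup>*\<^sub>n\<close> is nonnegative and \<open>p\<^sub>n\<close>, \<open>q\<^sub>n\<close>, \<open>u\<^sup>*\<^sub>n\<close>, \<open>P\<^sub>n\<close> are bounded by \<open>\<bar>X\<^sup>*\<^sub>n\<bar>\<close> times a polynomial in the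
  past noise. In the induction step, relations between \<open>p\<^sub>n + q\<^sub>n \<eta>\<^sub>n\<close> and \<open>m + s \<eta>\<^sub>n\<close> that hold almost surely
  hold for all values of the innovation, since a normal law charges every open set; evaluating them at
  \<open>1\<close> and \<open>- 1\<close> is enough (\<open>innovation_coercivity\<close>). Going forward again, \<open>u\<^sup>*\<^sub>n\<close> is bounded by \<open>\<bar>x\<bar>\<close> times a
  polynomial in the noise, and \<open>x\<close> is independent of the noise, so \<open>u\<^sup>*\<close> inherits from \<open>x\<close> the moment of order \<open>2 a\<close>.
\<close>

section \<open>Weighted characteristic functions and independence\<close>

text \<open>The function \<open>1 + Z / (K + 1)\<close> is a probability density with respect to \<open>M\<close>, and the hypothesis says
that \<open>Y\<close> has the same characteristic function under the reweighted measure as under \<open>M\<close>. Levy's uniqueness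
theorem makes the two laws of \<open>Y\<close> equal.\<close>

lemma (in prob_space) fourier_null_imp_null_real:
  fixes Z Y :: "'a \<Rightarrow> real"
  assumes Z[measurable]: "Z \<in> borel_measurable M" and Y[measurable]: "Y \<in> borel_measurable M"
    and bd: "\<And>\<omega>. \<bar>Z \<omega>\<bar> \<le> K"
    and null: "\<And>s. (CLINT \<omega>|M. Z \<omega> * iexp (s * Y \<omega>)) = 0"
    and A[measurable]: "A \<in> sets borel"
  shows "(\<integral>\<omega>. Z \<omega> * indicator A (Y \<omega>) \<partial>M) = 0"
proof -
  have K: "0 \<le> K" using bd[of undefined] by (smt (verit))
  \<comment> \<open>Dividing by \<open>K + 1\<close> rather than by \<open>K\<close> keeps the quotient meaningful for \<open>K = 0\<close>.\<close>
  define w where "w \<omega> = 1 + Z \<omega> / (K + 1)" for \<omega>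
  have w[measurable]: "w \<in> borel_measurable M" unfolding w_def by measurable
  have w0: "0 \<le> w \<omega>" for \<omega>
    using bd[of \<omega>] K unfolding w_def by (auto simp: field_simps abs_le_iff)
  have wbd: "\<bar>w \<omega>\<bar> \<le> 2" for \<omega>
    using bd[of \<omega>] K unfolding w_def by (auto simp: field_simps abs_le_iff)
  have intZ: "integrable M Z" by (rule integrable_const_bound[where B=K]) (use bd in auto)
  have intw: "integrable M w" by (rule integrable_const_bound[where B=2]) (use wbd in auto)
  have EZ: "(\<integral>\<omega>. Z \<omega> \<partial>M) = 0"
    using null[of 0] by simp
  have Ew: "(\<integral>\<omega>. w \<omega> \<partial>M) = 1"
    unfolding w_def using intZ EZ by (simp add: prob_space)
  define D where "D = density M w"
  interpret D: prob_space D
  proof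
    have "emeasure D (space D) = (\<integral>\<^sup>+\<omega>. w \<omega> \<partial>M)"
      unfolding D_def by (subst emeasure_density) (auto intro!: nn_integral_cong)
    also have "\<dots> = 1" using nn_integral_eq_integral[OF intw] w0 Ew by simp
    finally show "emeasure D (space D) = 1" .
  qed
  have YD[measurable]: "Y \<in> borel_measurable D" unfolding D_def by simp
  have "distr D borel Y = distr M borel Y"
  proof (rule Levy_uniqueness)
    show "real_distribution (distr D borel Y)" "real_distribution (distr M borel Y)"
      by (auto intro!: D.real_distribution_distr real_distribution_distr)
    show "char (distr D borel Y) = char (distr M borel Y)"
    proof
      fix s
      have i1: "complex_integrable M (\<lambda>\<omega>. iexp (s * Y \<omega>))"
        by (rule integrable_const_bound[where B=1]) auto
      have i2: "complex_integrable M (\<lambda>\<omega>. Z \<omega> * iexp (s * Y \<omega>))"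
        by (rule integrable_const_bound[where B=K]) (use bd in \<open>auto simp: norm_mult\<close>)
      have "char (distr D borel Y) s = (CLINT \<omega>|D. iexp (s * Y \<omega>))"
        unfolding char_def by (subst integral_distr) auto
      also have "\<dots> = (CLINT \<omega>|M. w \<omega> *\<^sub>R iexp (s * Y \<omega>))"
        unfolding D_def by (subst integral_density) (use w0 in auto)
      also have "\<dots> = (CLINT \<omega>|M. iexp (s * Y \<omega>) + (1 / (K + 1)) *\<^sub>R (Z \<omega> * iexp (s * Y \<omega>)))"
        by (rule Bochner_Integration.integral_cong)
          (auto simp: w_def scaleR_conv_of_real algebra_simps)
      also have "\<dots> = (CLINT \<omega>|M. iexp (s * Y \<omega>))"
        using i1 i2 null[of s] by (simp del: of_real_mult)
      also have "\<dots> = char (distr M borel Y) s"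
        unfolding char_def by (subst integral_distr) auto
      finally show "char (distr D borel Y) s = char (distr M borel Y) s" .
    qed
  qed
  then have "(\<integral>y. indicator A y \<partial>distr D borel Y) = (\<integral>y. (indicator A y :: real) \<partial>distr M borel Y)"
    by simp
  then have "(\<integral>\<omega>. indicator A (Y \<omega>) \<partial>D) = (\<integral>\<omega>. (indicator A (Y \<omega>) :: real) \<partial>M)"
    by (subst (asm) (1 2) integral_distr) auto
  moreover have "(\<integral>\<omega>. indicator A (Y \<omega>) \<partial>D) = (\<integral>\<omega>. w \<omega> * indicator A (Y \<omega>) \<partial>M)"
    unfolding D_def by (subst integral_density) (use w0 in auto)
  moreover have "(\<integral>\<omega>. w \<omega> * indicator A (Y \<omega>) \<partial>M) =
      (\<integral>\<omega>. indicator A (Y \<omega>) + (1 / (K + 1)) * (Z \<omega> * indicator A (Y \<omega>)) \<partial>M)"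
    by (rule Bochner_Integration.integral_cong) (auto simp: w_def algebra_simps)
  moreover have "\<dots> = (\<integral>\<omega>. indicator A (Y \<omega>) \<partial>M)
      + (1 / (K + 1)) * (\<integral>\<omega>. Z \<omega> * indicator A (Y \<omega>) \<partial>M)"
  proof -
    have "integrable M (\<lambda>\<omega>. (indicator A (Y \<omega>) :: real))"
      by (rule integrable_const_bound[where B=1]) (auto simp: indicator_def)
    moreover have "integrable M (\<lambda>\<omega>. Z \<omega> * indicator A (Y \<omega>))"
      by (rule integrable_const_bound[where B=K]) (use bd K in \<open>auto simp: indicator_def\<close>)
    ultimately show ?thesis by simp
  qed
  ultimately show ?thesis using K by simp
qed

text \<open>Conjugating the hypothesis at \<open>- s\<close> gives it for the conjugate weight, so the real and imaginary parts of
the weight can be treated separately.\<close>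

lemma (in prob_space) fourier_null_imp_null_complex:
  fixes Z :: "'a \<Rightarrow> complex" and Y :: "'a \<Rightarrow> real"
  assumes Z[measurable]: "Z \<in> borel_measurable M" and Y[measurable]: "Y \<in> borel_measurable M"
    and bd: "\<And>\<omega>. cmod (Z \<omega>) \<le> K"
    and null: "\<And>s. (CLINT \<omega>|M. Z \<omega> * iexp (s * Y \<omega>)) = 0"
    and A[measurable]: "A \<in> sets borel"
  shows "(CLINT \<omega>|M. Z \<omega> * indicator A (Y \<omega>)) = 0"
proof -
  have int: "complex_integrable M (\<lambda>\<omega>. Z \<omega> * iexp (s * Y \<omega>))" for s
    by (rule integrable_const_bound[where B=K]) (use bd in \<open>auto simp: norm_mult\<close>)
  have null': "(CLINT \<omega>|M. cnj (Z \<omega>) * iexp (s * Y \<omega>)) = 0" for s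
  proof -
    have "(CLINT \<omega>|M. cnj (Z \<omega>) * iexp (s * Y \<omega>)) = (CLINT \<omega>|M. cnj (Z \<omega> * iexp ((- s) * Y \<omega>)))"
      by (rule Bochner_Integration.integral_cong) (auto simp: exp_cnj)
    also have "\<dots> = cnj (CLINT \<omega>|M. Z \<omega> * iexp ((- s) * Y \<omega>))"
      by (rule Bochner_Integration.integral_cnj)
    finally show ?thesis by (simp only: null complex_cnj_zero)
  qed
  have [measurable]: "(\<lambda>\<omega>. cnj (Z \<omega>)) \<in> borel_measurable M"
    by (rule measurable_compose[OF Z]) (intro borel_measurable_continuous_onI continuous_intros)
  have int': "complex_integrable M (\<lambda>\<omega>. cnj (Z \<omega>) * iexp (s * Y \<omega>))" for s
    by (rule integrable_const_bound[where B=K]) (use bd in \<open>auto simp: norm_mult\<close>)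
  have re: "(\<integral>\<omega>. Re (Z \<omega>) * indicator A (Y \<omega>) \<partial>M) = 0"
  proof (rule fourier_null_imp_null_real[where K=K])
    show "\<bar>Re (Z \<omega>)\<bar> \<le> K" for \<omega> using abs_Re_le_cmod[of "Z \<omega>"] bd[of \<omega>] by linarith
    fix s
    have "(CLINT \<omega>|M. Re (Z \<omega>) * iexp (s * Y \<omega>)) =
      (CLINT \<omega>|M. (1/2) *\<^sub>R (Z \<omega> * iexp (s * Y \<omega>) + cnj (Z \<omega>) * iexp (s * Y \<omega>)))"
      by (rule Bochner_Integration.integral_cong)
        (auto simp: complex_add_cnj scaleR_conv_of_real distrib_right[symmetric])
    also have "\<dots> = 0"
      using int int' null null' by (simp del: of_real_mult)
    finally show "(CLINT \<omega>|M. Re (Z \<omega>) * iexp (s * Y \<omega>)) = 0" .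
  qed auto
  have im: "(\<integral>\<omega>. Im (Z \<omega>) * indicator A (Y \<omega>) \<partial>M) = 0"
  proof (rule fourier_null_imp_null_real[where K=K])
    show "\<bar>Im (Z \<omega>)\<bar> \<le> K" for \<omega> using abs_Im_le_cmod[of "Z \<omega>"] bd[of \<omega>] by linarith
    fix s
    have *: "complex_of_real (Im z) = (- \<i> / 2) * (z - cnj z)" for z
      by (simp add: complex_eq_iff)
    have "(CLINT \<omega>|M. Im (Z \<omega>) * iexp (s * Y \<omega>)) =
      (CLINT \<omega>|M. (- \<i> / 2) * (Z \<omega> * iexp (s * Y \<omega>) - cnj (Z \<omega>) * iexp (s * Y \<omega>)))"
      unfolding * by (rule Bochner_Integration.integral_cong) (auto simp: algebra_simps)
    also have "\<dots> = 0"
      using int int' null null' by (simp del: of_real_mult)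
    finally show "(CLINT \<omega>|M. Im (Z \<omega>) * iexp (s * Y \<omega>)) = 0" .
  qed auto
  have intA: "complex_integrable M (\<lambda>\<omega>. Z \<omega> * indicator A (Y \<omega>))"
    by (rule integrable_const_bound[where B=K])
      (use bd in \<open>auto simp: norm_mult indicator_def intro: order_trans[OF norm_ge_zero]\<close>)
  have ind: "Re (z * indicator A y) = Re z * indicator A y" "Im (z * indicator A y) = Im z * indicator A y" for z y
    by (cases "y \<in> A"; simp)+
  show ?thesis
    using integral_Re[OF intA] integral_Im[OF intA] re im unfolding ind by (simp add: complex_eq_iff)
qed

text \<open>This replaces the uniqueness theorem for characteristic functions of random vectors. The exponentials are
exchanged for indicators one coordinate at a time, the remaining factors being absorbed in the weight; this
is why the weight is an arbitrary bounded complex variable.\<close>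

lemma (in prob_space) fourier_null_imp_null_indicators:
  fixes Z :: "'a \<Rightarrow> complex" and Y :: "'i \<Rightarrow> 'a \<Rightarrow> real"
  assumes "finite J" and "Z \<in> borel_measurable M" and "\<And>j. j \<in> J \<Longrightarrow> Y j \<in> borel_measurable M"
    and "\<And>\<omega>. cmod (Z \<omega>) \<le> K"
    and "\<And>s. (CLINT \<omega>|M. Z \<omega> * iexp (\<Sum>j\<in>J. s j * Y j \<omega>)) = 0"
    and "\<And>j. j \<in> J \<Longrightarrow> A j \<in> sets borel"
  shows "(CLINT \<omega>|M. Z \<omega> * (\<Prod>j\<in>J. indicator (A j) (Y j \<omega>))) = 0"
  using assms
proof (induction J arbitrary: Z rule: finite_induct)
  case empty
  then show ?case by simp
next
  case (insert i J)
  note [measurable] = insert.prems(1)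
  have Yi[measurable]: "Y i \<in> borel_measurable M" and Ai: "A i \<in> sets borel"
    using insert.prems by auto
  have YJ[measurable]: "j \<in> J \<Longrightarrow> Y j \<in> borel_measurable M" for j using insert.prems by auto
  have AJ[measurable]: "j \<in> J \<Longrightarrow> A j \<in> sets borel" for j using insert.prems by auto
  have bdp: "cmod (\<Prod>j\<in>J. indicator (A j) (Y j \<omega>)) \<le> 1" for \<omega>
    unfolding prod_norm[symmetric] by (rule prod_le_1) (auto simp: indicator_def)
  have K: "0 \<le> K" using insert.prems(3)[of undefined] order_trans[OF norm_ge_zero] by blast
  have "(CLINT \<omega>|M. (Z \<omega> * (\<Prod>j\<in>J. indicator (A j) (Y j \<omega>))) * iexp (r * Y i \<omega>)) = 0" for r
  proof -
    have "(CLINT \<omega>|M. (Z \<omega> * iexp (r * Y i \<omega>)) * (\<Prod>j\<in>J. indicator (A j) (Y j \<omega>))) = 0"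
    proof (rule insert.IH)
      show "(\<lambda>\<omega>. Z \<omega> * iexp (r * Y i \<omega>)) \<in> borel_measurable M" by measurable
      show "cmod (Z \<omega> * iexp (r * Y i \<omega>)) \<le> K" for \<omega>
        using insert.prems(3)[of \<omega>] by (simp add: norm_mult)
      fix s
      have sm: "(\<Sum>j\<in>J. (s(i := r)) j * Y j \<omega>) = (\<Sum>j\<in>J. s j * Y j \<omega>)" for \<omega>
        by (rule sum.cong) (use insert.hyps in auto)
      have "(CLINT \<omega>|M. Z \<omega> * iexp (r * Y i \<omega>) * iexp (\<Sum>j\<in>J. s j * Y j \<omega>)) =
        (CLINT \<omega>|M. Z \<omega> * iexp (\<Sum>j\<in>insert i J. (s(i := r)) j * Y j \<omega>))"
        by (rule Bochner_Integration.integral_cong, rule refl,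
            subst sum.insert[OF insert.hyps], subst sm)
          (simp add: exp_add distrib_left mult.assoc)
      also have "\<dots> = 0" by (rule insert.prems(4))
      finally show "(CLINT \<omega>|M. Z \<omega> * iexp (r * Y i \<omega>) * iexp (\<Sum>j\<in>J. s j * Y j \<omega>)) = 0" .
    qed (use YJ AJ in auto)
    then show ?thesis by (simp add: mult_ac)
  qed
  then have "(CLINT \<omega>|M. (Z \<omega> * (\<Prod>j\<in>J. indicator (A j) (Y j \<omega>))) * indicator (A i) (Y i \<omega>)) = 0"
    by (intro fourier_null_imp_null_complex[where K=K] Ai)
      (use insert.prems(3) bdp K in \<open>auto simp: norm_mult intro!: mult_left_le[THEN order_trans]\<close>)
  then show ?case using insert.hyps by (simp add: mult_ac)
qed

text \<open>Sets \<open>E \<inter> {\<xi>\<^sub>k \<in> A\<^sub>k for all k}\<close> with \<open>E\<close> in \<open>F0\<close> form an intersection-stable generator of the left-hand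
sigma-algebra. For such a set \<open>G\<close> the factorisation says that the weight
\<open>1\<^sub>E (exp (i t Y) - \<phi>(t))\<close> is annihilated by all characters of the \<open>\<xi>\<^sub>k\<close>, hence
\<open>1\<^sub>G - P(G)\<close> is annihilated by all characters of \<open>Y\<close>.\<close>

lemma (in prob_space) indep_set_of_charfun_factor:
  fixes Y :: "'a \<Rightarrow> real" and \<xi> :: "nat \<Rightarrow> 'a \<Rightarrow> real"
  assumes F0: "subalgebra M F0" and J: "finite J"
    and \<xi>: "\<And>k. k \<in> J \<Longrightarrow> \<xi> k \<in> borel_measurable M" and Y[measurable]: "Y \<in> borel_measurable M"
    and char_mult: "\<And>E s t. E \<in> sets F0 \<Longrightarrow>
      (CLINT \<omega>|M. indicator E \<omega> * iexp (t * Y \<omega> + (\<Sum>k\<in>J. s k * \<xi> k \<omega>))) =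
      (CLINT \<omega>|M. indicator E \<omega> * iexp (\<Sum>k\<in>J. s k * \<xi> k \<omega>)) * (CLINT \<omega>|M. iexp (t * Y \<omega>))"
  shows "indep_set (sigma_sets (space M) (sets F0 \<union> noise_events M \<xi> J))
     (sigma_sets (space M) {Y -` A \<inter> space M |A. A \<in> sets borel})"
proof -
  define \<P> where "\<P> = {{\<omega> \<in> E. \<forall>k\<in>J. \<xi> k \<omega> \<in> A k} |E A. E \<in> sets F0 \<and> (\<forall>k. A k \<in> sets (borel::real measure))}"
  have F0M: "E \<in> sets F0 \<Longrightarrow> E \<in> sets M" for E using F0 by (auto simp: subalgebra_def)
  have F0s: "E \<in> sets F0 \<Longrightarrow> E \<subseteq> space M" for E using F0M sets.sets_into_space by blast
  have sp: "space M \<in> sets F0" using F0 by (metis sets.top subalgebra_def)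
  note [measurable] = \<xi>
  have \<P>M: "\<P> \<subseteq> events"
  proof
    fix G assume "G \<in> \<P>"
    then obtain E A where G: "G = {\<omega> \<in> E. \<forall>k\<in>J. \<xi> k \<omega> \<in> A k}" and E: "E \<in> sets F0"
      and A[measurable]: "\<And>k. A k \<in> sets borel" unfolding \<P>_def by blast
    have [measurable]: "E \<in> sets M" using E F0M by simp
    have "{\<omega> \<in> space M. \<omega> \<in> E \<and> (\<forall>k\<in>J. \<xi> k \<omega> \<in> A k)} \<in> sets M" using J by measurable
    moreover have "{\<omega> \<in> space M. \<omega> \<in> E \<and> (\<forall>k\<in>J. \<xi> k \<omega> \<in> A k)} = G" using F0s[OF E] G by auto
    ultimately show "G \<in> events" by simp
  qed
  have YM: "{Y -` A \<inter> space M |A. A \<in> sets borel} \<subseteq> events" by auto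
  have ind: "indep_set \<P> {Y -` A \<inter> space M |A. A \<in> sets borel}"
  proof (rule indep_setI[OF \<P>M YM])
    fix G B assume "G \<in> \<P>" and "B \<in> {Y -` A \<inter> space M |A. A \<in> sets borel}"
    then obtain E A A' where G: "G = {\<omega> \<in> E. \<forall>k\<in>J. \<xi> k \<omega> \<in> A k}" and E: "E \<in> sets F0"
      and A[measurable]: "\<And>k. A k \<in> sets borel" and B: "B = Y -` A' \<inter> space M"
      and A'[measurable]: "A' \<in> sets borel" unfolding \<P>_def by blast
    have [measurable]: "E \<in> sets M" using E F0M by simp
    have GM[measurable]: "G \<in> sets M" using \<open>G \<in> \<P>\<close> \<P>M by auto
    define \<phi> where "\<phi> t = (CLINT \<omega>|M. iexp (t * Y \<omega>))" for t
    have phb: "cmod (\<phi> t) \<le> 1" for t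
      unfolding \<phi>_def by (rule integral_norm_bound[THEN order_trans]) (simp add: prob_space)
    have ind_G: "indicator G \<omega> = (indicator E \<omega> * (\<Prod>k\<in>J. indicator (A k) (\<xi> k \<omega>)) :: complex)" for \<omega>
    proof (cases "\<forall>k\<in>J. \<xi> k \<omega> \<in> A k")
      case True
      then show ?thesis by (simp add: G indicator_def)
    next
      case False
      then have "(\<Prod>k\<in>J. indicator (A k) (\<xi> k \<omega>)) = (0::complex)"
        using J by (auto simp: prod_zero_iff indicator_def)
      then show ?thesis using False by (auto simp: G indicator_def)
    qed
    have null: "(CLINT \<omega>|M. (indicator E \<omega> * (iexp (t * Y \<omega>) - \<phi> t)) * (\<Prod>k\<in>J. indicator (A k) (\<xi> k \<omega>))) = 0" for t
    proof (rule fourier_null_imp_null_indicators[where K=2, OF J])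
      have "cmod (iexp (t * Y \<omega>) - \<phi> t) \<le> 2" for \<omega>
        using norm_triangle_ineq4[of "iexp (t * Y \<omega>)" "\<phi> t"] phb[of t] by simp
      then show "cmod (indicator E \<omega> * (iexp (t * Y \<omega>) - \<phi> t)) \<le> 2" for \<omega>
        by (auto simp: indicator_def norm_mult)
      fix s
      have i1: "complex_integrable M (\<lambda>\<omega>. indicator E \<omega> * iexp (t * Y \<omega> + (\<Sum>k\<in>J. s k * \<xi> k \<omega>)))"
        by (rule integrable_const_bound[where B=1]) (auto simp: norm_mult indicator_def)
      have i2: "complex_integrable M (\<lambda>\<omega>. indicator E \<omega> * iexp (\<Sum>k\<in>J. s k * \<xi> k \<omega>))"
        by (rule integrable_const_bound[where B=1]) (auto simp: norm_mult indicator_def)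
      have "(CLINT \<omega>|M. indicator E \<omega> * (iexp (t * Y \<omega>) - \<phi> t) * iexp (\<Sum>k\<in>J. s k * \<xi> k \<omega>)) =
        (CLINT \<omega>|M. indicator E \<omega> * iexp (t * Y \<omega> + (\<Sum>k\<in>J. s k * \<xi> k \<omega>))
          - indicator E \<omega> * iexp (\<Sum>k\<in>J. s k * \<xi> k \<omega>) * \<phi> t)"
        by (rule Bochner_Integration.integral_cong) (auto simp: exp_add algebra_simps)
      also have "\<dots> = 0"
        using i1 i2 char_mult[OF E, of t s] unfolding \<phi>_def
        by (subst Bochner_Integration.integral_diff) auto
      finally show "(CLINT \<omega>|M. indicator E \<omega> * (iexp (t * Y \<omega>) - \<phi> t) * iexp (\<Sum>k\<in>J. s k * \<xi> k \<omega>)) = 0" .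
    qed (use A in auto)
    have iG: "complex_integrable M (\<lambda>\<omega>. indicator G \<omega> * iexp (t * Y \<omega>))" for t
      by (rule integrable_const_bound[where B=1]) (auto simp: norm_mult indicator_def)
    have iG': "complex_integrable M (indicator G)"
      by (rule integrable_const_bound[where B=1]) (auto simp: indicator_def)
    have pG: "(CLINT \<omega>|M. indicator G \<omega>) = prob G"
    proof -
      have "(CLINT \<omega>|M. indicator G \<omega>) = (CLINT \<omega>|M. complex_of_real (indicator G \<omega>))"
        by (rule Bochner_Integration.integral_cong) (auto simp: indicator_def)
      then show ?thesis by simp
    qed
    have EG: "(CLINT \<omega>|M. indicator G \<omega> * iexp (t * Y \<omega>)) = prob G * \<phi> t" for t
    proof -
      have "0 = (CLINT \<omega>|M. indicator G \<omega> * iexp (t * Y \<omega>) - indicator G \<omega> * \<phi> t)"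
        unfolding ind_G null[of t, symmetric]
        by (rule Bochner_Integration.integral_cong) (auto simp: algebra_simps)
      also have "\<dots> = (CLINT \<omega>|M. indicator G \<omega> * iexp (t * Y \<omega>)) - prob G * \<phi> t"
        using iG iG' pG by (subst Bochner_Integration.integral_diff) auto
      finally show ?thesis by simp
    qed
    have "(\<integral>\<omega>. (indicator G \<omega> - prob G) * indicator A' (Y \<omega>) \<partial>M) = 0"
    proof (rule fourier_null_imp_null_real[where K=1])
      show "\<bar>indicator G \<omega> - prob G\<bar> \<le> 1" for \<omega>
        using prob_le_1[of G] measure_nonneg[of M G] by (auto simp: indicator_def abs_if; linarith)
      fix t
      have iY: "complex_integrable M (\<lambda>\<omega>. iexp (t * Y \<omega>))"
        by (rule integrable_const_bound[where B=1]) (auto simp: norm_mult indicator_def)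
      have "(CLINT \<omega>|M. (indicator G \<omega> - prob G) * iexp (t * Y \<omega>)) =
        (CLINT \<omega>|M. indicator G \<omega> * iexp (t * Y \<omega>) - prob G * iexp (t * Y \<omega>))"
        by (rule Bochner_Integration.integral_cong) (auto simp: algebra_simps indicator_def)
      also have "\<dots> = 0" using iG iY EG by (simp add: \<phi>_def del: of_real_mult)
      finally show "(CLINT \<omega>|M. complex_of_real (indicator G \<omega> - prob G) * iexp (t * Y \<omega>)) = 0"
        by simp
    qed auto
    moreover have "(\<integral>\<omega>. (indicator G \<omega> - prob G) * indicator A' (Y \<omega>) \<partial>M) =
      (\<integral>\<omega>. indicator (G \<inter> B) \<omega> - prob G * indicator B \<omega> \<partial>M)"
      by (rule Bochner_Integration.integral_cong) (auto simp: B indicator_def)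
    moreover have "(\<integral>\<omega>. indicator (G \<inter> B) \<omega> - prob G * indicator B \<omega> \<partial>M) =
        prob (G \<inter> B) - prob G * prob B"
    proof -
      have [measurable]: "B \<in> sets M" using B by simp
      have "integrable M (indicat_real (G \<inter> B))" "integrable M (\<lambda>\<omega>. prob G * indicat_real B \<omega>)"
        by (auto intro!: integrable_const_bound[where B=1] simp: indicator_def)
      then show ?thesis by (subst Bochner_Integration.integral_diff) auto
    qed
    ultimately show "prob (G \<inter> B) = prob G * prob B" by simp
  qed
  have st1: "Int_stable \<P>"
  proof (rule Int_stableI)
    fix a b assume "a \<in> \<P>" "b \<in> \<P>"
    then obtain E A E' A' where ab: "a = {\<omega> \<in> E. \<forall>k\<in>J. \<xi> k \<omega> \<in> A k}"
      "b = {\<omega> \<in> E'. \<forall>k\<in>J. \<xi> k \<omega> \<in> A' k}" and E: "E \<in> sets F0" "E' \<in> sets F0"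
      and A: "\<forall>k. A k \<in> sets borel" "\<forall>k. A' k \<in> sets borel" unfolding \<P>_def by blast
    have "a \<inter> b = {\<omega> \<in> E \<inter> E'. \<forall>k\<in>J. \<xi> k \<omega> \<in> A k \<inter> A' k}" using ab by auto
    moreover have "E \<inter> E' \<in> sets F0" using E by auto
    moreover have "\<forall>k. A k \<inter> A' k \<in> sets borel" using A by auto
    ultimately show "a \<inter> b \<in> \<P>" unfolding \<P>_def
      by (intro CollectI exI[of _ "E \<inter> E'"] exI[of _ "\<lambda>k. A k \<inter> A' k"]) auto
  qed
  have st2: "Int_stable {Y -` A \<inter> space M |A. A \<in> sets borel}"
  proof (rule Int_stableI)
    fix a b assume "a \<in> {Y -` A \<inter> space M |A. A \<in> sets borel}" "b \<in> {Y -` A \<inter> space M |A. A \<in> sets borel}"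
    then obtain A A' where "a = Y -` A \<inter> space M" "b = Y -` A' \<inter> space M" "A \<in> sets borel" "A' \<in> sets borel"
      by blast
    then show "a \<inter> b \<in> {Y -` A \<inter> space M |A. A \<in> sets borel}"
      by (intro CollectI exI[of _ "A \<inter> A'"]) auto
  qed
  have gen: "sigma_sets (space M) (sets F0 \<union> noise_events M \<xi> J) \<subseteq> sigma_sets (space M) \<P>"
  proof (rule sigma_sets_mono, rule Un_least)
    show "sets F0 \<subseteq> sigma_sets (space M) \<P>"
    proof
      fix E assume "E \<in> sets F0"
      then have "E \<in> \<P>" unfolding \<P>_def by (intro CollectI exI[of _ E] exI[of _ "\<lambda>_. UNIV"]) auto
      then show "E \<in> sigma_sets (space M) \<P>" by (rule sigma_sets.Basic)
    qed
    show "noise_events M \<xi> J \<subseteq> sigma_sets (space M) \<P>"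
    proof
      fix E assume "E \<in> noise_events M \<xi> J"
      then obtain k S where k: "k \<in> J" "E = \<xi> k -` S \<inter> space M" "S \<in> sets borel"
        unfolding noise_events_def by auto
      then have "E \<in> \<P>" unfolding \<P>_def
        by (intro CollectI exI[of _ "space M"] exI[of _ "\<lambda>i. if i = k then S else UNIV"]) (auto simp: sp)
      then show "E \<in> sigma_sets (space M) \<P>" by (rule sigma_sets.Basic)
    qed
  qed
  have "indep_set (sigma_sets (space M) \<P>) (sigma_sets (space M) {Y -` A \<inter> space M |A. A \<in> sets borel})"
    by (rule indep_set_sigma_sets[OF ind st1 st2])
  then show ?thesis
    unfolding indep_sets2_eq using gen by blast
qed

section \<open>Conditioning on the innovation\<close>

lemma (in prob_space) indep_var_of_indep_algebras:
  assumes ind: "indep_set (sets F1) (sets F2)" and sp: "space F1 = space M" "space F2 = space M"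
    and X: "X \<in> measurable F1 S" and Y: "Y \<in> measurable F2 T"
  shows "indep_var S X T Y"
proof -
  have sub: "sets F1 \<subseteq> events" "sets F2 \<subseteq> events"
    using ind unfolding indep_sets2_eq by auto
  have "sigma_sets (space M) {X -` A \<inter> space M |A. A \<in> sets S} \<subseteq> sets F1"
    unfolding sp(1)[symmetric] by (rule sets.sigma_sets_subset) (use X in \<open>auto simp: measurable_sets\<close>)
  moreover have "sigma_sets (space M) {Y -` A \<inter> space M |A. A \<in> sets T} \<subseteq> sets F2"
    unfolding sp(2)[symmetric] by (rule sets.sigma_sets_subset) (use Y in \<open>auto simp: measurable_sets\<close>)
  moreover have "random_variable S X" "random_variable T Y"
    using measurable_from_subalg[of M F1, OF _ X] measurable_from_subalg[of M F2, OF _ Y] sub sp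
    by (auto simp: subalgebra_def)
  ultimately show ?thesis
    using ind unfolding indep_var_eq indep_sets2_eq by blast
qed

text \<open>The set where \<open>g\<close> is negative is open and a null set, and nonempty open sets are not null.\<close>

lemma nonneg_of_AE_lborel:
  fixes g :: "real \<Rightarrow> real"
  assumes ae: "AE z in lborel. 0 \<le> g z" and c: "continuous_on UNIV g"
  shows "0 \<le> g z"
proof (rule ccontr)
  assume "\<not> 0 \<le> g z"
  have o: "open {z. g z < 0}"
    using open_Collect_less[OF c continuous_on_const[of UNIV 0]] by simp
  have "emeasure lborel {z. \<not> 0 \<le> g z} = 0"
    using ae AE_iff_measurable[of "{z. \<not> 0 \<le> g z}" lborel "\<lambda>z. 0 \<le> g z"] o by (simp add: not_le)
  then have "{z. g z < 0} \<in> null_sets lborel" using o by (auto simp: null_sets_def not_le)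
  then have "negligible {z. g z < 0}"
    by (simp add: negligible_iff_null_sets null_sets_completionI)
  moreover have "{z. g z < 0} \<noteq> {}" using \<open>\<not> 0 \<le> g z\<close> by (metis empty_iff mem_Collect_eq not_le)
  ultimately show False using open_not_negligible[OF o] by blast
qed

text \<open>The joint law of the identity into \<open>F\<close> and of \<open>\<eta>\<close> is a product measure, so by Fubini the inequality holds for
almost every \<open>\<omega>\<close> and then Lebesgue-almost every \<open>z\<close>; continuity in \<open>z\<close> removes the second exception. This lets
one move the innovation while everything known before it is held fixed.\<close>

lemma (in prob_space) AE_all_innovations:
  fixes \<eta> :: "'a \<Rightarrow> real" and g :: "'a \<Rightarrow> real \<Rightarrow> real"
  assumes ind: "indep_set (sets F) (sigma_sets (space M) {\<eta> -` A \<inter> space M |A. A \<in> sets borel})"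
    and sp: "space F = space M"
    and N: "distributed M lborel \<eta> std_normal_density"
    and g: "(\<lambda>(\<omega>, z). g \<omega> z) \<in> borel_measurable (F \<Otimes>\<^sub>M borel)"
    and c: "\<And>\<omega>. \<omega> \<in> space M \<Longrightarrow> continuous_on UNIV (g \<omega>)"
    and ae: "AE \<omega> in M. 0 \<le> g \<omega> (\<eta> \<omega>)"
  shows "AE \<omega> in M. \<forall>z. 0 \<le> g \<omega> z"
proof -
  have \<eta>[measurable]: "\<eta> \<in> borel_measurable M" using N by (auto simp: distributed_def)
  have "subalgebra M F" using ind sp unfolding indep_sets2_eq subalgebra_def by auto
  then have F[measurable]: "(\<lambda>\<omega>. \<omega>) \<in> measurable M F"
    by (auto simp: subalgebra_def intro!: measurableI)
  interpret F: prob_space "distr M F (\<lambda>\<omega>. \<omega>)" by (rule prob_space_distr) simp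
  interpret e: prob_space "distr M borel \<eta>" by (rule prob_space_distr) simp
  interpret pair_sigma_finite "distr M F (\<lambda>\<omega>. \<omega>)" "distr M borel \<eta>" ..
  have eq: "distr M F (\<lambda>\<omega>. \<omega>) \<Otimes>\<^sub>M distr M borel \<eta> = distr M (F \<Otimes>\<^sub>M borel) (\<lambda>\<omega>. (\<omega>, \<eta> \<omega>))"
  proof (rule pair_measure_eqI)
    fix A B assume "A \<in> sets (distr M F (\<lambda>\<omega>. \<omega>))" "B \<in> sets (distr M borel \<eta>)"
    then have [measurable]: "A \<in> sets F" "B \<in> sets borel" by auto
    have AM: "A \<subseteq> space M" using sets.sets_into_space[of A F] sp by simp
    have "prob (A \<inter> (\<eta> -` B \<inter> space M)) = prob A * prob (\<eta> -` B \<inter> space M)"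
      by (rule indep_setD[OF ind]) (auto intro!: sigma_sets.Basic)
    moreover have "(\<lambda>\<omega>. (\<omega>, \<eta> \<omega>)) -` (A \<times> B) \<inter> space M = A \<inter> (\<eta> -` B \<inter> space M)"
      using AM by auto
    moreover have "(\<lambda>\<omega>. \<omega>) -` A \<inter> space M = A" using AM by auto
    ultimately show "emeasure (distr M F (\<lambda>\<omega>. \<omega>)) A * emeasure (distr M borel \<eta>) B =
        emeasure (distr M (F \<Otimes>\<^sub>M borel) (\<lambda>\<omega>. (\<omega>, \<eta> \<omega>))) (A \<times> B)"
      by (simp add: emeasure_distr emeasure_eq_measure ennreal_mult''[symmetric])
  qed (auto simp: F.sigma_finite_measure_axioms e.sigma_finite_measure_axioms cong: sets_pair_measure_cong)
  have m[measurable]: "Measurable.pred (F \<Otimes>\<^sub>M borel) (\<lambda>w. 0 \<le> (case w of (\<omega>, z) \<Rightarrow> g \<omega> z))"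
    using g by measurable
  have "AE w in distr M (F \<Otimes>\<^sub>M borel) (\<lambda>\<omega>. (\<omega>, \<eta> \<omega>)). 0 \<le> (case w of (\<omega>, z) \<Rightarrow> g \<omega> z)"
    by (subst AE_distr_iff) (use ae m in \<open>auto simp: pred_def\<close>)
  then have "AE \<omega> in distr M F (\<lambda>\<omega>. \<omega>). AE z in distr M borel \<eta>. 0 \<le> g \<omega> z"
    unfolding eq[symmetric] by (drule_tac AE_pair) simp
  then have "AE \<omega> in M. AE z in distr M borel \<eta>. 0 \<le> g \<omega> z"
    by (rule AE_distrD[rotated]) simp
  then show ?thesis using AE_space
  proof eventually_elim
    case (elim \<omega>)
    have d: "distr M borel \<eta> = density lborel std_normal_density"
      using distributed_distr_eq_density[OF N] by (metis distr_cong sets_lborel)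
    have "AE z in lborel. 0 \<le> g \<omega> z"
      using elim(1) unfolding d by (subst (asm) AE_density) (auto simp: normal_density_pos)
    then show ?case using nonneg_of_AE_lborel c elim(2) by blast
  qed
qed

section \<open>Centered Gaussian variables\<close>

lemma integrable_mult_of_squares:
  fixes f g :: "'a \<Rightarrow> real"
  assumes [measurable]: "f \<in> borel_measurable M" "g \<in> borel_measurable M"
    and int: "integrable M (\<lambda>\<omega>. (f \<omega>)\<^sup>2)" "integrable M (\<lambda>\<omega>. (g \<omega>)\<^sup>2)"
  shows "integrable M (\<lambda>\<omega>. f \<omega> * g \<omega>)"
proof (rule Bochner_Integration.integrable_bound)
  show "integrable M (\<lambda>\<omega>. (f \<omega>)\<^sup>2 + (g \<omega>)\<^sup>2)" using int by simp
  show "(\<lambda>\<omega>. f \<omega> * g \<omega>) \<in> borel_measurable M" by measurable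
  show "AE \<omega> in M. norm (f \<omega> * g \<omega>) \<le> norm ((f \<omega>)\<^sup>2 + (g \<omega>)\<^sup>2)"
  proof (rule AE_I2)
    fix \<omega>
    have "2 * (\<bar>f \<omega>\<bar> * \<bar>g \<omega>\<bar>) \<le> \<bar>f \<omega>\<bar> ^ 2 + \<bar>g \<omega>\<bar> ^ 2"
      using sum_squares_bound[of "\<bar>f \<omega>\<bar>" "\<bar>g \<omega>\<bar>"] by simp
    moreover have "0 \<le> \<bar>f \<omega>\<bar> * \<bar>g \<omega>\<bar>" by simp
    moreover have "norm ((f \<omega>)\<^sup>2 + (g \<omega>)\<^sup>2) = \<bar>f \<omega>\<bar> ^ 2 + \<bar>g \<omega>\<bar> ^ 2" by simp
    ultimately show "norm (f \<omega> * g \<omega>) \<le> norm ((f \<omega>)\<^sup>2 + (g \<omega>)\<^sup>2)"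
      unfolding real_norm_def abs_mult by linarith
  qed
qed

lemma (in prob_space) gaussian_rv_centered_cases:
  assumes Y: "gaussian_rv M Y" and m: "(\<integral>\<omega>. Y \<omega> \<partial>M) = 0"
  obtains (zero) "AE \<omega> in M. Y \<omega> = 0"
  | (normal) \<sigma> where "0 < \<sigma>" "distributed M lborel Y (normal_density 0 \<sigma>)"
proof -
  have [measurable]: "Y \<in> borel_measurable M" using Y by (auto simp: gaussian_rv_def)
  consider (c) \<mu> where "AE \<omega> in M. Y \<omega> = \<mu>" | (n) \<mu> \<sigma> where "0 < \<sigma>" "distributed M lborel Y (normal_density \<mu> \<sigma>)"
    using Y unfolding gaussian_rv_def by blast
  then show ?thesis
  proof cases
    case c
    have "(\<integral>\<omega>. Y \<omega> \<partial>M) = (\<integral>\<omega>. \<mu> \<partial>M)" using c by (intro integral_cong_AE) auto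
    then have "\<mu> = 0" using m by (simp add: prob_space)
    then show ?thesis using c zero by simp
  next
    case n
    then show ?thesis using normal normal_distributed_expectation[OF n] m by simp
  qed
qed

lemma (in prob_space) gaussian_rv_moment:
  assumes Y: "gaussian_rv M Y" and m: "(\<integral>\<omega>. Y \<omega> \<partial>M) = 0"
  shows "integrable M (\<lambda>\<omega>. \<bar>Y \<omega>\<bar> ^ k)"
proof -
  have [measurable]: "Y \<in> borel_measurable M" using Y by (auto simp: gaussian_rv_def)
  from Y m show ?thesis
  proof (cases rule: gaussian_rv_centered_cases)
    case zero
    then have "AE \<omega> in M. \<bar>Y \<omega>\<bar> ^ k = 0 ^ k" by eventually_elim simp
    then have "integrable M (\<lambda>\<omega>. \<bar>Y \<omega>\<bar> ^ k) \<longleftrightarrow> integrable M (\<lambda>\<omega>. 0 ^ k :: real)"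
      by (intro integrable_cong_AE) auto
    then show ?thesis by simp
  next
    case (normal \<sigma>)
    then show ?thesis
      using distributed_integrable[OF normal(2), of "\<lambda>x. \<bar>x\<bar> ^ k"] integrable_normal_moment_abs[OF normal(1), of 0 k]
      by (simp add: less_imp_le)
  qed
qed

lemma (in prob_space) gaussian_rv_second_moment:
  assumes "0 < \<sigma>" "distributed M lborel Y (normal_density 0 \<sigma>)"
  shows "(\<integral>\<omega>. (Y \<omega>)\<^sup>2 \<partial>M) = \<sigma>\<^sup>2"
  using normal_distributed_variance[OF assms] normal_distributed_expectation[OF assms] by simp

text \<open>The value at frequency \<open>1\<close> carries all the information, since multiples and sums within a Gaussian
family are again Gaussian.\<close>

lemma (in prob_space) gaussian_rv_charfun:
  assumes Y: "gaussian_rv M Y" and m: "(\<integral>\<omega>. Y \<omega> \<partial>M) = 0"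
  shows "(CLINT \<omega>|M. iexp (Y \<omega>)) = exp (- (\<integral>\<omega>. (Y \<omega>)\<^sup>2 \<partial>M) / 2)"
proof -
  have Ym[measurable]: "Y \<in> borel_measurable M" using Y by (auto simp: gaussian_rv_def)
  from Y m show ?thesis
  proof (cases rule: gaussian_rv_centered_cases)
    case zero
    have "(CLINT \<omega>|M. iexp (Y \<omega>)) = (CLINT \<omega>|M. 1)"
      using zero by (intro integral_cong_AE) auto
    moreover have "(\<integral>\<omega>. (Y \<omega>)\<^sup>2 \<partial>M) = (\<integral>\<omega>. 0 \<partial>M)"
      using zero by (intro integral_cong_AE) auto
    ultimately show ?thesis by (simp add: prob_space)
  next
    case (normal \<sigma>)
    have D: "distributed M lborel (\<lambda>\<omega>. Y \<omega> / \<sigma>) std_normal_density"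
      using normal_density_affine[OF normal(2,1), of "1 / \<sigma>" 0] normal(1) by simp
    have dd: "distr M borel (\<lambda>\<omega>. Y \<omega> / \<sigma>) = std_normal_distribution"
      using distributed_distr_eq_density[OF D] by (metis distr_cong sets_lborel)
    have "(CLINT \<omega>|M. iexp (Y \<omega>)) = (CLINT \<omega>|M. iexp (\<sigma> * (Y \<omega> / \<sigma>)))"
      using normal(1) by simp
    also have "\<dots> = char (distr M borel (\<lambda>\<omega>. Y \<omega> / \<sigma>)) \<sigma>"
      unfolding char_def by (subst integral_distr) auto
    also have "\<dots> = exp (- \<sigma>\<^sup>2 / 2)"
      unfolding dd by (simp add: char_std_normal_distribution)
    finally show ?thesis by (simp add: gaussian_rv_second_moment[OF normal])
  qed
qed

lemma (in prob_space) gaussian_rv_std_normal: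
  assumes Y: "gaussian_rv M Y" and m: "(\<integral>\<omega>. Y \<omega> \<partial>M) = 0" and v: "(\<integral>\<omega>. (Y \<omega>)\<^sup>2 \<partial>M) = 1"
  shows "distributed M lborel Y std_normal_density"
proof -
  have [measurable]: "Y \<in> borel_measurable M" using Y by (auto simp: gaussian_rv_def)
  from Y m show ?thesis
  proof (cases rule: gaussian_rv_centered_cases)
    case zero
    have "(\<integral>\<omega>. (Y \<omega>)\<^sup>2 \<partial>M) = (\<integral>\<omega>. 0 \<partial>M)"
      using zero by (intro integral_cong_AE) auto
    then show ?thesis using v by simp
  next
    case (normal \<sigma>)
    then have "\<sigma> = 1" using gaussian_rv_second_moment[OF normal] v
      by (simp add: power2_eq_1_iff)
    then show ?thesis using normal by simp
  qed
qed

section \<open>The noise filtration\<close>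

lemma noise_events_Pow: "noise_events M \<xi> K \<subseteq> Pow (space M)"
  by (auto simp: noise_events_def)

lemma measurable_noise_generated:
  assumes "k \<in> K" shows "\<xi> k \<in> borel_measurable (sigma (space M) (noise_events M \<xi> K))"
proof (rule measurableI)
  fix S :: "real set" assume "S \<in> sets borel"
  then have "\<xi> k -` S \<inter> space M \<in> noise_events M \<xi> K" using assms by (auto simp: noise_events_def)
  then show "\<xi> k -` S \<inter> space (sigma (space M) (noise_events M \<xi> K)) \<in> sets (sigma (space M) (noise_events M \<xi> K))"
    by (simp add: space_measure_of_conv sets_measure_of[OF noise_events_Pow] sigma_sets.Basic)
qed simp

lemma noise_filtration_sets:
  assumes "subalgebra M F0"
  shows "sets (noise_filtration M F0 \<xi> n) = sigma_sets (space M) (sets F0 \<union> noise_events M \<xi> {..<n})"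
proof -
  have "sets F0 \<subseteq> Pow (space M)" using assms sets.space_closed[of F0] by (auto simp: subalgebra_def)
  then have "sets F0 \<union> noise_events M \<xi> {..<n} \<subseteq> Pow (space M)" using noise_events_Pow by (rule Un_least)
  then show ?thesis unfolding noise_filtration_def by (rule sets_measure_of)
qed

section \<open>Whitening a Gaussian sequence\<close>

locale centered_gaussian_sequence = prob_space M for M :: "'w measure" +
  fixes \<xi> :: "nat \<Rightarrow> 'w \<Rightarrow> real" and \<rho> :: "nat \<Rightarrow> nat \<Rightarrow> real"
  assumes gaussian: "gaussian_process M UNIV \<xi>"
    and mean_zero: "(\<integral>\<omega>. \<xi> n \<omega> \<partial>M) = 0"
    and covariance: "(\<integral>\<omega>. \<xi> n \<omega> * \<xi> k \<omega> \<partial>M) = \<rho> n k"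
begin

lemma combination: "finite I \<Longrightarrow> gaussian_rv M (\<lambda>\<omega>. \<Sum>k\<in>I. r k * \<xi> k \<omega>)"
  using gaussian by (simp add: gaussian_process_def)

lemma coordinate: "gaussian_rv M (\<xi> n)"
  using combination[of "{n}" "\<lambda>_. 1"] by simp

lemma measurable_noise[measurable]: "\<xi> n \<in> borel_measurable M"
  using coordinate by (simp add: gaussian_rv_def)

lemma noise_moment: "integrable M (\<lambda>\<omega>. \<bar>\<xi> n \<omega>\<bar> ^ k)"
  by (rule gaussian_rv_moment[OF coordinate mean_zero])

lemma integrable_noise: "integrable M (\<xi> n)"
  by (rule Bochner_Integration.integrable_bound[OF noise_moment[of n 1]]) auto

lemma integrable_noise_product: "integrable M (\<lambda>\<omega>. \<xi> n \<omega> * \<xi> k \<omega>)"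
  using noise_moment[of n 2] noise_moment[of k 2] by (intro integrable_mult_of_squares) simp_all

lemma combination_mean: "(\<integral>\<omega>. (\<Sum>k\<in>I. r k * \<xi> k \<omega>) \<partial>M) = 0"
  by (simp add: Bochner_Integration.integral_sum integrable_noise mean_zero)

end

text \<open>The recursion for \<open>\<beta>\<close> is the Cholesky factorisation of the covariance matrix, solved for one entry.\<close>

lemma whitening_factor_decomposition:
  assumes \<beta>: "whitening_factor \<rho> \<beta>" and kn: "k \<le> n"
  shows "\<rho> n k = (\<Sum>j\<le>k. \<beta> n j * \<beta> k j)"
proof -
  have "\<beta> k k \<noteq> 0"
    using \<beta> unfolding whitening_factor_def by (metis less_irrefl)
  moreover have "\<beta> n k = (\<rho> n k - (\<Sum>j<k. \<beta> n j * \<beta> k j)) / \<beta> k k"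
    using \<beta> kn unfolding whitening_factor_def by blast
  ultimately have "\<beta> n k * \<beta> k k = \<rho> n k - (\<Sum>j<k. \<beta> n j * \<beta> k j)" by (simp add: field_simps)
  then show ?thesis by (simp add: lessThan_Suc_atMost[symmetric])
qed

locale whitened_gaussian_sequence = centered_gaussian_sequence M \<xi> \<rho>
  for M :: "'w measure" and \<xi> :: "nat \<Rightarrow> 'w \<Rightarrow> real" and \<rho> :: "nat \<Rightarrow> nat \<Rightarrow> real" +
  fixes \<beta> \<alpha> :: "nat \<Rightarrow> nat \<Rightarrow> real"
  assumes factor: "whitening_factor \<rho> \<beta>" and inverse: "lower_triangular_inverse \<beta> \<alpha>"
begin

abbreviation \<eta> :: "nat \<Rightarrow> 'w \<Rightarrow> real" where "\<eta> \<equiv> white_noise \<alpha> \<xi>"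

lemma factor_upper: "n < k \<Longrightarrow> \<beta> n k = 0" and factor_diag: "0 < \<beta> n n"
  using factor unfolding whitening_factor_def by blast+

lemma inverse_upper: "n < k \<Longrightarrow> \<alpha> n k = 0"
  and inverse_mult: "(\<Sum>k\<le>n. \<alpha> n k * \<beta> k m) = (if n = m then 1 else 0)"
  using inverse unfolding lower_triangular_inverse_def by blast+

lemma rho_sym: "\<rho> n k = \<rho> k n"
  unfolding covariance[symmetric] by (simp add: mult.commute)

lemma covariance_factor:
  assumes "m \<le> n" "k \<le> n"
  shows "\<rho> k m = (\<Sum>j\<le>n. \<beta> k j * \<beta> m j)"
proof -
  have *: "\<rho> k m = (\<Sum>j\<le>n. \<beta> k j * \<beta> m j)" if "m \<le> k" "k \<le> n" for k m
    unfolding whitening_factor_decomposition[OF factor that(1)]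
    by (rule sum.mono_neutral_left) (use that factor_upper in auto)
  show ?thesis
  proof (cases "m \<le> k")
    case True
    then show ?thesis using * assms by simp
  next
    case False
    then show ?thesis using *[of k m] assms rho_sym[of k m] by (simp add: mult.commute)
  qed
qed

text \<open>In matrix form \<open>\<rho> = \<beta> \<beta>\<^sup>T\<close> and \<open>\<eta> = \<alpha> \<xi>\<close> with \<open>\<alpha> \<beta> = 1\<close>, so the covariance of \<open>\<eta>\<close> with \<open>\<xi>\<close> is
\<open>\<alpha> \<beta> \<beta>\<^sup>T = \<beta>\<^sup>T\<close>, which is upper triangular.\<close>

lemma white_noise_covariance:
  assumes "m \<le> n"
  shows "(\<integral>\<omega>. \<eta> n \<omega> * \<xi> m \<omega> \<partial>M) = (if m = n then \<beta> n n else 0)"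
proof -
  have "(\<integral>\<omega>. \<eta> n \<omega> * \<xi> m \<omega> \<partial>M) = (\<integral>\<omega>. (\<Sum>k\<le>n. \<alpha> n k * (\<xi> k \<omega> * \<xi> m \<omega>)) \<partial>M)"
    by (simp add: white_noise_def sum_distrib_right mult.assoc)
  also have "\<dots> = (\<Sum>k\<le>n. \<alpha> n k * \<rho> k m)"
    by (simp add: Bochner_Integration.integral_sum integrable_noise_product covariance)
  also have "\<dots> = (\<Sum>k\<le>n. \<Sum>j\<le>n. \<alpha> n k * (\<beta> k j * \<beta> m j))"
    by (rule sum.cong) (use assms covariance_factor in \<open>auto simp: sum_distrib_left\<close>)
  also have "\<dots> = (\<Sum>j\<le>n. \<beta> m j * (\<Sum>k\<le>n. \<alpha> n k * \<beta> k j))"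
    by (subst sum.swap) (simp add: sum_distrib_left mult_ac)
  also have "\<dots> = \<beta> m n"
    unfolding inverse_mult by (simp add: if_distrib cong: if_cong)
  also have "\<dots> = (if m = n then \<beta> n n else 0)" using assms factor_upper[of m n] by auto
  finally show ?thesis .
qed

lemma inverse_diag: "\<alpha> n n * \<beta> n n = 1"
proof -
  have "1 = (\<Sum>k\<le>n. \<alpha> n k * \<beta> k n)" by (simp add: inverse_mult)
  also have "\<dots> = (\<Sum>k\<in>{n}. \<alpha> n k * \<beta> k n)"
    by (rule sum.mono_neutral_right) (auto simp: factor_upper)
  finally show ?thesis by simp
qed

lemma gaussian_white_noise: "gaussian_rv M (\<eta> n)"
  using combination[of "{..n}" "\<alpha> n"] by (simp add: white_noise_def[abs_def])

lemma measurable_white_noise[measurable]: "\<eta> n \<in> borel_measurable M"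
  using gaussian_white_noise by (simp add: gaussian_rv_def)

lemma white_noise_mean: "(\<integral>\<omega>. \<eta> n \<omega> \<partial>M) = 0"
  using combination_mean[of "\<alpha> n" "{..n}"] by (simp add: white_noise_def)

lemma integrable_white_noise_product: "integrable M (\<lambda>\<omega>. \<eta> n \<omega> * \<xi> m \<omega>)"
  unfolding white_noise_def sum_distrib_right mult.assoc
  by (intro Bochner_Integration.integrable_sum Bochner_Integration.integrable_mult_right integrable_noise_product)

lemma integrable_white_noise_square: "integrable M (\<lambda>\<omega>. (\<eta> n \<omega>)\<^sup>2)"
  using gaussian_rv_moment[OF gaussian_white_noise white_noise_mean, where k=2] by simp

lemma white_noise_variance: "(\<integral>\<omega>. (\<eta> n \<omega>)\<^sup>2 \<partial>M) = 1"
proof -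
  have "(\<eta> n \<omega>)\<^sup>2 = (\<Sum>k\<le>n. \<alpha> n k * (\<eta> n \<omega> * \<xi> k \<omega>))" for \<omega>
  proof -
    have "(\<Sum>k\<le>n. \<alpha> n k * (\<eta> n \<omega> * \<xi> k \<omega>)) = \<eta> n \<omega> * (\<Sum>k\<le>n. \<alpha> n k * \<xi> k \<omega>)"
      unfolding sum_distrib_left by (rule sum.cong) auto
    then show ?thesis by (simp add: power2_eq_square white_noise_def)
  qed
  then have "(\<integral>\<omega>. (\<eta> n \<omega>)\<^sup>2 \<partial>M) = (\<integral>\<omega>. (\<Sum>k\<le>n. \<alpha> n k * (\<eta> n \<omega> * \<xi> k \<omega>)) \<partial>M)"
    by simp
  also have "\<dots> = (\<Sum>k\<le>n. \<alpha> n k * (if k = n then \<beta> n n else 0))"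
    by (simp add: Bochner_Integration.integral_sum integrable_white_noise_product white_noise_covariance)
  also have "\<dots> = 1" by (simp add: inverse_diag if_distrib cong: if_cong)
  finally show ?thesis .
qed

lemma std_normal_white_noise: "distributed M lborel (\<eta> n) std_normal_density"
  by (rule gaussian_rv_std_normal[OF gaussian_white_noise white_noise_mean white_noise_variance])

text \<open>Only \<open>\<alpha> \<beta> = 1\<close> is given. Since \<open>\<alpha>\<close> is triangular with nonzero diagonal, \<open>\<alpha> (\<beta> \<eta>) = \<eta> = \<alpha> \<xi>\<close> can be
solved row by row.\<close>

lemma noise_of_white_noise: "\<xi> n \<omega> = (\<Sum>k\<le>n. \<beta> n k * \<eta> k \<omega>)"
proof (induction n rule: less_induct)
  case (less n)
  define \<zeta> where "\<zeta> k = (\<Sum>j\<le>k. \<beta> k j * \<eta> j \<omega>)" for k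
  have "(\<Sum>k\<le>n. \<alpha> n k * \<zeta> k) = (\<Sum>k\<le>n. \<Sum>j\<le>n. \<alpha> n k * (\<beta> k j * \<eta> j \<omega>))"
    unfolding \<zeta>_def sum_distrib_left
    by (intro sum.cong refl sum.mono_neutral_left) (auto simp: factor_upper)
  also have "\<dots> = (\<Sum>j\<le>n. (\<Sum>k\<le>n. \<alpha> n k * \<beta> k j) * \<eta> j \<omega>)"
    by (subst sum.swap) (simp add: sum_distrib_right mult.assoc)
  also have "\<dots> = \<eta> n \<omega>" unfolding inverse_mult by (simp add: if_distrib if_distribR cong: if_cong)
  finally have "(\<Sum>k\<le>n. \<alpha> n k * \<zeta> k) = (\<Sum>k\<le>n. \<alpha> n k * \<xi> k \<omega>)" by (simp add: white_noise_def)
  moreover have "(\<Sum>k<n. \<alpha> n k * \<zeta> k) = (\<Sum>k<n. \<alpha> n k * \<xi> k \<omega>)"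
    by (rule sum.cong) (auto simp: less \<zeta>_def)
  ultimately have "\<alpha> n n * \<zeta> n = \<alpha> n n * \<xi> n \<omega>" by (simp add: lessThan_Suc_atMost[symmetric])
  then show ?case using inverse_diag[of n] unfolding \<zeta>_def by (metis mult_cancel_left mult_zero_left zero_neq_one)
qed

lemma noise_prediction:
  "\<xi> n \<omega> = (\<Sum>k<n. pred_coeff \<beta> \<alpha> n k * \<xi> k \<omega>) + \<beta> n n * \<eta> n \<omega>"
proof -
  have "(\<Sum>l<n. \<beta> n l * \<eta> l \<omega>) = (\<Sum>l<n. \<Sum>k<n. \<beta> n l * (\<alpha> l k * \<xi> k \<omega>))"
    unfolding white_noise_def sum_distrib_left
    by (intro sum.cong refl sum.mono_neutral_left) (auto simp: inverse_upper)
  also have "\<dots> = (\<Sum>k<n. pred_coeff \<beta> \<alpha> n k * \<xi> k \<omega>)"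
    by (subst sum.swap) (simp add: pred_coeff_def sum_distrib_right mult.assoc)
  finally show ?thesis
    unfolding noise_of_white_noise[of n] lessThan_Suc_atMost[symmetric] by simp
qed

text \<open>The exponent is Gaussian and the cross term of its variance is a covariance of \<open>\<eta>\<^sub>n\<close> with past noise, which
is zero.\<close>

lemma charfun_factor:
  "(CLINT \<omega>|M. iexp (t * \<eta> n \<omega> + (\<Sum>k<n. s k * \<xi> k \<omega>))) =
   (CLINT \<omega>|M. iexp (t * \<eta> n \<omega>)) * (CLINT \<omega>|M. iexp (\<Sum>k<n. s k * \<xi> k \<omega>))"
proof -
  define r where "r k = t * \<alpha> n k + (if k < n then s k else 0)" for k
  define L where "L \<omega> = (\<Sum>k<n. s k * \<xi> k \<omega>)" for \<omega>
  have Lg: "gaussian_rv M L" unfolding L_def by (rule combination) simp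
  then have [measurable]: "L \<in> borel_measurable M" by (simp add: gaussian_rv_def)
  have Lm: "(\<integral>\<omega>. L \<omega> \<partial>M) = 0" unfolding L_def by (rule combination_mean)
  have Yr: "t * \<eta> n \<omega> + L \<omega> = (\<Sum>k\<le>n. r k * \<xi> k \<omega>)" for \<omega>
  proof -
    have "(\<Sum>k\<le>n. (if k < n then s k else 0) * \<xi> k \<omega>) = L \<omega>"
      unfolding L_def lessThan_Suc_atMost[symmetric] by simp
    then show ?thesis
      by (simp add: r_def white_noise_def distrib_right sum.distrib sum_distrib_left mult.assoc)
  qed
  have Tr: "t * \<eta> n \<omega> = (\<Sum>k\<le>n. (t * \<alpha> n k) * \<xi> k \<omega>)" for \<omega>
    by (simp add: white_noise_def sum_distrib_left mult.assoc)
  have i1: "integrable M (\<lambda>\<omega>. (L \<omega>)\<^sup>2)" using gaussian_rv_moment[OF Lg Lm, where k=2] by simp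
  have i2: "integrable M (\<lambda>\<omega>. \<eta> n \<omega> * L \<omega>)"
    unfolding L_def sum_distrib_left
    by (intro Bochner_Integration.integrable_sum) (simp add: mult.left_commute integrable_white_noise_product)
  have cross: "(\<integral>\<omega>. \<eta> n \<omega> * L \<omega> \<partial>M) = 0"
  proof -
    have "(\<integral>\<omega>. \<eta> n \<omega> * L \<omega> \<partial>M) = (\<integral>\<omega>. (\<Sum>k<n. s k * (\<eta> n \<omega> * \<xi> k \<omega>)) \<partial>M)"
      by (simp add: L_def sum_distrib_left mult_ac)
    also have "\<dots> = 0"
      by (simp add: Bochner_Integration.integral_sum integrable_white_noise_product white_noise_covariance)
    finally show ?thesis .
  qed
  have "(\<integral>\<omega>. (t * \<eta> n \<omega> + L \<omega>)\<^sup>2 \<partial>M) =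
     (\<integral>\<omega>. t\<^sup>2 * (\<eta> n \<omega>)\<^sup>2 + 2 * t * (\<eta> n \<omega> * L \<omega>) + (L \<omega>)\<^sup>2 \<partial>M)"
    by (rule Bochner_Integration.integral_cong) (auto simp: power2_eq_square algebra_simps)
  also have "\<dots> = t\<^sup>2 + (\<integral>\<omega>. (L \<omega>)\<^sup>2 \<partial>M)"
    using i1 i2 cross integrable_white_noise_square[of n] by (simp add: white_noise_variance)
  finally have v: "(\<integral>\<omega>. (t * \<eta> n \<omega> + L \<omega>)\<^sup>2 \<partial>M) = t\<^sup>2 + (\<integral>\<omega>. (L \<omega>)\<^sup>2 \<partial>M)" .
  have v': "(\<integral>\<omega>. (t * \<eta> n \<omega>)\<^sup>2 \<partial>M) = t\<^sup>2" by (simp add: power_mult_distrib white_noise_variance)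
  have "(CLINT \<omega>|M. iexp (t * \<eta> n \<omega> + L \<omega>)) = exp (- (\<integral>\<omega>. (t * \<eta> n \<omega> + L \<omega>)\<^sup>2 \<partial>M) / 2)"
    unfolding Yr by (rule gaussian_rv_charfun[OF combination combination_mean]) simp
  moreover have "(CLINT \<omega>|M. iexp (t * \<eta> n \<omega>)) = exp (- (\<integral>\<omega>. (t * \<eta> n \<omega>)\<^sup>2 \<partial>M) / 2)"
    unfolding Tr by (rule gaussian_rv_charfun[OF combination combination_mean]) simp
  moreover have "(CLINT \<omega>|M. iexp (L \<omega>)) = exp (- (\<integral>\<omega>. (L \<omega>)\<^sup>2 \<partial>M) / 2)"
    by (rule gaussian_rv_charfun[OF Lg Lm])
  moreover have "exp (- (t\<^sup>2 + V) / 2) = exp (- t\<^sup>2 / 2) * exp (- V / 2)" for V :: real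
    unfolding mult_exp_exp by (rule arg_cong[where f=exp]) (simp add: field_simps)
  ultimately show ?thesis unfolding L_def[symmetric] v v' by simp
qed

lemma white_noise_indep_past:
  assumes F0: "subalgebra M F0"
    and ind: "indep_set (sets F0) (sigma_sets (space M) (noise_events M \<xi> UNIV))"
  shows "indep_set (sets (noise_filtration M F0 \<xi> n))
     (sigma_sets (space M) {\<eta> n -` A \<inter> space M |A. A \<in> sets borel})"
proof -
  let ?G = "sigma (space M) (noise_events M \<xi> UNIV)"
  have G: "sets ?G = sigma_sets (space M) (noise_events M \<xi> UNIV)"
    by (rule sets_measure_of[OF noise_events_Pow])
  have [measurable]: "\<xi> k \<in> borel_measurable ?G" for k by (rule measurable_noise_generated) simp
  have "indep_set (sigma_sets (space M) (sets F0 \<union> noise_events M \<xi> {..<n}))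
     (sigma_sets (space M) {\<eta> n -` A \<inter> space M |A. A \<in> sets borel})"
  proof (rule indep_set_of_charfun_factor[OF F0])
    fix E and s :: "nat \<Rightarrow> real" and t :: real
    assume E: "E \<in> sets F0"
    have [measurable]: "E \<in> sets F0" by fact
    have mult: "(CLINT \<omega>|M. indicator E \<omega> * iexp (t * \<eta> n \<omega> + (\<Sum>k<n. s k * \<xi> k \<omega>))) =
       (CLINT \<omega>|M. indicator E \<omega>) * (CLINT \<omega>|M. iexp (t * \<eta> n \<omega> + (\<Sum>k<n. s k * \<xi> k \<omega>)))" for t
    proof (rule indep_var_lebesgue_integral)
      show "indep_var borel (indicator E) borel (\<lambda>\<omega>. iexp (t * \<eta> n \<omega> + (\<Sum>k<n. s k * \<xi> k \<omega>)))"
      proof (rule indep_var_of_indep_algebras)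
        show "indep_set (sets F0) (sets ?G)" using ind by (simp add: G)
        show "(\<lambda>\<omega>. iexp (t * \<eta> n \<omega> + (\<Sum>k<n. s k * \<xi> k \<omega>))) \<in> borel_measurable ?G"
          unfolding white_noise_def by measurable
      qed (use F0 in \<open>auto simp: subalgebra_def space_measure_of_conv\<close>)
      have [measurable]: "E \<in> sets M" using E F0 by (auto simp: subalgebra_def)
      show "complex_integrable M (indicator E)"
        by (rule integrable_const_bound[where B=1]) (auto simp: indicator_def)
      show "complex_integrable M (\<lambda>\<omega>. iexp (t * \<eta> n \<omega> + (\<Sum>k<n. s k * \<xi> k \<omega>)))"
        by (rule integrable_const_bound[where B=1]) auto
    qed
    show "(CLINT \<omega>|M. indicator E \<omega> * iexp (t * \<eta> n \<omega> + (\<Sum>k<n. s k * \<xi> k \<omega>))) =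
      (CLINT \<omega>|M. indicator E \<omega> * iexp (\<Sum>k<n. s k * \<xi> k \<omega>)) * (CLINT \<omega>|M. iexp (t * \<eta> n \<omega>))"
      using mult[of 0] unfolding mult[of t] charfun_factor by (simp add: prob_space)
  qed auto
  then show ?thesis unfolding noise_filtration_sets[OF F0] .
qed

end

section \<open>Fractional noise\<close>

text \<open>The linear span of the family, as a predicate: closure under addition spares an explicit bookkeeping of the
time points at which increments of the process overlap.\<close>

definition combination_of :: "'t set \<Rightarrow> ('t \<Rightarrow> 'w \<Rightarrow> real) \<Rightarrow> ('w \<Rightarrow> real) \<Rightarrow> bool" where
  "combination_of T W Y \<longleftrightarrow> (\<exists>I r. finite I \<and> I \<subseteq> T \<and> Y = (\<lambda>\<omega>. \<Sum>t\<in>I. r t * W t \<omega>))"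

lemma combination_of_single: "t \<in> T \<Longrightarrow> combination_of T W (\<lambda>\<omega>. r * W t \<omega>)"
  unfolding combination_of_def by (intro exI[of _ "{t}"] exI[of _ "\<lambda>_. r"]) auto

lemma combination_of_add:
  assumes "combination_of T W Y" "combination_of T W Z"
  shows "combination_of T W (\<lambda>\<omega>. Y \<omega> + Z \<omega>)"
proof -
  obtain I r where I: "finite I" "I \<subseteq> T" "Y = (\<lambda>\<omega>. \<Sum>t\<in>I. r t * W t \<omega>)"
    using assms(1) unfolding combination_of_def by blast
  obtain K s where K: "finite K" "K \<subseteq> T" "Z = (\<lambda>\<omega>. \<Sum>t\<in>K. s t * W t \<omega>)"
    using assms(2) unfolding combination_of_def by blast
  define w where "w t = (if t \<in> I then r t else 0) + (if t \<in> K then s t else 0)" for t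
  have "Y \<omega> + Z \<omega> = (\<Sum>t\<in>I \<union> K. w t * W t \<omega>)" for \<omega>
  proof -
    have "(\<Sum>t\<in>I. r t * W t \<omega>) = (\<Sum>t\<in>I \<union> K. (if t \<in> I then r t else 0) * W t \<omega>)"
      by (rule sum.mono_neutral_cong_left) (use I K in auto)
    moreover have "(\<Sum>t\<in>K. s t * W t \<omega>) = (\<Sum>t\<in>I \<union> K. (if t \<in> K then s t else 0) * W t \<omega>)"
      by (rule sum.mono_neutral_cong_left) (use I K in auto)
    ultimately show ?thesis unfolding I(3) K(3) w_def by (simp only: distrib_right sum.distrib)
  qed
  then show ?thesis unfolding combination_of_def
    using I K by (intro exI[of _ "I \<union> K"] exI[of _ w]) auto
qed

lemma gaussian_process_fractional_noise:
  assumes "gaussian_process M {0..} W"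
  shows "gaussian_process M UNIV (fractional_noise W)"
proof -
  have "combination_of {0..} W (\<lambda>\<omega>. \<Sum>k\<in>I. r k * fractional_noise W k \<omega>)" if "finite I" for I and r :: "nat \<Rightarrow> real"
    using that
  proof (induction I rule: finite_induct)
    case empty
    then show ?case unfolding combination_of_def by (intro exI[of _ "{}"]) auto
  next
    case (insert k I)
    have "combination_of {0..} W (\<lambda>\<omega>. (r k * W (real k + 1) \<omega> + (- r k) * W (real k) \<omega>) + (\<Sum>k\<in>I. r k * fractional_noise W k \<omega>))"
      by (intro combination_of_add combination_of_single insert.IH) auto
    then show ?case using insert.hyps by (simp add: fractional_noise_def right_diff_distrib)
  qed
  moreover have "gaussian_rv M Y" if "combination_of {0..} W Y" for Y
    using that assms unfolding gaussian_process_def combination_of_def by blast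
  ultimately show ?thesis unfolding gaussian_process_def by blast
qed

context prob_space
begin

lemma fbm_gaussian_rv:
  assumes "fractional_brownian_motion M H W" "0 \<le> t"
  shows "gaussian_rv M (W t)" "(\<integral>\<omega>. W t \<omega> \<partial>M) = 0"
proof -
  have "\<forall>I r. finite I \<and> I \<subseteq> {0..} \<longrightarrow> gaussian_rv M (\<lambda>\<omega>. \<Sum>t\<in>I. r t * W t \<omega>)"
    using assms(1) unfolding fractional_brownian_motion_def gaussian_process_def by blast
  from this[rule_format, of "{t}" "\<lambda>_. 1"] assms(2) show "gaussian_rv M (W t)" by simp
  show "(\<integral>\<omega>. W t \<omega> \<partial>M) = 0" using assms unfolding fractional_brownian_motion_def by blast
qed

lemma integrable_fbm_product:
  assumes W: "fractional_brownian_motion M H W" and t: "0 \<le> t" and s: "0 \<le> s"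
  shows "integrable M (\<lambda>\<omega>. W t \<omega> * W s \<omega>)"
  using fbm_gaussian_rv(1)[OF W] t s
    gaussian_rv_moment[OF fbm_gaussian_rv[OF W t], of 2] gaussian_rv_moment[OF fbm_gaussian_rv[OF W s], of 2]
  by (intro integrable_mult_of_squares) (simp_all add: gaussian_rv_def)

lemma centered_gaussian_fractional_noise:
  assumes W: "fractional_brownian_motion M H W"
  shows "centered_gaussian_sequence M (fractional_noise W) (noise_cov H)"
proof
  show "gaussian_process M UNIV (fractional_noise W)"
    using W by (intro gaussian_process_fractional_noise) (simp add: fractional_brownian_motion_def)
  have i: "integrable M (W t)" if "0 \<le> t" for t
  proof -
    have [measurable]: "W t \<in> borel_measurable M" using fbm_gaussian_rv(1)[OF W that] by (simp add: gaussian_rv_def)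
    have "integrable M (\<lambda>\<omega>. \<bar>W t \<omega>\<bar> ^ 1)" by (rule gaussian_rv_moment[OF fbm_gaussian_rv[OF W that]])
    then show ?thesis by (simp add: integrable_abs_iff)
  qed
  show "(\<integral>\<omega>. fractional_noise W n \<omega> \<partial>M) = 0" for n
    unfolding fractional_noise_def using i fbm_gaussian_rv(2)[OF W] by simp
  fix n k
  define r where "r t s = 1/2 * (t powr (2 * H) + s powr (2 * H) - \<bar>t - s\<bar> powr (2 * H))" for t s :: real
  have c: "(\<integral>\<omega>. W t \<omega> * W s \<omega> \<partial>M) = r t s" if "0 \<le> t" "0 \<le> s" for t s
    using W that unfolding fractional_brownian_motion_def r_def by blast
  note p = integrable_fbm_product[OF W]
  let ?n = "real n" and ?k = "real k"
  have "(\<integral>\<omega>. fractional_noise W n \<omega> * fractional_noise W k \<omega> \<partial>M) =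
    (\<integral>\<omega>. W (?n + 1) \<omega> * W (?k + 1) \<omega> - W (?n + 1) \<omega> * W ?k \<omega> - W ?n \<omega> * W (?k + 1) \<omega> + W ?n \<omega> * W ?k \<omega> \<partial>M)"
    by (rule Bochner_Integration.integral_cong) (auto simp: fractional_noise_def algebra_simps)
  also have "\<dots> = r (?n + 1) (?k + 1) - r (?n + 1) ?k - r ?n (?k + 1) + r ?n ?k"
    by (simp add: p c)
  also have "\<dots> = noise_cov H n k"
  proof -
    have "?n + 1 - (?k + 1) = ?n - ?k" "?n + 1 - ?k = ?n - ?k + 1" "?n - (?k + 1) = ?n - ?k - 1" by simp_all
    then show ?thesis unfolding r_def noise_cov_def by (simp only:) argo
  qed
  finally show "(\<integral>\<omega>. fractional_noise W n \<omega> * fractional_noise W k \<omega> \<partial>M) = noise_cov H n k" .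
qed

end

section \<open>Polynomial domination by the noise\<close>

text \<open>What the control problem needs from the noise: each \<open>\<xi>\<^sub>n\<close> is a linear prediction from the past plus a
scaled standard normal innovation independent of the past, and all its moments are finite.\<close>

locale innovation_noise = prob_space M for M :: "'w measure" +
  fixes F :: "nat \<Rightarrow> 'w measure" and \<xi> \<eta> :: "nat \<Rightarrow> 'w \<Rightarrow> real"
    and c :: "nat \<Rightarrow> nat \<Rightarrow> real" and b :: "nat \<Rightarrow> real"
  assumes filtration: "subalgebra M (F n)"
    and filtration_mono: "m \<le> n \<Longrightarrow> sets (F m) \<subseteq> sets (F n)"
    and noise_adapted: "\<xi> n \<in> borel_measurable (F (Suc n))"
    and noise_split: "\<xi> n \<omega> = (\<Sum>k<n. c n k * \<xi> k \<omega>) + b n * \<eta> n \<omega>"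
    and scale_pos: "0 < b n"
    and innovation_indep: "indep_set (sets (F n)) (sigma_sets (space M) {\<eta> n -` A \<inter> space M |A. A \<in> sets borel})"
    and innovation_normal: "distributed M lborel (\<eta> n) std_normal_density"
    and noise_moments: "integrable M (\<lambda>\<omega>. \<bar>\<xi> n \<omega>\<bar> ^ k)"
begin

definition prediction :: "nat \<Rightarrow> 'w \<Rightarrow> real" where
  "prediction n \<omega> = (\<Sum>k<n. c n k * \<xi> k \<omega>)"

definition noise_size :: "nat \<Rightarrow> 'w \<Rightarrow> real" where
  "noise_size n \<omega> = 1 + (\<Sum>k<n. \<bar>\<xi> k \<omega>\<bar>)"

text \<open>A domination relation in the style of Landau symbols. The drift of the state contains the
unbounded prediction of the noise, so bounds up to constants would be useless; constants and degrees are hidden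
because nothing depends on their values.\<close>

definition poly_bounded :: "nat \<Rightarrow> ('w \<Rightarrow> real) \<Rightarrow> ('w \<Rightarrow> real) \<Rightarrow> bool" where
  "poly_bounded n Y Z \<longleftrightarrow> (\<exists>K d. 0 \<le> K \<and> (AE \<omega> in M. \<bar>Y \<omega>\<bar> \<le> K * noise_size n \<omega> ^ d * \<bar>Z \<omega>\<bar>))"

text \<open>Square integrability against all powers of the noise. Unlike the space of square-integrable variables this class is
closed under multiplication by polynomially bounded factors, and it contains the variables with a
moment of order greater than \<open>2\<close>.\<close>

definition tempered :: "nat \<Rightarrow> ('w \<Rightarrow> real) \<Rightarrow> bool" where
  "tempered n Z \<longleftrightarrow> Z \<in> borel_measurable M \<and> (\<forall>k. integrable M (\<lambda>\<omega>. noise_size n \<omega> ^ k * (Z \<omega>)\<^sup>2))"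

lemma space_filtration: "space (F n) = space M"
  using filtration[of n] by (simp add: subalgebra_def)

lemma measurable_filtration_mono: "m \<le> n \<Longrightarrow> f \<in> borel_measurable (F m) \<Longrightarrow> f \<in> borel_measurable (F n)"
  by (rule measurable_from_subalg[of "F n" "F m"])
    (auto simp: subalgebra_def space_filtration filtration_mono)

lemma measurable_filtration: "f \<in> borel_measurable (F n) \<Longrightarrow> f \<in> borel_measurable M"
  by (rule measurable_from_subalg[OF filtration])

lemma noise_measurable: "k < n \<Longrightarrow> \<xi> k \<in> borel_measurable (F n)"
  using measurable_filtration_mono[OF _ noise_adapted, of k n] by simp

lemma noise_measurable_M[measurable]: "\<xi> k \<in> borel_measurable M"
  by (rule measurable_filtration[OF noise_adapted])

lemma prediction_measurable: "prediction n \<in> borel_measurable (F n)"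
  unfolding prediction_def[abs_def]
  by (intro borel_measurable_sum borel_measurable_times borel_measurable_const noise_measurable) auto

lemma noise_size_measurable: "noise_size n \<in> borel_measurable (F n)"
  unfolding noise_size_def[abs_def]
  by (intro borel_measurable_sum borel_measurable_add borel_measurable_const borel_measurable_abs noise_measurable) auto

lemma noise_size_measurable_M[measurable]: "noise_size n \<in> borel_measurable M"
  by (rule measurable_filtration[OF noise_size_measurable])

lemma innovation_measurable[measurable]: "\<eta> n \<in> borel_measurable M"
  using innovation_normal by (auto simp: distributed_def)

lemma noise_eq: "\<xi> n \<omega> = prediction n \<omega> + b n * \<eta> n \<omega>"
  by (simp add: prediction_def noise_split[symmetric])

lemma innovation_eq: "\<eta> n \<omega> = (\<xi> n \<omega> - prediction n \<omega>) / b n"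
  using scale_pos[of n] by (simp add: noise_eq)

lemma innovation_adapted: "\<eta> n \<in> borel_measurable (F (Suc n))"
proof -
  have [measurable]: "\<xi> n \<in> borel_measurable (F (Suc n))" "prediction n \<in> borel_measurable (F (Suc n))"
    using noise_adapted measurable_filtration_mono[OF _ prediction_measurable, of n "Suc n"] by auto
  have "(\<lambda>\<omega>. (\<xi> n \<omega> - prediction n \<omega>) / b n) \<in> borel_measurable (F (Suc n))" by measurable
  then show ?thesis by (simp add: innovation_eq[abs_def])
qed

lemma noise_size_ge_1: "1 \<le> noise_size n \<omega>"
  by (simp add: noise_size_def sum_nonneg)

lemma noise_size_mono: "m \<le> n \<Longrightarrow> noise_size m \<omega> \<le> noise_size n \<omega>"
  by (auto simp: noise_size_def intro!: sum_mono2)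

lemma noise_size_Suc: "noise_size (Suc n) \<omega> = noise_size n \<omega> + \<bar>\<xi> n \<omega>\<bar>"
  by (simp add: noise_size_def)

lemma noise_size_pow_nonneg: "0 \<le> noise_size n \<omega> ^ k"
  using noise_size_ge_1[of n \<omega>] by simp

lemma noise_size_moment: "integrable M (\<lambda>\<omega>. noise_size n \<omega> ^ k)"
proof (induction n)
  case 0
  then show ?case by (simp add: noise_size_def)
next
  case (Suc n)
  have bd: "(u + v) ^ k \<le> 2 ^ k * (u ^ k + v ^ k)" if "0 \<le> u" "0 \<le> v" for u v :: real
  proof -
    have "(u + v) ^ k \<le> (2 * max u v) ^ k" using that by (intro power_mono) auto
    also have "\<dots> \<le> 2 ^ k * (u ^ k + v ^ k)"
      using that by (auto simp: power_mult_distrib max_def)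
    finally show ?thesis .
  qed
  have "integrable M (\<lambda>\<omega>. 2 ^ k * (noise_size n \<omega> ^ k + \<bar>\<xi> n \<omega>\<bar> ^ k))"
    using Suc noise_moments[of n k] by simp
  then show ?case
  proof (rule Bochner_Integration.integrable_bound)
    show "AE \<omega> in M. norm (noise_size (Suc n) \<omega> ^ k) \<le> norm (2 ^ k * (noise_size n \<omega> ^ k + \<bar>\<xi> n \<omega>\<bar> ^ k))"
    proof (rule AE_I2)
      fix \<omega>
      have "0 \<le> noise_size n \<omega>" using noise_size_ge_1[of n \<omega>] by simp
      then show "norm (noise_size (Suc n) \<omega> ^ k) \<le> norm (2 ^ k * (noise_size n \<omega> ^ k + \<bar>\<xi> n \<omega>\<bar> ^ k))"
        using bd[of "noise_size n \<omega>" "\<bar>\<xi> n \<omega>\<bar>"] by (simp add: noise_size_Suc)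
    qed
  qed simp
qed

lemma poly_boundedI:
  assumes "AE \<omega> in M. \<bar>Y \<omega>\<bar> \<le> K * noise_size n \<omega> ^ d * \<bar>Z \<omega>\<bar>" "0 \<le> K"
  shows "poly_bounded n Y Z"
  using assms unfolding poly_bounded_def by blast

lemma poly_bounded_refl: "poly_bounded n Z Z"
  by (rule poly_boundedI[where K=1 and d=0]) auto

lemma poly_bounded_const: "poly_bounded n (\<lambda>_. r) (\<lambda>_. 1)"
  by (rule poly_boundedI[where K="\<bar>r\<bar>" and d=0]) auto

lemma poly_bounded_AE_le:
  assumes "AE \<omega> in M. \<bar>Y \<omega>\<bar> \<le> K" shows "poly_bounded n Y (\<lambda>_. 1)"
  by (rule poly_boundedI[where K="\<bar>K\<bar>" and d=0]) (use assms in auto)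

lemma poly_bounded_size: "poly_bounded n (noise_size n) (\<lambda>_. 1)"
  by (rule poly_boundedI[where K=1 and d=1]) (use noise_size_ge_1[of n] in \<open>auto simp: abs_of_nonneg order_trans[OF zero_le_one]\<close>)

lemma poly_bounded_noise: "k < n \<Longrightarrow> poly_bounded n (\<xi> k) (\<lambda>_. 1)"
proof (rule poly_boundedI[where K=1 and d=1])
  assume "k < n"
  then have "\<bar>\<xi> k \<omega>\<bar> \<le> noise_size n \<omega>" for \<omega>
    using noise_size_mono[of "Suc k" n \<omega>] noise_size_ge_1[of k \<omega>] by (simp add: noise_size_Suc)
  then show "AE \<omega> in M. \<bar>\<xi> k \<omega>\<bar> \<le> 1 * noise_size n \<omega> ^ 1 * \<bar>1\<bar>" by simp
qed simp

lemma poly_bounded_cmp: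
  assumes "poly_bounded n Y Z" and "AE \<omega> in M. \<bar>Y' \<omega>\<bar> \<le> \<bar>Y \<omega>\<bar>"
  shows "poly_bounded n Y' Z"
proof -
  obtain K d where K: "0 \<le> K" and 1: "AE \<omega> in M. \<bar>Y \<omega>\<bar> \<le> K * noise_size n \<omega> ^ d * \<bar>Z \<omega>\<bar>"
    using assms(1) unfolding poly_bounded_def by blast
  from assms(2) 1 have "AE \<omega> in M. \<bar>Y' \<omega>\<bar> \<le> K * noise_size n \<omega> ^ d * \<bar>Z \<omega>\<bar>"
    by eventually_elim linarith
  then show ?thesis using K by (rule poly_boundedI)
qed

lemma poly_bounded_cong:
  assumes "poly_bounded n Y Z" and "AE \<omega> in M. Y' \<omega> = Y \<omega>"
  shows "poly_bounded n Y' Z"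
  by (rule poly_bounded_cmp[OF assms(1)]) (use assms(2) in auto)

lemma poly_bounded_mono: "poly_bounded m Y Z \<Longrightarrow> m \<le> n \<Longrightarrow> poly_bounded n Y Z"
  unfolding poly_bounded_def
proof safe
  fix K d assume "m \<le> n" "0 \<le> K" and *: "AE \<omega> in M. \<bar>Y \<omega>\<bar> \<le> K * noise_size m \<omega> ^ d * \<bar>Z \<omega>\<bar>"
  have "K * noise_size m \<omega> ^ d * \<bar>Z \<omega>\<bar> \<le> K * noise_size n \<omega> ^ d * \<bar>Z \<omega>\<bar>" for \<omega>
    using \<open>m \<le> n\<close> \<open>0 \<le> K\<close> noise_size_mono[of m n \<omega>] noise_size_ge_1[of m \<omega>]
    by (intro mult_right_mono mult_left_mono power_mono) auto
  with * have "AE \<omega> in M. \<bar>Y \<omega>\<bar> \<le> K * noise_size n \<omega> ^ d * \<bar>Z \<omega>\<bar>"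
    by (auto elim!: eventually_mono intro: order_trans)
  then show "\<exists>K d. 0 \<le> K \<and> (AE \<omega> in M. \<bar>Y \<omega>\<bar> \<le> K * noise_size n \<omega> ^ d * \<bar>Z \<omega>\<bar>)"
    using \<open>0 \<le> K\<close> by blast
qed

lemma poly_bounded_add:
  assumes "poly_bounded n Y Z" "poly_bounded n Y' Z"
  shows "poly_bounded n (\<lambda>\<omega>. Y \<omega> + Y' \<omega>) Z"
proof -
  obtain K d where K: "0 \<le> K" and 1: "AE \<omega> in M. \<bar>Y \<omega>\<bar> \<le> K * noise_size n \<omega> ^ d * \<bar>Z \<omega>\<bar>"
    using assms(1) unfolding poly_bounded_def by blast
  obtain K' d' where K': "0 \<le> K'" and 2: "AE \<omega> in M. \<bar>Y' \<omega>\<bar> \<le> K' * noise_size n \<omega> ^ d' * \<bar>Z \<omega>\<bar>"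
    using assms(2) unfolding poly_bounded_def by blast
  have le: "K * noise_size n \<omega> ^ d * \<bar>Z \<omega>\<bar> \<le> K * noise_size n \<omega> ^ (d + d') * \<bar>Z \<omega>\<bar>"
    "K' * noise_size n \<omega> ^ d' * \<bar>Z \<omega>\<bar> \<le> K' * noise_size n \<omega> ^ (d + d') * \<bar>Z \<omega>\<bar>" for \<omega>
    using K K' noise_size_ge_1[of n \<omega>]
    by (intro mult_right_mono mult_left_mono power_increasing; simp)+
  from 1 2 have "AE \<omega> in M. \<bar>Y \<omega> + Y' \<omega>\<bar> \<le> (K + K') * noise_size n \<omega> ^ (d + d') * \<bar>Z \<omega>\<bar>"
  proof eventually_elim
    case (elim \<omega>)
    then show ?case using le[of \<omega>] abs_triangle_ineq[of "Y \<omega>" "Y' \<omega>"]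
      unfolding distrib_right by linarith
  qed
  then show ?thesis by (rule poly_boundedI) (use K K' in simp)
qed

lemma poly_bounded_mult:
  assumes "poly_bounded n Y Z" "poly_bounded n Y' Z'"
  shows "poly_bounded n (\<lambda>\<omega>. Y \<omega> * Y' \<omega>) (\<lambda>\<omega>. Z \<omega> * Z' \<omega>)"
proof -
  obtain K d where K: "0 \<le> K" and 1: "AE \<omega> in M. \<bar>Y \<omega>\<bar> \<le> K * noise_size n \<omega> ^ d * \<bar>Z \<omega>\<bar>"
    using assms(1) unfolding poly_bounded_def by blast
  obtain K' d' where K': "0 \<le> K'" and 2: "AE \<omega> in M. \<bar>Y' \<omega>\<bar> \<le> K' * noise_size n \<omega> ^ d' * \<bar>Z' \<omega>\<bar>"
    using assms(2) unfolding poly_bounded_def by blast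
  from 1 2 have "AE \<omega> in M. \<bar>Y \<omega> * Y' \<omega>\<bar> \<le> (K * K') * noise_size n \<omega> ^ (d + d') * \<bar>Z \<omega> * Z' \<omega>\<bar>"
  proof eventually_elim
    case (elim \<omega>)
    then have "\<bar>Y \<omega>\<bar> * \<bar>Y' \<omega>\<bar> \<le> (K * noise_size n \<omega> ^ d * \<bar>Z \<omega>\<bar>) * (K' * noise_size n \<omega> ^ d' * \<bar>Z' \<omega>\<bar>)"
      using K noise_size_pow_nonneg[of n \<omega> d] by (intro mult_mono) auto
    then show ?case by (simp add: abs_mult power_add mult_ac)
  qed
  then show ?thesis by (rule poly_boundedI) (use K K' in simp)
qed

lemma poly_bounded_mult_left:
  assumes "poly_bounded n Y (\<lambda>_. 1)" "poly_bounded n Y' Z"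
  shows "poly_bounded n (\<lambda>\<omega>. Y \<omega> * Y' \<omega>) Z"
  using poly_bounded_mult[OF assms] by simp

lemma poly_bounded_cmult:
  assumes "poly_bounded n Y Z" shows "poly_bounded n (\<lambda>\<omega>. r * Y \<omega>) Z"
  by (rule poly_bounded_mult_left[OF poly_bounded_const assms])

lemma poly_bounded_trans:
  assumes "poly_bounded n Y Z" "poly_bounded n Z V"
  shows "poly_bounded n Y V"
proof -
  obtain K d where K: "0 \<le> K" and 1: "AE \<omega> in M. \<bar>Y \<omega>\<bar> \<le> K * noise_size n \<omega> ^ d * \<bar>Z \<omega>\<bar>"
    using assms(1) unfolding poly_bounded_def by blast
  have "poly_bounded n (\<lambda>\<omega>. (K * noise_size n \<omega> ^ d) * Z \<omega>) V"
  proof (rule poly_bounded_mult_left[OF _ assms(2)])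
    show "poly_bounded n (\<lambda>\<omega>. K * noise_size n \<omega> ^ d) (\<lambda>_. 1)"
      by (rule poly_boundedI[where K=K and d=d]) (use K noise_size_pow_nonneg[of n _ d] in auto)
  qed
  then show ?thesis
    by (rule poly_bounded_cmp) (use 1 K noise_size_pow_nonneg[of n _ d] in \<open>auto simp: abs_mult\<close>)
qed

lemma poly_bounded_abs: "poly_bounded n Y Z \<Longrightarrow> poly_bounded n (\<lambda>\<omega>. \<bar>Y \<omega>\<bar>) Z"
  by (erule poly_bounded_cmp) simp

lemma poly_bounded_sum:
  assumes "finite I" "\<And>i. i \<in> I \<Longrightarrow> poly_bounded n (Y i) Z"
  shows "poly_bounded n (\<lambda>\<omega>. \<Sum>i\<in>I. Y i \<omega>) Z"
  using assms
proof (induction I rule: finite_induct)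
  case empty
  show ?case by (rule poly_boundedI[where K=0 and d=0]) auto
next
  case (insert i I)
  then show ?case by (simp add: poly_bounded_add)
qed

lemma poly_bounded_power: "poly_bounded n Y (\<lambda>_. 1) \<Longrightarrow> poly_bounded n (\<lambda>\<omega>. Y \<omega> ^ d) (\<lambda>_. 1)"
  by (induction d) (auto intro: poly_bounded_const poly_bounded_mult_left)

lemma poly_bounded_prediction: "poly_bounded n (prediction n) (\<lambda>_. 1)"
  unfolding prediction_def[abs_def]
  by (intro poly_bounded_sum poly_bounded_cmult poly_bounded_noise) auto

section \<open>Tempered random variables\<close>

lemma tempered_measurable: "tempered n Z \<Longrightarrow> Z \<in> borel_measurable M"
  by (simp add: tempered_def)

lemma tempered_poly_bounded:
  assumes Z: "tempered n Z" and YZ: "poly_bounded n Y Z" and Y[measurable]: "Y \<in> borel_measurable M"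
  shows "tempered n Y"
proof -
  obtain K d where K: "0 \<le> K" and 1: "AE \<omega> in M. \<bar>Y \<omega>\<bar> \<le> K * noise_size n \<omega> ^ d * \<bar>Z \<omega>\<bar>"
    using YZ unfolding poly_bounded_def by blast
  have "integrable M (\<lambda>\<omega>. noise_size n \<omega> ^ k * (Y \<omega>)\<^sup>2)" for k
  proof (rule Bochner_Integration.integrable_bound)
    show "integrable M (\<lambda>\<omega>. K\<^sup>2 * (noise_size n \<omega> ^ (k + 2 * d) * (Z \<omega>)\<^sup>2))"
      using Z by (simp add: tempered_def)
    show "AE \<omega> in M. norm (noise_size n \<omega> ^ k * (Y \<omega>)\<^sup>2) \<le> norm (K\<^sup>2 * (noise_size n \<omega> ^ (k + 2 * d) * (Z \<omega>)\<^sup>2))"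
      using 1
    proof eventually_elim
      case (elim \<omega>)
      have "\<bar>Y \<omega>\<bar>\<^sup>2 \<le> (K * noise_size n \<omega> ^ d * \<bar>Z \<omega>\<bar>)\<^sup>2" using elim by (intro power_mono) auto
      then have "(Y \<omega>)\<^sup>2 \<le> K\<^sup>2 * (noise_size n \<omega> ^ (2 * d) * (Z \<omega>)\<^sup>2)"
        by (simp add: power_mult_distrib power_mult[symmetric] mult_ac)
      then have "noise_size n \<omega> ^ k * (Y \<omega>)\<^sup>2 \<le> noise_size n \<omega> ^ k * (K\<^sup>2 * (noise_size n \<omega> ^ (2 * d) * (Z \<omega>)\<^sup>2))"
        using noise_size_pow_nonneg by (rule mult_left_mono)
      then show ?case using noise_size_pow_nonneg[of n \<omega>] by (simp add: power_add mult_ac abs_mult)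
    qed
  qed simp
  then show ?thesis by (simp add: tempered_def)
qed

lemma tempered_add:
  assumes Y: "tempered n Y" and Z: "tempered n Z"
  shows "tempered n (\<lambda>\<omega>. Y \<omega> + Z \<omega>)"
proof -
  note [measurable] = Y[THEN tempered_measurable] Z[THEN tempered_measurable]
  have "integrable M (\<lambda>\<omega>. noise_size n \<omega> ^ k * (Y \<omega> + Z \<omega>)\<^sup>2)" for k
  proof (rule Bochner_Integration.integrable_bound)
    show "integrable M (\<lambda>\<omega>. 2 * (noise_size n \<omega> ^ k * (Y \<omega>)\<^sup>2) + 2 * (noise_size n \<omega> ^ k * (Z \<omega>)\<^sup>2))"
      using Y Z by (simp add: tempered_def)
    show "AE \<omega> in M. norm (noise_size n \<omega> ^ k * (Y \<omega> + Z \<omega>)\<^sup>2)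
       \<le> norm (2 * (noise_size n \<omega> ^ k * (Y \<omega>)\<^sup>2) + 2 * (noise_size n \<omega> ^ k * (Z \<omega>)\<^sup>2))"
    proof (rule AE_I2)
      fix \<omega>
      have "(Y \<omega> + Z \<omega>)\<^sup>2 \<le> 2 * (Y \<omega>)\<^sup>2 + 2 * (Z \<omega>)\<^sup>2"
        using sum_squares_bound[of "Y \<omega>" "Z \<omega>"] by (simp add: power2_sum)
      then have "noise_size n \<omega> ^ k * (Y \<omega> + Z \<omega>)\<^sup>2 \<le> noise_size n \<omega> ^ k * (2 * (Y \<omega>)\<^sup>2 + 2 * (Z \<omega>)\<^sup>2)"
        using noise_size_pow_nonneg by (rule mult_left_mono)
      then show "norm (noise_size n \<omega> ^ k * (Y \<omega> + Z \<omega>)\<^sup>2)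
         \<le> norm (2 * (noise_size n \<omega> ^ k * (Y \<omega>)\<^sup>2) + 2 * (noise_size n \<omega> ^ k * (Z \<omega>)\<^sup>2))"
        using noise_size_pow_nonneg[of n \<omega> k] by (simp add: algebra_simps)
    qed
  qed simp
  then show ?thesis by (simp add: tempered_def)
qed

lemma tempered_mult_left:
  assumes "poly_bounded n Y (\<lambda>_. 1)" "Y \<in> borel_measurable M" "tempered n Z"
  shows "tempered n (\<lambda>\<omega>. Y \<omega> * Z \<omega>)"
  using assms tempered_measurable[OF assms(3)]
  by (intro tempered_poly_bounded[OF assms(3) poly_bounded_mult_left[OF assms(1) poly_bounded_refl]]) simp

lemma tempered_cmult: "tempered n Z \<Longrightarrow> tempered n (\<lambda>\<omega>. r * Z \<omega>)"
  by (rule tempered_mult_left[OF poly_bounded_const]) auto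

lemma tempered_diff: "tempered n Y \<Longrightarrow> tempered n Z \<Longrightarrow> tempered n (\<lambda>\<omega>. Y \<omega> - Z \<omega>)"
  using tempered_add[of n Y "\<lambda>\<omega>. -1 * Z \<omega>"] tempered_cmult[of n Z "-1"] by simp

lemma tempered_square_integrable: "tempered n Z \<Longrightarrow> integrable M (\<lambda>\<omega>. (Z \<omega>)\<^sup>2)"
  unfolding tempered_def by (metis (no_types, lifting) Bochner_Integration.integrable_cong mult_1 power_0)

lemma tempered_product_integrable:
  assumes Y: "tempered n Y" and Z: "tempered n Z"
  shows "integrable M (\<lambda>\<omega>. Y \<omega> * Z \<omega>)"
  by (rule integrable_mult_of_squares[OF tempered_measurable[OF Y] tempered_measurable[OF Z]
        tempered_square_integrable[OF Y] tempered_square_integrable[OF Z]])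

text \<open>Young's inequality with the conjugate exponents \<open>a / (a - 1)\<close> and \<open>a\<close> bounds \<open>S\<^sup>k Z\<^sup>2\<close> by a power of the noise
size \<open>S\<close>, which is integrable, plus \<open>\<bar>Z\<bar>\<close> to the power \<open>2 a\<close>. The inequality is used up to a constant, in the form
\<open>s\<^sup>1\<^sup>-\<^sup>\<theta> t\<^sup>\<theta> \<le> max s t\<close>.\<close>

lemma tempered_of_moment:
  assumes a: "1 < a" and Z[measurable]: "Z \<in> borel_measurable M"
    and int: "integrable M (\<lambda>\<omega>. \<bar>Z \<omega>\<bar> powr (2 * a))"
  shows "tempered n Z"
proof -
  have "integrable M (\<lambda>\<omega>. noise_size n \<omega> ^ k * (Z \<omega>)\<^sup>2)" for k
  proof -
    \<comment> \<open>The exponent conjugate to \<open>a\<close>, times \<open>k\<close>, rounded up.\<close>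
    define j where "j = nat \<lceil>real k * a / (a - 1)\<rceil>"
    have j: "real k \<le> real j * (1 - 1 / a)"
    proof -
      have "real k * a / (a - 1) \<le> real j" unfolding j_def by linarith
      then show ?thesis using a by (simp add: field_simps)
    qed
    show ?thesis
    proof (rule Bochner_Integration.integrable_bound)
      show "integrable M (\<lambda>\<omega>. noise_size n \<omega> ^ j + \<bar>Z \<omega>\<bar> powr (2 * a))"
        using int noise_size_moment[of n j] by simp
      show "AE \<omega> in M. norm (noise_size n \<omega> ^ k * (Z \<omega>)\<^sup>2) \<le> norm (noise_size n \<omega> ^ j + \<bar>Z \<omega>\<bar> powr (2 * a))"
      proof (rule AE_I2)
        fix \<omega>
        let ?s = "noise_size n \<omega>" let ?z = "\<bar>Z \<omega>\<bar>"
        have s: "1 \<le> ?s" by (rule noise_size_ge_1)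
        have "?s ^ k * ?z\<^sup>2 \<le> ?s ^ j + ?z powr (2 * a)"
        proof (cases "?z = 0")
          case True
          then show ?thesis using s by simp
        next
          case False
          then have z: "0 < ?z" by simp
          have "?s ^ k = ?s powr real k" using s by (simp add: powr_realpow)
          also have "\<dots> \<le> ?s powr (real j * (1 - 1 / a))" using s j by (intro powr_mono) auto
          also have "\<dots> = (?s ^ j) powr (1 - 1 / a)" using s by (simp add: powr_powr powr_realpow[symmetric])
          finally have 1: "?s ^ k \<le> (?s ^ j) powr (1 - 1 / a)" .
          have 2: "?z\<^sup>2 = (?z powr (2 * a)) powr (1 / a)"
            using z a by (simp add: powr_powr powr_numeral)
          have "?s ^ k * ?z\<^sup>2 \<le> (?s ^ j) powr (1 - 1 / a) * (?z powr (2 * a)) powr (1 / a)"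
            unfolding 2 by (rule mult_right_mono[OF 1]) simp
          also have "\<dots> \<le> max (?s ^ j) (?z powr (2 * a)) powr (1 - 1 / a) * max (?s ^ j) (?z powr (2 * a)) powr (1 / a)"
            using s a by (intro mult_mono powr_mono2) auto
          also have "\<dots> = max (?s ^ j) (?z powr (2 * a))"
            using s z by (simp add: powr_add[symmetric] abs_of_nonneg le_max_iff_disj)
          also have "\<dots> \<le> ?s ^ j + ?z powr (2 * a)" using s by (simp add: max_def)
          finally show ?thesis .
        qed
        then show "norm (?s ^ k * (Z \<omega>)\<^sup>2) \<le> norm (?s ^ j + ?z powr (2 * a))"
          using s by (simp add: abs_mult)
      qed
    qed simp
  qed
  then show ?thesis by (simp add: tempered_def)
qed

section \<open>A step along the innovation\<close>

lemma AE_innovation_all: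
  fixes g :: "'w \<Rightarrow> real \<Rightarrow> real"
  assumes "(\<lambda>(\<omega>, z). g \<omega> z) \<in> borel_measurable (F n \<Otimes>\<^sub>M borel)"
    and "\<And>\<omega>. \<omega> \<in> space M \<Longrightarrow> continuous_on UNIV (g \<omega>)"
    and "AE \<omega> in M. 0 \<le> g \<omega> (\<eta> n \<omega>)"
  shows "AE \<omega> in M. \<forall>z. 0 \<le> g \<omega> z"
  by (rule AE_all_innovations[OF innovation_indep space_filtration innovation_normal assms])

lemma affine_innovation_zero:
  assumes [measurable]: "r \<in> borel_measurable (F n)" "s \<in> borel_measurable (F n)"
    and ae: "AE \<omega> in M. r \<omega> + s \<omega> * \<eta> n \<omega> = 0"
  shows "AE \<omega> in M. r \<omega> = 0 \<and> s \<omega> = 0"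
proof -
  have "AE \<omega> in M. \<forall>z. 0 \<le> - \<bar>r \<omega> + s \<omega> * z\<bar>"
    by (rule AE_innovation_all[where n=n]) (use ae in \<open>auto intro!: continuous_intros\<close>)
  then show ?thesis
  proof eventually_elim
    case (elim \<omega>)
    from elim[rule_format, of 0] elim[rule_format, of 1] show ?case by simp
  qed
qed

text \<open>The polynomial bound and the sign condition hold for every value \<open>z\<close> of the innovation, with \<open>P = p + q z\<close> and \<open>Z = m + s z\<close>.
For \<open>z = 1\<close> and \<open>z = - 1\<close> the polynomial factor is at most some \<open>T\<close> that depends on the past only, hence
\<open>P\<^sup>2 \<le> T \<bar>P Z\<bar> = T P Z\<close> at both values; adding the two inequalities cancels the mixed terms.\<close>

lemma innovation_coercivity:
  assumes [measurable]: "p \<in> borel_measurable (F n)" "q \<in> borel_measurable (F n)"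
      "m \<in> borel_measurable (F n)" "s \<in> borel_measurable (F n)"
    and P: "AE \<omega> in M. P \<omega> = p \<omega> + q \<omega> * \<eta> n \<omega>" and Z: "AE \<omega> in M. Z \<omega> = m \<omega> + s \<omega> * \<eta> n \<omega>"
    and sgn: "AE \<omega> in M. 0 \<le> P \<omega> * Z \<omega>" and bd: "poly_bounded (Suc n) P Z"
  obtains T where "poly_bounded n T (\<lambda>_. 1)" "\<And>\<omega>. 1 \<le> T \<omega>"
    "AE \<omega> in M. (p \<omega>)\<^sup>2 + (q \<omega>)\<^sup>2 \<le> T \<omega> * (p \<omega> * m \<omega> + q \<omega> * s \<omega>)"
proof -
  obtain K0 d where K0: "0 \<le> K0" and bd0: "AE \<omega> in M. \<bar>P \<omega>\<bar> \<le> K0 * noise_size (Suc n) \<omega> ^ d * \<bar>Z \<omega>\<bar>"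
    using bd unfolding poly_bounded_def by blast
  \<comment> \<open>Enlarging the constant makes \<open>T\<close> at least \<open>1\<close>, so that signs can be read off after multiplying by \<open>T\<close>.\<close>
  define K where "K = K0 + 1"
  have K: "1 \<le> K" using K0 by (simp add: K_def)
  define T where "T \<omega> = K * (noise_size n \<omega> + (\<bar>prediction n \<omega>\<bar> + b n)) ^ d" for \<omega>
  note [measurable] = noise_size_measurable[of n] prediction_measurable[of n]
  have "AE \<omega> in M. \<forall>z. 0 \<le> K * (noise_size n \<omega> + \<bar>prediction n \<omega> + b n * z\<bar>) ^ d * \<bar>m \<omega> + s \<omega> * z\<bar> - \<bar>p \<omega> + q \<omega> * z\<bar>"
  proof (rule AE_innovation_all[where n=n])
    show "AE \<omega> in M. 0 \<le> K * (noise_size n \<omega> + \<bar>prediction n \<omega> + b n * \<eta> n \<omega>\<bar>) ^ d * \<bar>m \<omega> + s \<omega> * \<eta> n \<omega>\<bar> - \<bar>p \<omega> + q \<omega> * \<eta> n \<omega>\<bar>"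
      using bd0 P Z
    proof eventually_elim
      case (elim \<omega>)
      have "K0 * noise_size (Suc n) \<omega> ^ d * \<bar>Z \<omega>\<bar> \<le> K * noise_size (Suc n) \<omega> ^ d * \<bar>Z \<omega>\<bar>"
        using noise_size_pow_nonneg[of "Suc n" \<omega> d] by (intro mult_right_mono) (auto simp: K_def)
      with elim show ?case by (simp add: noise_size_Suc noise_eq)
    qed
    show "continuous_on UNIV (\<lambda>z. K * (noise_size n \<omega> + \<bar>prediction n \<omega> + b n * z\<bar>) ^ d * \<bar>m \<omega> + s \<omega> * z\<bar> - \<bar>p \<omega> + q \<omega> * z\<bar>)" for \<omega>
      by (intro continuous_intros)
  qed measurable
  moreover have "AE \<omega> in M. \<forall>z. 0 \<le> (p \<omega> + q \<omega> * z) * (m \<omega> + s \<omega> * z)"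
  proof (rule AE_innovation_all[where n=n])
    show "AE \<omega> in M. 0 \<le> (p \<omega> + q \<omega> * \<eta> n \<omega>) * (m \<omega> + s \<omega> * \<eta> n \<omega>)"
      using sgn P Z by eventually_elim simp
    show "continuous_on UNIV (\<lambda>z. (p \<omega> + q \<omega> * z) * (m \<omega> + s \<omega> * z))" for \<omega>
      by (intro continuous_intros)
  qed measurable
  ultimately have "AE \<omega> in M. (p \<omega>)\<^sup>2 + (q \<omega>)\<^sup>2 \<le> T \<omega> * (p \<omega> * m \<omega> + q \<omega> * s \<omega>)"
  proof eventually_elim
    case (elim \<omega>)
    have key: "(p \<omega> + q \<omega> * z)\<^sup>2 \<le> T \<omega> * ((p \<omega> + q \<omega> * z) * (m \<omega> + s \<omega> * z))" if "\<bar>z\<bar> = 1" for z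
    proof -
      have "\<bar>prediction n \<omega> + b n * z\<bar> \<le> \<bar>prediction n \<omega>\<bar> + b n"
        using abs_triangle_ineq[of "prediction n \<omega>" "b n * z"] that scale_pos[of n] by (simp add: abs_mult)
      then have "K * (noise_size n \<omega> + \<bar>prediction n \<omega> + b n * z\<bar>) ^ d * \<bar>m \<omega> + s \<omega> * z\<bar> \<le> T \<omega> * \<bar>m \<omega> + s \<omega> * z\<bar>"
        unfolding T_def using K noise_size_ge_1[of n \<omega>]
        by (intro mult_right_mono mult_left_mono power_mono) auto
      then have "\<bar>p \<omega> + q \<omega> * z\<bar> \<le> T \<omega> * \<bar>m \<omega> + s \<omega> * z\<bar>" using elim(1)[rule_format, of z] by simp
      then have "\<bar>p \<omega> + q \<omega> * z\<bar> * \<bar>p \<omega> + q \<omega> * z\<bar> \<le> T \<omega> * \<bar>m \<omega> + s \<omega> * z\<bar> * \<bar>p \<omega> + q \<omega> * z\<bar>"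
        by (rule mult_right_mono) simp
      then have "(p \<omega> + q \<omega> * z)\<^sup>2 \<le> T \<omega> * \<bar>(p \<omega> + q \<omega> * z) * (m \<omega> + s \<omega> * z)\<bar>"
        by (simp add: abs_mult power2_eq_square mult_ac)
      then show ?thesis using elim(2)[rule_format, of z] by simp
    qed
    from key[of 1] key[of "-1"] show ?case by (simp add: power2_eq_square algebra_simps)
  qed
  moreover have "1 \<le> T \<omega>" for \<omega>
  proof -
    have "1 \<le> (noise_size n \<omega> + (\<bar>prediction n \<omega>\<bar> + b n)) ^ d"
      using noise_size_ge_1[of n \<omega>] scale_pos[of n] by (intro one_le_power) linarith
    then show ?thesis unfolding T_def using K mult_mono[of 1 K 1] by fastforce
  qed
  moreover have "poly_bounded n T (\<lambda>_. 1)"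
    unfolding T_def[abs_def]
    by (intro poly_bounded_cmult poly_bounded_power poly_bounded_add poly_bounded_size poly_bounded_abs
        poly_bounded_prediction poly_bounded_const)
  ultimately show ?thesis using that by blast
qed

lemma innovation_mean: "integrable M (\<eta> n)" "(\<integral>\<omega>. \<eta> n \<omega> \<partial>M) = 0"
  and innovation_variance: "integrable M (\<lambda>\<omega>. (\<eta> n \<omega>)\<^sup>2)" "(\<integral>\<omega>. (\<eta> n \<omega>)\<^sup>2 \<partial>M) = 1"
proof -
  show "integrable M (\<eta> n)"
    using distributed_integrable[OF innovation_normal[of n], of "\<lambda>x. x"] integrable_std_normal_moment[of 1] by simp
  show "integrable M (\<lambda>\<omega>. (\<eta> n \<omega>)\<^sup>2)"
    using distributed_integrable[OF innovation_normal[of n], of "\<lambda>x. x\<^sup>2"] integrable_std_normal_moment[of 2] by simp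
  show e: "(\<integral>\<omega>. \<eta> n \<omega> \<partial>M) = 0"
    by (rule standard_normal_distributed_expectation[OF innovation_normal])
  show "(\<integral>\<omega>. (\<eta> n \<omega>)\<^sup>2 \<partial>M) = 1"
    using standard_normal_distributed_variance[OF innovation_normal[of n]] e by simp
qed

lemma innovation_product:
  fixes Y :: "'w \<Rightarrow> real" and f :: "real \<Rightarrow> real"
  assumes Y: "Y \<in> borel_measurable (F n)" "integrable M Y" and f: "f \<in> borel_measurable borel"
    and int: "integrable M (\<lambda>\<omega>. f (\<eta> n \<omega>))"
  shows "integrable M (\<lambda>\<omega>. Y \<omega> * f (\<eta> n \<omega>))"
    and "(\<integral>\<omega>. Y \<omega> * f (\<eta> n \<omega>) \<partial>M) = (\<integral>\<omega>. Y \<omega> \<partial>M) * (\<integral>\<omega>. f (\<eta> n \<omega>) \<partial>M)"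
proof -
  let ?E = "sigma (space M) {\<eta> n -` A \<inter> space M |A. A \<in> sets borel}"
  have E: "sets ?E = sigma_sets (space M) {\<eta> n -` A \<inter> space M |A. A \<in> sets borel}"
    by (rule sets_measure_of) auto
  have "indep_var borel Y borel (\<lambda>\<omega>. f (\<eta> n \<omega>))"
  proof (rule indep_var_of_indep_algebras[of "F n" ?E])
    have "\<eta> n \<in> borel_measurable ?E"
      by (rule measurableI) (auto simp: E space_measure_of_conv intro!: sigma_sets.Basic)
    then show "(\<lambda>\<omega>. f (\<eta> n \<omega>)) \<in> borel_measurable ?E"
      using f by (rule measurable_compose)
  qed (use innovation_indep[of n] Y(1) in \<open>auto simp: E space_filtration space_measure_of_conv\<close>)
  from indep_var_integrable[OF this Y(2) int] indep_var_lebesgue_integral[OF this Y(2) int]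
  show "integrable M (\<lambda>\<omega>. Y \<omega> * f (\<eta> n \<omega>))"
    "(\<integral>\<omega>. Y \<omega> * f (\<eta> n \<omega>) \<partial>M) = (\<integral>\<omega>. Y \<omega> \<partial>M) * (\<integral>\<omega>. f (\<eta> n \<omega>) \<partial>M)"
    by simp_all
qed

text \<open>Conditionally on the past the innovation has mean \<open>0\<close> and second moment \<open>1\<close>; only the terms of even degree
in \<open>\<eta>\<^sub>n\<close> survive.\<close>

lemma expectation_affine_product:
  assumes m: "p \<in> borel_measurable (F n)" "q \<in> borel_measurable (F n)"
      "m \<in> borel_measurable (F n)" "s \<in> borel_measurable (F n)"
    and t: "tempered k p" "tempered k q" "tempered k m" "tempered k s"
  shows "(\<integral>\<omega>. (p \<omega> + q \<omega> * \<eta> n \<omega>) * (m \<omega> + s \<omega> * \<eta> n \<omega>) \<partial>M) = (\<integral>\<omega>. p \<omega> * m \<omega> + q \<omega> * s \<omega> \<partial>M)"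
proof -
  note [measurable] = m
  have i: "integrable M (\<lambda>\<omega>. p \<omega> * m \<omega>)" "integrable M (\<lambda>\<omega>. q \<omega> * s \<omega>)"
    "integrable M (\<lambda>\<omega>. p \<omega> * s \<omega> + q \<omega> * m \<omega>)"
    using t by (auto intro!: tempered_product_integrable Bochner_Integration.integrable_add)
  have b1: "(\<lambda>z::real. z) \<in> borel_measurable borel" and b2: "(\<lambda>z::real. z\<^sup>2) \<in> borel_measurable borel"
    by measurable
  have m1: "(\<lambda>\<omega>. p \<omega> * s \<omega> + q \<omega> * m \<omega>) \<in> borel_measurable (F n)"
    and m2: "(\<lambda>\<omega>. q \<omega> * s \<omega>) \<in> borel_measurable (F n)"
    by measurable
  note 1 = innovation_product[OF m1 i(3) b1 innovation_mean(1)]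
  note 2 = innovation_product[OF m2 i(2) b2 innovation_variance(1)]
  have "(\<integral>\<omega>. (p \<omega> + q \<omega> * \<eta> n \<omega>) * (m \<omega> + s \<omega> * \<eta> n \<omega>) \<partial>M) =
    (\<integral>\<omega>. p \<omega> * m \<omega> + (p \<omega> * s \<omega> + q \<omega> * m \<omega>) * \<eta> n \<omega> + (q \<omega> * s \<omega>) * (\<eta> n \<omega>)\<^sup>2 \<partial>M)"
    by (rule Bochner_Integration.integral_cong) (auto simp: power2_eq_square algebra_simps)
  also have "\<dots> = (\<integral>\<omega>. p \<omega> * m \<omega> \<partial>M) + 0 + (\<integral>\<omega>. q \<omega> * s \<omega> \<partial>M)"
    using i(1) 1 2 by (simp add: innovation_mean innovation_variance)
  also have "\<dots> = (\<integral>\<omega>. p \<omega> * m \<omega> + q \<omega> * s \<omega> \<partial>M)" using i by simp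
  finally show ?thesis .
qed

end

section \<open>The controlled state\<close>

locale lq_problem = innovation_noise M F \<xi> \<eta> c b
  for M :: "'w measure" and F \<xi> \<eta> c b +
  fixes N :: nat and A B C D :: "nat \<Rightarrow> 'w \<Rightarrow> real" and Q R :: "nat \<Rightarrow> real" and G L :: real
    and x :: "'w \<Rightarrow> real"
  assumes coeff_adapted: "n < N \<Longrightarrow> A n \<in> borel_measurable (F n)" "n < N \<Longrightarrow> B n \<in> borel_measurable (F n)"
      "n < N \<Longrightarrow> C n \<in> borel_measurable (F n)" "n < N \<Longrightarrow> D n \<in> borel_measurable (F n)"
    and coeff_bounded: "n < N \<Longrightarrow> AE \<omega> in M. \<bar>A n \<omega>\<bar> \<le> L" "n < N \<Longrightarrow> AE \<omega> in M. \<bar>B n \<omega>\<bar> \<le> L"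
      "n < N \<Longrightarrow> AE \<omega> in M. \<bar>C n \<omega>\<bar> \<le> L" "n < N \<Longrightarrow> AE \<omega> in M. \<bar>D n \<omega>\<bar> \<le> L"
    and weights: "n < N \<Longrightarrow> 0 \<le> Q n" "n < N \<Longrightarrow> 0 < R n" "0 \<le> G"
    and initial_measurable: "x \<in> borel_measurable (F 0)"
begin

abbreviation X :: "(nat \<Rightarrow> 'w \<Rightarrow> real) \<Rightarrow> nat \<Rightarrow> 'w \<Rightarrow> real" where
  "X u \<equiv> state (lin_coeff A B) (lin_coeff C D) \<xi> x u"

abbreviation J :: "(nat \<Rightarrow> 'w \<Rightarrow> real) \<Rightarrow> real" where
  "J u \<equiv> lq_cost M N Q R G (X u) u"

definition drift :: "nat \<Rightarrow> real \<Rightarrow> real \<Rightarrow> 'w \<Rightarrow> real" where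
  "drift n y w \<omega> = (1 + A n \<omega> + C n \<omega> * prediction n \<omega>) * y + (B n \<omega> + D n \<omega> * prediction n \<omega>) * w"

definition diffusion :: "nat \<Rightarrow> real \<Rightarrow> real \<Rightarrow> 'w \<Rightarrow> real" where
  "diffusion n y w \<omega> = b n * (C n \<omega> * y + D n \<omega> * w)"

lemma state_step: "X u (Suc n) \<omega> = drift n (X u n \<omega>) (u n \<omega>) \<omega> + diffusion n (X u n \<omega>) (u n \<omega>) \<omega> * \<eta> n \<omega>"
  by (simp add: drift_def diffusion_def lin_coeff_def noise_eq[of n] algebra_simps)

lemma state_Suc_linear: "X u (Suc n) = (\<lambda>\<omega>. X u n \<omega> + (A n \<omega> * X u n \<omega> + B n \<omega> * u n \<omega>)
    + \<xi> n \<omega> * (C n \<omega> * X u n \<omega> + D n \<omega> * u n \<omega>))"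
  by (rule ext) (simp only: state.simps lin_coeff_def mult.commute[of "\<xi> n _"])

lemma coeff_measurable_M: "n < N \<Longrightarrow> A n \<in> borel_measurable M" "n < N \<Longrightarrow> B n \<in> borel_measurable M"
  "n < N \<Longrightarrow> C n \<in> borel_measurable M" "n < N \<Longrightarrow> D n \<in> borel_measurable M"
  using coeff_adapted measurable_filtration by blast+

lemma coeff_poly_bounded: "n < N \<Longrightarrow> poly_bounded k (A n) (\<lambda>_. 1)" "n < N \<Longrightarrow> poly_bounded k (B n) (\<lambda>_. 1)"
  "n < N \<Longrightarrow> poly_bounded k (C n) (\<lambda>_. 1)" "n < N \<Longrightarrow> poly_bounded k (D n) (\<lambda>_. 1)"
  using coeff_bounded poly_bounded_AE_le by blast+

lemma drift_measurable:
  assumes "n < N" and [measurable]: "f \<in> borel_measurable (F n)" "g \<in> borel_measurable (F n)"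
  shows "(\<lambda>\<omega>. drift n (f \<omega>) (g \<omega>) \<omega>) \<in> borel_measurable (F n)"
proof -
  note [measurable] = coeff_adapted[OF assms(1)] prediction_measurable[of n]
  show ?thesis unfolding drift_def by measurable
qed

lemma diffusion_measurable:
  assumes "n < N" and [measurable]: "f \<in> borel_measurable (F n)" "g \<in> borel_measurable (F n)"
  shows "(\<lambda>\<omega>. diffusion n (f \<omega>) (g \<omega>) \<omega>) \<in> borel_measurable (F n)"
proof -
  note [measurable] = coeff_adapted[OF assms(1)]
  show ?thesis unfolding diffusion_def by measurable
qed

lemma state_measurable:
  assumes "\<And>k. k < N \<Longrightarrow> u k \<in> borel_measurable (F k)" and "n \<le> N"
  shows "X u n \<in> borel_measurable (F n)"
  using \<open>n \<le> N\<close>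
proof (induction n)
  case 0
  then show ?case by (simp add: initial_measurable)
next
  case (Suc n)
  then have n: "n < N" by simp
  have [measurable]: "X u n \<in> borel_measurable (F n)" using Suc by simp
  note [measurable] = assms(1)[OF n]
  have [measurable]: "(\<lambda>\<omega>. drift n (X u n \<omega>) (u n \<omega>) \<omega>) \<in> borel_measurable (F (Suc n))"
    by (rule measurable_filtration_mono[OF _ drift_measurable[OF n]]) auto
  have [measurable]: "(\<lambda>\<omega>. diffusion n (X u n \<omega>) (u n \<omega>) \<omega>) \<in> borel_measurable (F (Suc n))"
    by (rule measurable_filtration_mono[OF _ diffusion_measurable[OF n]]) auto
  note [measurable] = innovation_adapted[of n]
  show ?case unfolding state_step[abs_def] by measurable
qed

lemma state_poly_bounded:
  assumes "n < N" and "poly_bounded n (X u n) Z" and "poly_bounded n (u n) Z"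
  shows "poly_bounded (Suc n) (X u (Suc n)) Z"
proof -
  have y: "poly_bounded (Suc n) (X u n) Z" and w: "poly_bounded (Suc n) (u n) Z"
    using assms(2,3) by (auto intro: poly_bounded_mono)
  have "poly_bounded (Suc n) (\<lambda>\<omega>. X u n \<omega> + (A n \<omega> * X u n \<omega> + B n \<omega> * u n \<omega>)
      + \<xi> n \<omega> * (C n \<omega> * X u n \<omega> + D n \<omega> * u n \<omega>)) Z"
    by (intro poly_bounded_add poly_bounded_mult_left y w coeff_poly_bounded assms(1) poly_bounded_noise) simp
  then show ?thesis unfolding state_Suc_linear .
qed

lemma tempered_drift:
  assumes n: "n < N" and "tempered N f" "tempered N g"
  shows "tempered N (\<lambda>\<omega>. drift n (f \<omega>) (g \<omega>) \<omega>)"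
proof -
  note [measurable] = coeff_measurable_M[OF n] measurable_filtration[OF prediction_measurable[of n]]
  have pr: "poly_bounded N (prediction n) (\<lambda>_. 1)"
    using poly_bounded_prediction poly_bounded_mono n less_imp_le by blast
  show ?thesis unfolding drift_def
    by (intro tempered_add tempered_mult_left poly_bounded_add poly_bounded_mult_left coeff_poly_bounded n pr
        poly_bounded_const assms) measurable
qed

lemma tempered_diffusion:
  assumes n: "n < N" and "tempered N f" "tempered N g"
  shows "tempered N (\<lambda>\<omega>. diffusion n (f \<omega>) (g \<omega>) \<omega>)"
  unfolding diffusion_def
  by (intro tempered_cmult tempered_add tempered_mult_left coeff_poly_bounded n coeff_measurable_M assms)

lemma tempered_state:
  assumes x: "tempered N x" and u: "\<And>k. k < N \<Longrightarrow> tempered N (u k)" and "n \<le> N"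
  shows "tempered N (X u n)"
  using \<open>n \<le> N\<close>
proof (induction n)
  case 0
  then show ?case by (simp add: x)
next
  case (Suc n)
  then have n: "n < N" and y: "tempered N (X u n)" by auto
  note [measurable] = coeff_measurable_M[OF n]
  have "tempered N (\<lambda>\<omega>. X u n \<omega> + (A n \<omega> * X u n \<omega> + B n \<omega> * u n \<omega>)
      + \<xi> n \<omega> * (C n \<omega> * X u n \<omega> + D n \<omega> * u n \<omega>))"
    by (intro tempered_add tempered_mult_left y u[OF n] coeff_poly_bounded n poly_bounded_noise) measurable
  then show ?case unfolding state_Suc_linear .
qed

lemma drift_diff: "drift n y w \<omega> - drift n y' w' \<omega> = drift n (y - y') (w - w') \<omega>"
  by (simp add: drift_def algebra_simps)

lemma diffusion_diff: "diffusion n y w \<omega> - diffusion n y' w' \<omega> = diffusion n (y - y') (w - w') \<omega>"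
  by (simp add: diffusion_def algebra_simps)

end

section \<open>The adjoint equation\<close>

locale lq_adjoint = lq_problem M F \<xi> \<eta> c b N A B C D Q R G L x
  for M :: "'w measure" and F \<xi> \<eta> c b N A B C D Q R G L x +
  fixes p q v :: "nat \<Rightarrow> 'w \<Rightarrow> real"
  assumes control: "n < N \<Longrightarrow> \<omega> \<in> space M \<Longrightarrow> v n \<omega> = - inverse (R n) *
      (B n \<omega> * p n \<omega> + D n \<omega> * p n \<omega> * prediction n \<omega> + b n * D n \<omega> * q n \<omega>)"
    and adjoint: "lq_bsde_solution M F N (\<lambda>_. b) \<xi> \<eta> A C Q G (X v) p q"
begin

text \<open>The right-hand side of the adjoint equation with the noise replaced by its prediction, and the terminal value
at \<open>N\<close>. It plays the part of the derivative of the remaining cost with respect to the state.\<close>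

definition lifted :: "nat \<Rightarrow> 'w \<Rightarrow> real" where
  "lifted n \<omega> = (if n < N then (1 + A n \<omega> + C n \<omega> * prediction n \<omega>) * p n \<omega> + b n * C n \<omega> * q n \<omega> + Q n * X v n \<omega>
     else G * X v n \<omega>)"

lemma p_measurable: "n \<le> N \<Longrightarrow> p n \<in> borel_measurable (F n)"
  and q_measurable: "n \<le> N \<Longrightarrow> q n \<in> borel_measurable (F n)"
  using adjoint by (auto simp: lq_bsde_solution_def adapted_on_def)

lemma stationarity:
  assumes "n < N" "\<omega> \<in> space M"
  shows "(B n \<omega> + D n \<omega> * prediction n \<omega>) * p n \<omega> + b n * D n \<omega> * q n \<omega> = - R n * v n \<omega>"
  using weights(2)[OF assms(1)] unfolding control[OF assms] by (simp add: field_simps)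

lemma control_measurable:
  assumes n: "n < N" shows "v n \<in> borel_measurable (F n)"
proof -
  note [measurable] = coeff_adapted[OF n] p_measurable[OF less_imp_le[OF n]] q_measurable[OF less_imp_le[OF n]]
    prediction_measurable[of n]
  have "(\<lambda>\<omega>. - inverse (R n) * (B n \<omega> * p n \<omega> + D n \<omega> * p n \<omega> * prediction n \<omega> + b n * D n \<omega> * q n \<omega>))
      \<in> borel_measurable (F n)" by measurable
  then show ?thesis
    by (rule iffD1[OF measurable_cong, rotated]) (simp add: space_filtration control[OF n])
qed

lemma optimal_state_measurable: "n \<le> N \<Longrightarrow> X v n \<in> borel_measurable (F n)"
  by (rule state_measurable[OF control_measurable])

text \<open>In the adjoint equation everything except \<open>C\<^sub>m p\<^sub>m \<xi>\<^sub>m\<close>, with \<open>m = n + 1\<close>, is known at time \<open>m\<close>. After splitting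
\<open>\<xi>\<^sub>m\<close> the equation is affine in the innovation \<open>\<eta>\<^sub>m\<close> with coefficients known at time \<open>m\<close>, so both coefficients
vanish.\<close>

lemma adjoint_noise_coupling:
  assumes n: "Suc n < N"
  shows "AE \<omega> in M. C (Suc n) \<omega> * p (Suc n) \<omega> = 0"
proof -
  let ?m = "Suc n"
  have n': "n \<le> N" "?m \<le> N" using n by auto
  have [measurable]: "p n \<in> borel_measurable (F ?m)" "q n \<in> borel_measurable (F ?m)"
    using p_measurable[OF n'(1)] q_measurable[OF n'(1)] measurable_filtration_mono[of n ?m] by auto
  note [measurable] = p_measurable[OF n'(2)] q_measurable[OF n'(2)] coeff_adapted[OF n]
    innovation_adapted[of n] optimal_state_measurable[OF n'(2)] prediction_measurable[of ?m]
  define r where "r \<omega> = p ?m \<omega> + A ?m \<omega> * p ?m \<omega> + b ?m * C ?m \<omega> * q ?m \<omega> + Q ?m * X v ?m \<omega>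
     + C ?m \<omega> * p ?m \<omega> * prediction ?m \<omega> - (p n \<omega> + q n \<omega> * \<eta> n \<omega>)" for \<omega>
  have "AE \<omega> in M. r \<omega> = 0 \<and> b ?m * (C ?m \<omega> * p ?m \<omega>) = 0"
  proof (rule affine_innovation_zero[where n="?m"])
    show "r \<in> borel_measurable (F ?m)" unfolding r_def[abs_def] by measurable
    show "(\<lambda>\<omega>. b ?m * (C ?m \<omega> * p ?m \<omega>)) \<in> borel_measurable (F ?m)" by measurable
    have "AE \<omega> in M. p n \<omega> + q n \<omega> * \<eta> n \<omega> = p (n+1) \<omega> + A (n+1) \<omega> * p (n+1) \<omega> + b (n+1) * C (n+1) \<omega> * q (n+1) \<omega>
          + Q (n+1) * X v (n+1) \<omega> + C (n+1) \<omega> * p (n+1) \<omega> * \<xi> (n+1) \<omega>"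
      using adjoint n unfolding lq_bsde_solution_def by (meson Suc_lessD)
    then show "AE \<omega> in M. r \<omega> + b ?m * (C ?m \<omega> * p ?m \<omega>) * \<eta> ?m \<omega> = 0"
    proof eventually_elim
      case (elim \<omega>)
      then show ?case unfolding r_def noise_eq[of "n + 1"] by (simp add: algebra_simps del: state.simps)
    qed
  qed
  then show ?thesis by eventually_elim (use scale_pos[of ?m] in simp)
qed

lemma adjoint_step:
  assumes n: "n < N"
  shows "AE \<omega> in M. lifted (Suc n) \<omega> = p n \<omega> + q n \<omega> * \<eta> n \<omega>"
proof -
  have eq: "AE \<omega> in M. p n \<omega> + q n \<omega> * \<eta> n \<omega> = p (n+1) \<omega> + A (n+1) \<omega> * p (n+1) \<omega> + b (n+1) * C (n+1) \<omega> * q (n+1) \<omega>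
        + Q (n+1) * X v (n+1) \<omega> + C (n+1) \<omega> * p (n+1) \<omega> * \<xi> (n+1) \<omega>"
    using adjoint n unfolding lq_bsde_solution_def by meson
  show ?thesis
  proof (cases "Suc n < N")
    case True
    from eq adjoint_noise_coupling[OF True] show ?thesis
    proof eventually_elim
      case (elim \<omega>)
      have "C (Suc n) \<omega> = 0 \<or> p (Suc n) \<omega> = 0" using elim(2) by simp
      then show ?case using elim(1) True
        by (elim disjE) (simp_all add: lifted_def distrib_right del: state.simps)
    qed
  next
    case False
    then have N: "Suc n = N" using n by simp
    have "AE \<omega> in M. p N \<omega> = G * X v N \<omega>" "AE \<omega> in M. q N \<omega> = 0" "AE \<omega> in M. A N \<omega> = 0 \<and> C N \<omega> = 0" "Q N = 0"
      using adjoint unfolding lq_bsde_solution_def by blast+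
    from eq this(1-3) show ?thesis
      by eventually_elim (use N \<open>Q N = 0\<close> in \<open>auto simp: lifted_def simp del: state.simps\<close>)
  qed
qed

text \<open>Coercivity bounds \<open>p\<^sup>2 + q\<^sup>2\<close> by \<open>T (p m + q s)\<close>, where \<open>m\<close> and \<open>s\<close> are the drift and the diffusion of the state. The
formula for the control turns \<open>p m + q s\<close> into \<open>\<lambda> X - R v\<^sup>2\<close> with \<open>\<lambda>\<close> linear in \<open>p\<close> and \<open>q\<close>. Dropping the negative term
leaves \<open>p\<^sup>2 + q\<^sup>2 \<le> T \<bar>\<lambda>\<bar> \<bar>X\<bar>\<close>, quadratic on the left and linear on the right, so \<open>p\<close> and \<open>q\<close> are bounded by a
multiple of \<open>\<bar>X\<bar>\<close>. The same identity shows that \<open>\<lambda> X\<close> is nonnegative, which carries the sign to the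
previous time.\<close>

lemma feedback_step:
  assumes n: "n < N" and bd: "poly_bounded (Suc n) (lifted (Suc n)) (X v (Suc n))"
    and sgn: "AE \<omega> in M. 0 \<le> lifted (Suc n) \<omega> * X v (Suc n) \<omega>"
  shows "poly_bounded n (p n) (X v n)" "poly_bounded n (q n) (X v n)" "poly_bounded n (v n) (X v n)"
    "poly_bounded n (lifted n) (X v n)" "AE \<omega> in M. 0 \<le> lifted n \<omega> * X v n \<omega>"
proof -
  have n': "n \<le> N" using n by simp
  note [measurable] = p_measurable[OF n'] q_measurable[OF n'] control_measurable[OF n] optimal_state_measurable[OF n']
  have mm: "(\<lambda>\<omega>. drift n (X v n \<omega>) (v n \<omega>) \<omega>) \<in> borel_measurable (F n)"
    by (rule drift_measurable[OF n]) measurable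
  have ms: "(\<lambda>\<omega>. diffusion n (X v n \<omega>) (v n \<omega>) \<omega>) \<in> borel_measurable (F n)"
    by (rule diffusion_measurable[OF n]) measurable
  obtain T where Tb: "poly_bounded n T (\<lambda>_. 1)" and T1: "\<And>\<omega>. 1 \<le> T \<omega>"
    and T: "AE \<omega> in M. (p n \<omega>)\<^sup>2 + (q n \<omega>)\<^sup>2 \<le>
       T \<omega> * (p n \<omega> * drift n (X v n \<omega>) (v n \<omega>) \<omega> + q n \<omega> * diffusion n (X v n \<omega>) (v n \<omega>) \<omega>)"
    by (rule innovation_coercivity[OF p_measurable[OF n'] q_measurable[OF n'] mm ms adjoint_step[OF n] _ sgn bd])
      (auto simp: state_step simp del: state.simps)
  define \<psi> where "\<psi> \<omega> = 1 + A n \<omega> + C n \<omega> * prediction n \<omega>" for \<omega>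
  define \<kappa> where "\<kappa> \<omega> = \<bar>\<psi> \<omega>\<bar> + \<bar>b n * C n \<omega>\<bar>" for \<omega>
  define lam where "lam \<omega> = \<psi> \<omega> * p n \<omega> + b n * C n \<omega> * q n \<omega>" for \<omega>
  have id: "p n \<omega> * drift n (X v n \<omega>) (v n \<omega>) \<omega> + q n \<omega> * diffusion n (X v n \<omega>) (v n \<omega>) \<omega>
      = lam \<omega> * X v n \<omega> - R n * (v n \<omega>)\<^sup>2" if "\<omega> \<in> space M" for \<omega>
  proof -
    have "p n \<omega> * drift n (X v n \<omega>) (v n \<omega>) \<omega> + q n \<omega> * diffusion n (X v n \<omega>) (v n \<omega>) \<omega>
      = lam \<omega> * X v n \<omega> + ((B n \<omega> + D n \<omega> * prediction n \<omega>) * p n \<omega> + b n * D n \<omega> * q n \<omega>) * v n \<omega>"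
      by (simp add: drift_def diffusion_def lam_def \<psi>_def algebra_simps)
    then show ?thesis unfolding stationarity[OF n that] by (simp add: power2_eq_square)
  qed
  have main: "AE \<omega> in M. \<bar>p n \<omega>\<bar> + \<bar>q n \<omega>\<bar> \<le> \<bar>2 * T \<omega> * \<kappa> \<omega> * X v n \<omega>\<bar> \<and> 0 \<le> lam \<omega> * X v n \<omega>"
    using T AE_space
  proof eventually_elim
    case (elim \<omega>)
    let ?h = "\<bar>p n \<omega>\<bar> + \<bar>q n \<omega>\<bar>" and ?y = "X v n \<omega>"
    have Rv: "0 \<le> R n * (v n \<omega>)\<^sup>2" using weights(2)[OF n] by simp
    have t: "(p n \<omega>)\<^sup>2 + (q n \<omega>)\<^sup>2 \<le> T \<omega> * (lam \<omega> * ?y - R n * (v n \<omega>)\<^sup>2)"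
      using elim unfolding id[OF elim(2)] by simp
    then have "0 \<le> T \<omega> * (lam \<omega> * ?y - R n * (v n \<omega>)\<^sup>2)"
      by (rule order_trans[rotated]) simp
    then have "0 \<le> lam \<omega> * ?y - R n * (v n \<omega>)\<^sup>2"
      using T1[of \<omega>] by (simp add: zero_le_mult_iff)
    then have pos: "0 \<le> lam \<omega> * ?y" using Rv by linarith
    have \<kappa>: "0 \<le> \<kappa> \<omega>" by (simp add: \<kappa>_def)
    have "\<bar>lam \<omega>\<bar> \<le> \<bar>\<psi> \<omega>\<bar> * \<bar>p n \<omega>\<bar> + \<bar>b n * C n \<omega>\<bar> * \<bar>q n \<omega>\<bar>"
      unfolding lam_def abs_mult[symmetric] by (rule abs_triangle_ineq)
    also have "\<dots> \<le> \<bar>\<psi> \<omega>\<bar> * ?h + \<bar>b n * C n \<omega>\<bar> * ?h"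
      by (intro add_mono mult_left_mono) auto
    finally have lh: "\<bar>lam \<omega>\<bar> \<le> \<kappa> \<omega> * ?h" by (simp add: \<kappa>_def distrib_right)
    have "?h * ?h \<le> 2 * ((p n \<omega>)\<^sup>2 + (q n \<omega>)\<^sup>2)"
      using sum_squares_bound[of "\<bar>p n \<omega>\<bar>" "\<bar>q n \<omega>\<bar>"] by (simp add: power2_eq_square algebra_simps)
    also have "\<dots> \<le> 2 * (T \<omega> * (lam \<omega> * ?y - R n * (v n \<omega>)\<^sup>2))" using t by simp
    also have "\<dots> \<le> 2 * (T \<omega> * \<bar>lam \<omega> * ?y\<bar>)"
      using T1[of \<omega>] Rv by (intro mult_left_mono) auto
    also have "\<dots> \<le> 2 * (T \<omega> * (\<kappa> \<omega> * ?h * \<bar>?y\<bar>))"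
      unfolding abs_mult using lh T1[of \<omega>] by (intro mult_left_mono mult_right_mono) auto
    also have "\<dots> = \<bar>2 * T \<omega> * \<kappa> \<omega> * ?y\<bar> * ?h"
      using T1[of \<omega>] \<kappa> by (simp add: abs_mult)
    finally have "?h * ?h \<le> \<bar>2 * T \<omega> * \<kappa> \<omega> * ?y\<bar> * ?h" .
    moreover have "0 \<le> ?h" by simp
    ultimately have "?h \<le> \<bar>2 * T \<omega> * \<kappa> \<omega> * ?y\<bar>"
      by (metis abs_ge_zero mult_right_le_imp_le order_le_less)
    then show ?case using pos by simp
  qed
  have \<psi>b: "poly_bounded n \<psi> (\<lambda>_. 1)" unfolding \<psi>_def[abs_def]
    by (intro poly_bounded_add poly_bounded_const poly_bounded_mult_left coeff_poly_bounded n poly_bounded_prediction)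
  have bC: "poly_bounded n (\<lambda>\<omega>. b n * C n \<omega>) (\<lambda>_. 1)" by (intro poly_bounded_cmult coeff_poly_bounded n)
  have rb: "poly_bounded n (\<lambda>\<omega>. 2 * T \<omega> * \<kappa> \<omega> * X v n \<omega>) (X v n)"
    unfolding \<kappa>_def[abs_def]
    by (intro poly_bounded_mult_left poly_bounded_cmult poly_bounded_add poly_bounded_abs Tb \<psi>b bC poly_bounded_refl)
  show pb: "poly_bounded n (p n) (X v n)"
    by (rule poly_bounded_cmp[OF rb]) (use main in \<open>auto elim!: eventually_mono\<close>)
  show qb: "poly_bounded n (q n) (X v n)"
    by (rule poly_bounded_cmp[OF rb]) (use main in \<open>auto elim!: eventually_mono\<close>)
  have "poly_bounded n (\<lambda>\<omega>. - inverse (R n) * ((B n \<omega> * p n \<omega> + prediction n \<omega> * (D n \<omega> * p n \<omega>)) + b n * (D n \<omega> * q n \<omega>))) (X v n)"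
    by (intro poly_bounded_cmult poly_bounded_add poly_bounded_mult_left coeff_poly_bounded n poly_bounded_prediction pb qb)
  then show "poly_bounded n (v n) (X v n)"
    by (rule poly_bounded_cong) (rule AE_I2, simp add: control[OF n] mult_ac)
  have "poly_bounded n (\<lambda>\<omega>. \<psi> \<omega> * p n \<omega> + (b n * C n \<omega>) * q n \<omega> + Q n * X v n \<omega>) (X v n)"
    by (intro poly_bounded_add poly_bounded_mult_left[OF \<psi>b] poly_bounded_mult_left[OF bC] poly_bounded_cmult pb qb poly_bounded_refl)
  then show "poly_bounded n (lifted n) (X v n)"
    by (rule poly_bounded_cong) (rule AE_I2, simp add: lifted_def n \<psi>_def)
  show "AE \<omega> in M. 0 \<le> lifted n \<omega> * X v n \<omega>"
    using main
  proof eventually_elim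
    case (elim \<omega>)
    have "lifted n \<omega> * X v n \<omega> = lam \<omega> * X v n \<omega> + Q n * (X v n \<omega>)\<^sup>2"
      using n by (simp add: lifted_def lam_def \<psi>_def power2_eq_square algebra_simps)
    then show ?case using elim weights(1)[OF n] by simp
  qed
qed

lemma feedback:
  assumes "n \<le> N"
  shows "poly_bounded n (lifted n) (X v n) \<and> (AE \<omega> in M. 0 \<le> lifted n \<omega> * X v n \<omega>)"
  using assms
proof (induction n rule: inc_induct)
  case base
  have "poly_bounded N (\<lambda>\<omega>. G * X v N \<omega>) (X v N)" by (rule poly_bounded_cmult[OF poly_bounded_refl])
  then show ?case using weights(3) by (simp add: lifted_def[abs_def] mult.assoc)
next
  case (step n)
  then show ?case using feedback_step(4,5)[of n] by simp
qed

lemma feedback_bounds: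
  assumes "n < N"
  shows "poly_bounded n (p n) (X v n)" "poly_bounded n (q n) (X v n)" "poly_bounded n (v n) (X v n)"
  using feedback_step(1-3)[OF assms] feedback[of "Suc n"] assms by auto

text \<open>Forward in time, each step of the closed loop multiplies the bound by a polynomial in the noise seen so far.\<close>

lemma optimal_state_bound: "n \<le> N \<Longrightarrow> poly_bounded n (X v n) x"
proof (induction n)
  case 0
  then show ?case by (simp add: poly_bounded_refl)
next
  case (Suc n)
  then have n: "n < N" and y: "poly_bounded n (X v n) x" by auto
  show ?case
    by (rule state_poly_bounded[OF n y poly_bounded_trans[OF feedback_bounds(3)[OF n] y]])
qed

lemma optimal_control_bound:
  assumes "n < N" shows "poly_bounded N (v n) x"
  using poly_bounded_trans[OF feedback_bounds(3)[OF assms] optimal_state_bound] poly_bounded_mono[of n "v n" x N] assms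
  by simp

section \<open>Duality and the cost\<close>

context
  fixes u :: "nat \<Rightarrow> 'w \<Rightarrow> real"
  assumes u_adapted: "\<And>n. n < N \<Longrightarrow> u n \<in> borel_measurable (F n)"
    and u_tempered: "\<And>n. n < N \<Longrightarrow> tempered N (u n)" and x_tempered: "tempered N x"
begin

lemma tempered_optimal_control: "n < N \<Longrightarrow> tempered N (v n)"
  by (rule tempered_poly_bounded[OF x_tempered optimal_control_bound measurable_filtration[OF control_measurable]])

lemma tempered_states: "n \<le> N \<Longrightarrow> tempered N (X u n)" "n \<le> N \<Longrightarrow> tempered N (X v n)"
  using tempered_state[OF x_tempered] u_tempered tempered_optimal_control by auto

lemma tempered_feedback:
  assumes "poly_bounded n Y (X v n)" "Y \<in> borel_measurable (F n)" "n \<le> N"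
  shows "tempered N Y"
  by (rule tempered_poly_bounded[OF tempered_states(2)[OF assms(3)] poly_bounded_mono[OF assms(1,3)]
        measurable_filtration[OF assms(2)]])

lemma lifted_measurable:
  assumes "n \<le> N" shows "lifted n \<in> borel_measurable (F n)"
proof (cases "n < N")
  case True
  note [measurable] = coeff_adapted[OF True] p_measurable[OF assms] q_measurable[OF assms]
    optimal_state_measurable[OF assms] prediction_measurable[of n]
  show ?thesis unfolding lifted_def[abs_def] using True by simp
next
  case False
  note [measurable] = optimal_state_measurable[OF assms]
  show ?thesis unfolding lifted_def[abs_def] using False by simp
qed

lemma tempered_lifted: "n \<le> N \<Longrightarrow> tempered N (lifted n)"
  using tempered_feedback feedback lifted_measurable by blast

text \<open>Both factors on the left are affine in the innovation: the first by the adjoint equation, the second because the state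
equation is linear. Taking expectations pairs \<open>p\<close> with the drift and \<open>q\<close> with the diffusion of the difference;
the coefficient of \<open>u - v\<close> is the stationarity expression, equal to \<open>- R v\<close>.\<close>

lemma duality_step:
  assumes n: "n < N"
  shows "(\<integral>\<omega>. lifted (Suc n) \<omega> * (X u (Suc n) \<omega> - X v (Suc n) \<omega>) \<partial>M) =
    (\<integral>\<omega>. lifted n \<omega> * (X u n \<omega> - X v n \<omega>) \<partial>M)
    - (\<integral>\<omega>. Q n * X v n \<omega> * (X u n \<omega> - X v n \<omega>) + R n * v n \<omega> * (u n \<omega> - v n \<omega>) \<partial>M)"
proof -
  have n': "n \<le> N" "Suc n \<le> N" using n by auto
  define dX where "dX \<omega> = X u n \<omega> - X v n \<omega>" for \<omega>
  define du where "du \<omega> = u n \<omega> - v n \<omega>" for \<omega>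
  note mF = p_measurable[OF n'(1)] q_measurable[OF n'(1)] control_measurable[OF n] optimal_state_measurable[OF n'(1)]
    u_adapted[OF n] state_measurable[OF u_adapted n'(1)]
  have dXm: "dX \<in> borel_measurable (F n)" and dum: "du \<in> borel_measurable (F n)"
    unfolding dX_def[abs_def] du_def[abs_def] using mF by (auto intro!: borel_measurable_diff)
  have dXt: "tempered N dX" and dut: "tempered N du"
    unfolding dX_def[abs_def] du_def[abs_def]
    using tempered_states[OF n'(1)] u_tempered[OF n] tempered_optimal_control[OF n] by (auto intro!: tempered_diff)
  have pt: "tempered N (p n)" and qt: "tempered N (q n)"
    using tempered_feedback[OF feedback_bounds(1)[OF n] mF(1) n'(1)] tempered_feedback[OF feedback_bounds(2)[OF n] mF(2) n'(1)] by auto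
  have step: "X u (Suc n) \<omega> - X v (Suc n) \<omega> = drift n (dX \<omega>) (du \<omega>) \<omega> + diffusion n (dX \<omega>) (du \<omega>) \<omega> * \<eta> n \<omega>" for \<omega>
    unfolding state_step dX_def du_def drift_diff[symmetric] diffusion_diff[symmetric] by (simp add: algebra_simps)
  have "(\<integral>\<omega>. lifted (Suc n) \<omega> * (X u (Suc n) \<omega> - X v (Suc n) \<omega>) \<partial>M) =
     (\<integral>\<omega>. (p n \<omega> + q n \<omega> * \<eta> n \<omega>) * (drift n (dX \<omega>) (du \<omega>) \<omega> + diffusion n (dX \<omega>) (du \<omega>) \<omega> * \<eta> n \<omega>) \<partial>M)"
  proof (rule integral_cong_AE)
    have [measurable]: "lifted (Suc n) \<in> borel_measurable M" "X u (Suc n) \<in> borel_measurable M" "X v (Suc n) \<in> borel_measurable M"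
      using tempered_lifted[OF n'(2)] tempered_states[OF n'(2)] by (auto dest: tempered_measurable simp del: state.simps)
    show "(\<lambda>\<omega>. lifted (Suc n) \<omega> * (X u (Suc n) \<omega> - X v (Suc n) \<omega>)) \<in> borel_measurable M"
      by (simp del: state.simps)
    have [measurable]: "p n \<in> borel_measurable M" "q n \<in> borel_measurable M"
      "(\<lambda>\<omega>. drift n (dX \<omega>) (du \<omega>) \<omega>) \<in> borel_measurable M" "(\<lambda>\<omega>. diffusion n (dX \<omega>) (du \<omega>) \<omega>) \<in> borel_measurable M"
      using mF(1,2) drift_measurable[OF n dXm dum] diffusion_measurable[OF n dXm dum] by (auto intro: measurable_filtration)
    show "(\<lambda>\<omega>. (p n \<omega> + q n \<omega> * \<eta> n \<omega>) * (drift n (dX \<omega>) (du \<omega>) \<omega> + diffusion n (dX \<omega>) (du \<omega>) \<omega> * \<eta> n \<omega>)) \<in> borel_measurable M"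
      by measurable
    show "AE \<omega> in M. lifted (Suc n) \<omega> * (X u (Suc n) \<omega> - X v (Suc n) \<omega>) =
      (p n \<omega> + q n \<omega> * \<eta> n \<omega>) * (drift n (dX \<omega>) (du \<omega>) \<omega> + diffusion n (dX \<omega>) (du \<omega>) \<omega> * \<eta> n \<omega>)"
      using adjoint_step[OF n] by eventually_elim (simp only: step)
  qed
  also have "\<dots> = (\<integral>\<omega>. p n \<omega> * drift n (dX \<omega>) (du \<omega>) \<omega> + q n \<omega> * diffusion n (dX \<omega>) (du \<omega>) \<omega> \<partial>M)"
    by (rule expectation_affine_product[OF mF(1,2) drift_measurable[OF n dXm dum] diffusion_measurable[OF n dXm dum]
          pt qt tempered_drift[OF n dXt dut] tempered_diffusion[OF n dXt dut]])
  also have "\<dots> = (\<integral>\<omega>. lifted n \<omega> * dX \<omega> - (Q n * X v n \<omega> * dX \<omega> + R n * v n \<omega> * du \<omega>) \<partial>M)"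
  proof (rule Bochner_Integration.integral_cong[OF refl])
    fix \<omega> assume \<omega>: "\<omega> \<in> space M"
    have "p n \<omega> * drift n (dX \<omega>) (du \<omega>) \<omega> + q n \<omega> * diffusion n (dX \<omega>) (du \<omega>) \<omega> =
      (lifted n \<omega> - Q n * X v n \<omega>) * dX \<omega>
       + ((B n \<omega> + D n \<omega> * prediction n \<omega>) * p n \<omega> + b n * D n \<omega> * q n \<omega>) * du \<omega>"
      using n by (simp add: drift_def diffusion_def lifted_def algebra_simps)
    then show "p n \<omega> * drift n (dX \<omega>) (du \<omega>) \<omega> + q n \<omega> * diffusion n (dX \<omega>) (du \<omega>) \<omega> =
      lifted n \<omega> * dX \<omega> - (Q n * X v n \<omega> * dX \<omega> + R n * v n \<omega> * du \<omega>)"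
      unfolding stationarity[OF n \<omega>] by (simp add: algebra_simps)
  qed
  also have "\<dots> = (\<integral>\<omega>. lifted n \<omega> * dX \<omega> \<partial>M) - (\<integral>\<omega>. Q n * X v n \<omega> * dX \<omega> + R n * v n \<omega> * du \<omega> \<partial>M)"
    by (intro Bochner_Integration.integral_diff Bochner_Integration.integrable_add tempered_product_integrable[where n=N]
        tempered_cmult tempered_lifted dXt dut tempered_states tempered_optimal_control n n'(1))
  finally show ?thesis unfolding dX_def du_def .
qed

lemma duality:
  assumes "n \<le> N"
  shows "(\<integral>\<omega>. lifted n \<omega> * (X u n \<omega> - X v n \<omega>) \<partial>M) =
    - (\<Sum>k<n. \<integral>\<omega>. Q k * X v k \<omega> * (X u k \<omega> - X v k \<omega>) + R k * v k \<omega> * (u k \<omega> - v k \<omega>) \<partial>M)"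
  using assms
proof (induction n)
  case 0
  then show ?case by simp
next
  case (Suc n)
  then have n: "n < N" by simp
  show ?case unfolding duality_step[OF n] using Suc.IH n by simp
qed

text \<open>The cost is quadratic, so its expansion around \<open>v\<close> stops at second order; the first-order term is the sum of
the terms produced by the duality up to the horizon, where the lifted adjoint is \<open>G X\<^sub>N\<close>.\<close>

lemma cost_expansion:
  "J u = J v + 1/2 * (\<integral>\<omega>. (\<Sum>n<N. Q n * (X u n \<omega> - X v n \<omega>)\<^sup>2 + R n * (u n \<omega> - v n \<omega>)\<^sup>2)
      + G * (X u N \<omega> - X v N \<omega>)\<^sup>2 \<partial>M)"
proof -
  define cross where "cross k \<omega> = Q k * X v k \<omega> * (X u k \<omega> - X v k \<omega>) + R k * v k \<omega> * (u k \<omega> - v k \<omega>)" for k \<omega>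
  define quad where "quad y w \<omega> = (\<Sum>n<N. Q n * (y n \<omega>)\<^sup>2 + R n * (w n \<omega>)\<^sup>2) + G * (y N \<omega>)\<^sup>2"
    for y w :: "nat \<Rightarrow> 'w \<Rightarrow> real" and \<omega>
  let ?dX = "\<lambda>n \<omega>. X u n \<omega> - X v n \<omega>" and ?du = "\<lambda>n \<omega>. u n \<omega> - v n \<omega>"
  have tX: "tempered N (X u n)" "tempered N (X v n)" "tempered N (?dX n)" if "n \<le> N" for n
    using tempered_states[OF that] by (auto intro: tempered_diff)
  have tu: "tempered N (u n)" "tempered N (v n)" "tempered N (?du n)" if "n < N" for n
    using u_tempered[OF that] tempered_optimal_control[OF that] by (auto intro: tempered_diff)
  have qi: "integrable M (quad y w)" if "\<And>n. n \<le> N \<Longrightarrow> tempered N (y n)" "\<And>n. n < N \<Longrightarrow> tempered N (w n)" for y w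
    unfolding quad_def[abs_def]
    by (intro Bochner_Integration.integrable_add Bochner_Integration.integrable_sum
        Bochner_Integration.integrable_mult_right tempered_square_integrable[where n=N] that) auto
  have ci: "integrable M (cross k)" if "k < N" for k
    unfolding cross_def[abs_def] using that
    by (intro Bochner_Integration.integrable_add tempered_product_integrable[where n=N] tempered_cmult tX tu) auto
  have Gi: "integrable M (\<lambda>\<omega>. G * X v N \<omega> * ?dX N \<omega>)"
    by (intro tempered_product_integrable[where n=N] tempered_cmult tX) auto
  have "quad (X u) u \<omega> = quad (X v) v \<omega> + 2 * ((\<Sum>k<N. cross k \<omega>) + G * X v N \<omega> * ?dX N \<omega>) + quad ?dX ?du \<omega>" for \<omega>
  proof -
    have "Q n * (X u n \<omega>)\<^sup>2 + R n * (u n \<omega>)\<^sup>2 = Q n * (X v n \<omega>)\<^sup>2 + R n * (v n \<omega>)\<^sup>2 + 2 * cross n \<omega>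
      + (Q n * (?dX n \<omega>)\<^sup>2 + R n * (?du n \<omega>)\<^sup>2)" for n
      by (simp add: cross_def power2_eq_square algebra_simps)
    moreover have "G * (X u N \<omega>)\<^sup>2 = G * (X v N \<omega>)\<^sup>2 + 2 * (G * X v N \<omega> * ?dX N \<omega>) + G * (?dX N \<omega>)\<^sup>2"
      by (simp add: power2_eq_square algebra_simps)
    ultimately show ?thesis by (simp only: quad_def sum.distrib sum_distrib_left distrib_left)
  qed
  then have "(\<integral>\<omega>. quad (X u) u \<omega> \<partial>M) = (\<integral>\<omega>. quad (X v) v \<omega> + 2 * ((\<Sum>k<N. cross k \<omega>) + G * X v N \<omega> * ?dX N \<omega>) + quad ?dX ?du \<omega> \<partial>M)"
    by simp
  also have "\<dots> = (\<integral>\<omega>. quad (X v) v \<omega> \<partial>M) + 2 * ((\<Sum>k<N. \<integral>\<omega>. cross k \<omega> \<partial>M) + (\<integral>\<omega>. G * X v N \<omega> * ?dX N \<omega> \<partial>M))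
      + (\<integral>\<omega>. quad ?dX ?du \<omega> \<partial>M)"
  proof -
    have s: "integrable M (\<lambda>\<omega>. \<Sum>k<N. cross k \<omega>)" by (rule Bochner_Integration.integrable_sum) (use ci in auto)
    have "(\<integral>\<omega>. (\<Sum>k<N. cross k \<omega>) \<partial>M) = (\<Sum>k<N. \<integral>\<omega>. cross k \<omega> \<partial>M)"
      by (rule Bochner_Integration.integral_sum) (use ci in auto)
    moreover have "integrable M (quad (X v) v)" "integrable M (quad ?dX ?du)"
      by (auto intro!: qi tX tu)
    ultimately show ?thesis using s Gi
      by (simp only: Bochner_Integration.integral_add Bochner_Integration.integrable_add Bochner_Integration.integral_mult_right_zero
        Bochner_Integration.integrable_mult_right)
  qed
  also have "(\<Sum>k<N. \<integral>\<omega>. cross k \<omega> \<partial>M) + (\<integral>\<omega>. G * X v N \<omega> * ?dX N \<omega> \<partial>M) = 0"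
    using duality[of N] unfolding cross_def lifted_def by simp
  finally show ?thesis
    unfolding lq_cost_def quad_def by simp
qed

lemma cost_gap_nonneg: "J v \<le> J u"
proof -
  have "0 \<le> (\<integral>\<omega>. (\<Sum>n<N. Q n * (X u n \<omega> - X v n \<omega>)\<^sup>2 + R n * (u n \<omega> - v n \<omega>)\<^sup>2)
      + G * (X u N \<omega> - X v N \<omega>)\<^sup>2 \<partial>M)"
    using weights by (intro integral_nonneg_AE AE_I2 add_nonneg_nonneg sum_nonneg mult_nonneg_nonneg)
      (auto simp: less_imp_le)
  then show ?thesis unfolding cost_expansion by simp
qed

lemma cost_gap_zero:
  assumes "J u = J v" shows "AE \<omega> in M. \<forall>n<N. u n \<omega> = v n \<omega>"
proof -
  let ?f = "\<lambda>\<omega>. (\<Sum>n<N. Q n * (X u n \<omega> - X v n \<omega>)\<^sup>2 + R n * (u n \<omega> - v n \<omega>)\<^sup>2) + G * (X u N \<omega> - X v N \<omega>)\<^sup>2"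
  have nn: "0 \<le> Q n * (X u n \<omega> - X v n \<omega>)\<^sup>2 + R n * (u n \<omega> - v n \<omega>)\<^sup>2" if "n < N" for n \<omega>
    using weights(1)[OF that] weights(2)[OF that] by simp
  have i: "integrable M ?f"
    using tempered_states u_tempered tempered_optimal_control
    by (intro Bochner_Integration.integrable_add Bochner_Integration.integrable_sum
        Bochner_Integration.integrable_mult_right tempered_square_integrable[where n=N] tempered_diff) auto
  have f0: "0 \<le> ?f \<omega>" for \<omega>
    using weights(3) by (intro add_nonneg_nonneg[OF sum_nonneg]) (simp_all add: nn)
  have "(\<integral>\<omega>. ?f \<omega> \<partial>M) = 0" using assms cost_expansion by simp
  then have "AE \<omega> in M. ?f \<omega> = 0"
    using integral_nonneg_eq_0_iff_AE[OF i] f0 by simp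
  then show ?thesis
  proof eventually_elim
    case (elim \<omega>)
    have "0 \<le> (\<Sum>n<N. Q n * (X u n \<omega> - X v n \<omega>)\<^sup>2 + R n * (u n \<omega> - v n \<omega>)\<^sup>2)"
      by (rule sum_nonneg) (use nn in auto)
    moreover have "0 \<le> G * (X u N \<omega> - X v N \<omega>)\<^sup>2" using weights(3) by simp
    ultimately have "(\<Sum>n<N. Q n * (X u n \<omega> - X v n \<omega>)\<^sup>2 + R n * (u n \<omega> - v n \<omega>)\<^sup>2) = 0"
      using elim by linarith
    then have z: "Q n * (X u n \<omega> - X v n \<omega>)\<^sup>2 + R n * (u n \<omega> - v n \<omega>)\<^sup>2 = 0" if "n < N" for n
      using that nn by (subst (asm) sum_nonneg_eq_0_iff) auto
    show ?case
    proof (intro allI impI)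
      fix n assume n: "n < N"
      have "0 \<le> Q n * (X u n \<omega> - X v n \<omega>)\<^sup>2" "0 \<le> R n * (u n \<omega> - v n \<omega>)\<^sup>2"
        using weights(1)[OF n] weights(2)[OF n] by simp_all
      then have "R n * (u n \<omega> - v n \<omega>)\<^sup>2 = 0" using z[OF n] by linarith
      then show "u n \<omega> = v n \<omega>" using weights(2)[OF n] by simp
    qed
  qed
qed

end

end

section \<open>Admissible controls\<close>

lemma (in whitened_gaussian_sequence) innovation_noise_filtration:
  assumes F0: "subalgebra M F0"
    and ind: "indep_set (sets F0) (sigma_sets (space M) (noise_events M \<xi> UNIV))"
  shows "innovation_noise M (noise_filtration M F0 \<xi>) \<xi> \<eta> (pred_coeff \<beta> \<alpha>) (\<lambda>n. \<beta> n n)"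
proof
  let ?F = "noise_filtration M F0 \<xi>"
  note s = noise_filtration_sets[OF F0]
  have sp: "space (?F n) = space M" for n by (simp add: noise_filtration_def space_measure_of_conv)
  show i: "indep_set (sets (?F n)) (sigma_sets (space M) {\<eta> n -` A \<inter> space M |A. A \<in> sets borel})" for n
    by (rule white_noise_indep_past[OF F0 ind])
  have "sets (?F n) \<subseteq> events" for n
    using i[of n] unfolding indep_sets2_eq by (rule conjunct1)
  then show "subalgebra M (?F n)" for n
    by (simp add: subalgebra_def sp)
  show "sets (?F m) \<subseteq> sets (?F n)" if "m \<le> n" for m n
  proof -
    have "noise_events M \<xi> {..<m} \<subseteq> noise_events M \<xi> {..<n}"
      unfolding noise_events_def using that by (intro UN_mono) auto
    then show ?thesis unfolding s by (intro sigma_sets_mono') blast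
  qed
  show "\<xi> n \<in> borel_measurable (?F (Suc n))" for n
  proof (rule measurableI)
    fix S :: "real set" assume "S \<in> sets borel"
    then have "\<xi> n -` S \<inter> space M \<in> noise_events M \<xi> {..<Suc n}" by (auto simp: noise_events_def)
    then show "\<xi> n -` S \<inter> space (?F (Suc n)) \<in> sets (?F (Suc n))"
      unfolding s sp by (intro sigma_sets.Basic) simp
  qed simp
  show "\<xi> n \<omega> = (\<Sum>k<n. pred_coeff \<beta> \<alpha> n k * \<xi> k \<omega>) + \<beta> n n * \<eta> n \<omega>" for n \<omega>
    by (rule noise_prediction)
  show "0 < \<beta> n n" for n by (rule factor_diag)
  show "distributed M lborel (\<eta> n) std_normal_density" for n by (rule std_normal_white_noise)
  show "integrable M (\<lambda>\<omega>. \<bar>\<xi> n \<omega>\<bar> ^ k)" for n k by (rule noise_moment)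
qed

lemma adapted_of_progressively_measurable:
  assumes "progressively_measurable_on T F u" "n \<in> T"
  shows "u n \<in> borel_measurable (F n)"
proof -
  have u: "(\<lambda>(k, \<omega>). u k \<omega>) \<in> borel_measurable (count_space {..n} \<Otimes>\<^sub>M F n)"
    using assms unfolding progressively_measurable_on_def by blast
  have "n \<in> space (count_space {..n})" by (simp only: space_count_space atMost_iff order_refl)
  from measurable_Pair2[OF u this] show ?thesis unfolding prod.case .
qed

lemma (in innovation_noise) progressively_measurable_of_adapted:
  assumes "\<And>n. n < N \<Longrightarrow> u n \<in> borel_measurable (F n)"
  shows "progressively_measurable_on {..<N} F u"
  unfolding progressively_measurable_on_def
proof
  fix n assume n: "n \<in> {..<N}"
  show "(\<lambda>(k, \<omega>). u k \<omega>) \<in> borel_measurable (count_space {..n} \<Otimes>\<^sub>M F n)"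
  proof (rule measurable_pair_measure_countable1)
    fix k assume "k \<in> {..n}"
    then have "k \<le> n" "k < N" using n by auto
    then show "(\<lambda>\<omega>. case (k, \<omega>) of (k, \<omega>) \<Rightarrow> u k \<omega>) \<in> borel_measurable (F n)"
      unfolding prod.case using measurable_filtration_mono assms by blast
  qed (rule countable_finite[OF finite_atMost])
qed

text \<open>Raising the bound to the power \<open>a\<close> gives the noise size a real exponent, which is rounded up to a natural number.\<close>

lemma (in innovation_noise) poly_bounded_moment:
  assumes a: "0 < a" and Y[measurable]: "Y \<in> borel_measurable M" and bd: "poly_bounded n Y Z"
    and int: "\<And>k. integrable M (\<lambda>\<omega>. noise_size n \<omega> ^ k * \<bar>Z \<omega>\<bar> powr a)"
  shows "integrable M (\<lambda>\<omega>. \<bar>Y \<omega>\<bar> powr a)"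
proof -
  obtain K d where K: "0 \<le> K" and 1: "AE \<omega> in M. \<bar>Y \<omega>\<bar> \<le> K * noise_size n \<omega> ^ d * \<bar>Z \<omega>\<bar>"
    using bd unfolding poly_bounded_def by blast
  define j where "j = nat \<lceil>real d * a\<rceil>"
  have j: "real d * a \<le> real j" unfolding j_def by linarith
  show ?thesis
  proof (rule Bochner_Integration.integrable_bound)
    show "integrable M (\<lambda>\<omega>. K powr a * (noise_size n \<omega> ^ j * \<bar>Z \<omega>\<bar> powr a))" using int by simp
    show "AE \<omega> in M. norm (\<bar>Y \<omega>\<bar> powr a) \<le> norm (K powr a * (noise_size n \<omega> ^ j * \<bar>Z \<omega>\<bar> powr a))"
      using 1
    proof eventually_elim
      case (elim \<omega>)
      let ?s = "noise_size n \<omega>"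
      have s: "1 \<le> ?s" by (rule noise_size_ge_1)
      have "\<bar>Y \<omega>\<bar> powr a \<le> (K * ?s ^ d * \<bar>Z \<omega>\<bar>) powr a" using elim a by (intro powr_mono2) auto
      also have "\<dots> = K powr a * ((?s ^ d) powr a * \<bar>Z \<omega>\<bar> powr a)" using K s by (simp add: powr_mult)
      also have "(?s ^ d) powr a = ?s powr (real d * a)" using s by (simp add: powr_realpow[symmetric] powr_powr)
      also have "K powr a * (?s powr (real d * a) * \<bar>Z \<omega>\<bar> powr a) \<le> K powr a * (?s ^ j * \<bar>Z \<omega>\<bar> powr a)"
      proof -
        have "?s powr (real d * a) \<le> ?s powr real j" using s j by (intro powr_mono) auto
        also have "\<dots> = ?s ^ j" using s by (simp add: powr_realpow)
        finally show ?thesis by (intro mult_left_mono mult_right_mono) auto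
      qed
      finally show ?case using s by (simp add: abs_mult)
    qed
  qed simp
qed

lemma lipschitz_lin_coeff:
  assumes "L-lipschitz_on UNIV (\<lambda>(y, w). lin_coeff A B n y w \<omega>)"
  shows "\<bar>A n \<omega>\<bar> \<le> L" "\<bar>B n \<omega>\<bar> \<le> L"
  using lipschitz_onD[OF assms, of "(1, 0)" "(0, 0)"] lipschitz_onD[OF assms, of "(0, 1)" "(0, 0)"]
  by (auto simp: lin_coeff_def dist_real_def dist_Pair_Pair)

section \<open>Optimality of the feedback control\<close>

theorem theorem3:
  fixes M F0 :: "'w measure"
    and H a L G :: real and N :: nat and U :: "real set"
    and W :: "real \<Rightarrow> 'w \<Rightarrow> real"
    and \<xi> \<eta> :: "nat \<Rightarrow> 'w \<Rightarrow> real" and F :: "nat \<Rightarrow> 'w measure"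
    and \<beta> \<alpha> :: "nat \<Rightarrow> nat \<Rightarrow> real"
    and x :: "'w \<Rightarrow> real"
    and A B C D :: "nat \<Rightarrow> 'w \<Rightarrow> real" and Q R :: "nat \<Rightarrow> real"
    and X :: "(nat \<Rightarrow> 'w \<Rightarrow> real) \<Rightarrow> nat \<Rightarrow> 'w \<Rightarrow> real"
    and J :: "(nat \<Rightarrow> 'w \<Rightarrow> real) \<Rightarrow> real" and \<U> :: "(nat \<Rightarrow> 'w \<Rightarrow> real) set"
    and p q u_opt :: "nat \<Rightarrow> 'w \<Rightarrow> real"
  defines "\<xi> \<equiv> fractional_noise W"
    and "\<eta> \<equiv> white_noise \<alpha> \<xi>"
    and "F \<equiv> noise_filtration M F0 \<xi>"
    and "X \<equiv> state (lin_coeff A B) (lin_coeff C D) \<xi> x"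
    and "J \<equiv> \<lambda>u. lq_cost M N Q R G (X u) u"
    and "\<U> \<equiv> admissible_controls M F N a U"
  assumes H: "0 < H" "H < 1" and a: "1 < a" and N: "1 \<le> N" and L: "0 < L"
    and M: "prob_space M"
    and W: "fractional_brownian_motion M H W"
    and F0: "subalgebra M F0"
    and F0_indep: "prob_space.indep_set M (sets F0)
                     (sigma_sets (space M) (noise_events M \<xi> UNIV))"
    and x_measurable: "x \<in> borel_measurable F0"
    and x_moment: "integrable M (\<lambda>\<omega>. \<bar>x \<omega>\<bar> powr (2 * a))"
    and x_indep: "prob_space.indep_set M (sets (vimage_algebra (space M) x borel))
                     (sigma_sets (space M) (noise_events M \<xi> UNIV))"
    and U: "closed U" "convex U"
    and \<beta>: "whitening_factor (noise_cov H) \<beta>"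
    and \<alpha>: "lower_triangular_inverse \<beta> \<alpha>"
    and coeffs: "standing_assumptions M F N a L (lin_coeff A B) (lin_coeff C D)
                   (quad_running Q R) (quad_terminal G)"
    and Q: "\<forall>n<N. 0 \<le> Q n" and G: "0 \<le> G" and R: "\<forall>n<N. 0 < R n"
    and u_opt: "\<forall>n<N. \<forall>\<omega>\<in>space M.
        u_opt n \<omega> = - inverse (R n) *
          (B n \<omega> * p n \<omega> + D n \<omega> * p n \<omega> * (\<Sum>k<n. pred_coeff \<beta> \<alpha> n k * \<xi> k \<omega>)
           + \<beta> n n * D n \<omega> * q n \<omega>)"
    and u_opt_values: "\<forall>n<N. \<forall>\<omega>\<in>space M. u_opt n \<omega> \<in> U"
    and pq: "lq_bsde_solution M F N \<beta> \<xi> \<eta> A C Q G (X u_opt) p q"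
  shows "u_opt \<in> \<U> \<and> J u_opt = (INF u\<in>\<U>. J u) \<and>
         (\<forall>u\<in>\<U>. J u = (INF v\<in>\<U>. J v) \<longrightarrow> (AE \<omega> in M. \<forall>n<N. u n \<omega> = u_opt n \<omega>))"
proof -
  interpret prob_space M by (rule M)
  interpret g: centered_gaussian_sequence M \<xi> "noise_cov H"
    unfolding \<xi>_def by (rule centered_gaussian_fractional_noise[OF W])
  interpret w: whitened_gaussian_sequence M \<xi> "noise_cov H" \<beta> \<alpha>
    by unfold_locales (fact \<beta>, fact \<alpha>)
  interpret i: innovation_noise M F \<xi> \<eta> "pred_coeff \<beta> \<alpha>" "\<lambda>n. \<beta> n n"
    unfolding F_def \<eta>_def by (rule w.innovation_noise_filtration[OF F0 F0_indep])
  have coeff_meas: "A n \<in> borel_measurable (F n)" "B n \<in> borel_measurable (F n)"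
    "C n \<in> borel_measurable (F n)" "D n \<in> borel_measurable (F n)" if "n < N" for n
  proof -
    have *: "lin_coeff A B n y w \<in> borel_measurable (F n)" "lin_coeff C D n y w \<in> borel_measurable (F n)" for y w
      using coeffs that unfolding standing_assumptions_def adapted_on_def by auto
    have "lin_coeff A B n 1 0 = A n" "lin_coeff A B n 0 1 = B n" "lin_coeff C D n 1 0 = C n" "lin_coeff C D n 0 1 = D n"
      by (auto simp: lin_coeff_def fun_eq_iff)
    with * show "A n \<in> borel_measurable (F n)" "B n \<in> borel_measurable (F n)"
      "C n \<in> borel_measurable (F n)" "D n \<in> borel_measurable (F n)" by metis+
  qed
  have lip: "AE \<omega> in M. \<forall>n<N. smooth_lipschitz L (\<lambda>x u. lin_coeff A B n x u \<omega>) \<and>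
                       smooth_lipschitz L (\<lambda>x u. lin_coeff C D n x u \<omega>)"
    using coeffs unfolding standing_assumptions_def by blast
  have bounds: "AE \<omega> in M. \<bar>A n \<omega>\<bar> \<le> L \<and> \<bar>B n \<omega>\<bar> \<le> L \<and> \<bar>C n \<omega>\<bar> \<le> L \<and> \<bar>D n \<omega>\<bar> \<le> L" if "n < N" for n
    using lip
  proof eventually_elim
    case (elim \<omega>)
    then have l: "L-lipschitz_on UNIV (\<lambda>(y, w). lin_coeff A B n y w \<omega>)" "L-lipschitz_on UNIV (\<lambda>(y, w). lin_coeff C D n y w \<omega>)"
      using that unfolding smooth_lipschitz_def by blast+
    show ?case using lipschitz_lin_coeff[OF l(1)] lipschitz_lin_coeff[OF l(2)] by blast
  qed
  have F_0: "x \<in> borel_measurable (F 0)"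
  proof (rule measurable_from_subalg[OF _ x_measurable])
    show "subalgebra (F 0) F0"
      using F0 unfolding subalgebra_def F_def noise_filtration_sets[OF F0]
      by (auto simp: noise_filtration_def space_measure_of_conv)
  qed
  interpret lq: lq_adjoint M F \<xi> \<eta> "pred_coeff \<beta> \<alpha>" "\<lambda>n. \<beta> n n" N A B C D Q R G L x p q u_opt
  proof
    fix n assume n: "n < N"
    show "AE \<omega> in M. \<bar>A n \<omega>\<bar> \<le> L" "AE \<omega> in M. \<bar>B n \<omega>\<bar> \<le> L" "AE \<omega> in M. \<bar>C n \<omega>\<bar> \<le> L" "AE \<omega> in M. \<bar>D n \<omega>\<bar> \<le> L"
      using bounds[OF n] by (auto elim!: eventually_mono)
    show "u_opt n \<omega> = - inverse (R n) * (B n \<omega> * p n \<omega> + D n \<omega> * p n \<omega> * i.prediction n \<omega> + \<beta> n n * D n \<omega> * q n \<omega>)"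
      if "\<omega> \<in> space M" for \<omega>
      using u_opt n that unfolding i.prediction_def by blast
  next
    show "lq_bsde_solution M F N (\<lambda>_ n. \<beta> n n) \<xi> \<eta> A C Q G (state (lin_coeff A B) (lin_coeff C D) \<xi> x u_opt) p q"
      unfolding lq_bsde_solution_def by (rule pq[unfolded lq_bsde_solution_def X_def])
  qed (use coeff_meas Q R G F_0 in auto)
  have x_M[measurable]: "x \<in> borel_measurable M" by (rule i.measurable_filtration[OF F_0])
  have x_t: "i.tempered N x" by (rule i.tempered_of_moment[OF a x_M x_moment])
  \<comment> \<open>Independence separates the moment of \<open>x\<close>, which is of order \<open>2 a\<close> exactly, from the powers of the noise.\<close>
  have x_noise: "integrable M (\<lambda>\<omega>. i.noise_size N \<omega> ^ k * \<bar>x \<omega>\<bar> powr (2 * a))" for k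
  proof -
    let ?G = "sigma (space M) (noise_events M \<xi> UNIV)"
    have "indep_var borel (\<lambda>\<omega>. \<bar>x \<omega>\<bar> powr (2 * a)) borel (\<lambda>\<omega>. i.noise_size N \<omega> ^ k)"
    proof (rule indep_var_of_indep_algebras[of "vimage_algebra (space M) x borel" ?G])
      show "indep_set (sets (vimage_algebra (space M) x borel)) (sets ?G)"
        using x_indep by (simp add: sets_measure_of[OF noise_events_Pow])
      have [measurable]: "x \<in> borel_measurable (vimage_algebra (space M) x borel)"
        by (rule measurable_vimage_algebra1) simp
      show "(\<lambda>\<omega>. \<bar>x \<omega>\<bar> powr (2 * a)) \<in> borel_measurable (vimage_algebra (space M) x borel)" by measurable
      have [measurable]: "\<xi> k \<in> borel_measurable ?G" for k by (rule measurable_noise_generated) simp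
      show "(\<lambda>\<omega>. i.noise_size N \<omega> ^ k) \<in> borel_measurable ?G" unfolding i.noise_size_def by measurable
    qed (simp_all add: space_measure_of_conv)
    from indep_var_integrable[OF this x_moment i.noise_size_moment] show ?thesis by (simp add: mult.commute)
  qed
  have opt_adm: "u_opt \<in> \<U>"
    unfolding \<U>_def admissible_controls_def
  proof (intro CollectI conjI)
    show "progressively_measurable_on {..<N} F u_opt"
      by (rule i.progressively_measurable_of_adapted[OF lq.control_measurable])
    show "\<forall>n<N. \<forall>\<omega>\<in>space M. u_opt n \<omega> \<in> U" by (rule u_opt_values)
    show "integrable M (\<lambda>\<omega>. \<Sum>n<N. \<bar>u_opt n \<omega>\<bar> powr (2 * a))"
    proof (rule Bochner_Integration.integrable_sum)
      fix n assume "n \<in> {..<N}"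
      then have n: "n < N" by simp
      show "integrable M (\<lambda>\<omega>. \<bar>u_opt n \<omega>\<bar> powr (2 * a))"
        by (rule i.poly_bounded_moment[OF _ i.measurable_filtration[OF lq.control_measurable[OF n]]
              lq.optimal_control_bound[OF n] x_noise]) (use a in simp)
    qed
  qed
  have adm: "u n \<in> borel_measurable (F n)" "i.tempered N (u n)" if u: "u \<in> \<U>" and n: "n < N" for u n
  proof -
    show m: "u n \<in> borel_measurable (F n)"
      using u n by (auto simp: \<U>_def admissible_controls_def intro: adapted_of_progressively_measurable)
    have M: "u k \<in> borel_measurable M" if "k < N" for k
      using u that by (auto simp: \<U>_def admissible_controls_def intro: adapted_of_progressively_measurable i.measurable_filtration)
    have "integrable M (\<lambda>\<omega>. \<Sum>n<N. \<bar>u n \<omega>\<bar> powr (2 * a))"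
      using u by (simp add: \<U>_def admissible_controls_def)
    then have "integrable M (\<lambda>\<omega>. \<bar>u n \<omega>\<bar> powr (2 * a))"
    proof (rule Bochner_Integration.integrable_bound)
      note [measurable] = M[OF n]
      show "(\<lambda>\<omega>. \<bar>u n \<omega>\<bar> powr (2 * a)) \<in> borel_measurable M" by measurable
      show "AE \<omega> in M. norm (\<bar>u n \<omega>\<bar> powr (2 * a)) \<le> norm (\<Sum>n<N. \<bar>u n \<omega>\<bar> powr (2 * a))"
        using n by (intro AE_I2) (auto simp: sum_nonneg intro!: member_le_sum[of n "{..<N}"])
    qed
    then show "i.tempered N (u n)" by (rule i.tempered_of_moment[OF a M[OF n]])
  qed
  have le: "J u_opt \<le> J u" if "u \<in> \<U>" for u
    using lq.cost_gap_nonneg[of u, OF adm(1)[OF that] adm(2)[OF that] x_t] by (simp add: J_def X_def)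
  have inf: "(INF u\<in>\<U>. J u) = J u_opt"
    by (rule cInf_eq_minimum) (use opt_adm le in auto)
  have uniq: "AE \<omega> in M. \<forall>n<N. u n \<omega> = u_opt n \<omega>" if "u \<in> \<U>" "J u = J u_opt" for u
    using lq.cost_gap_zero[of u, OF adm(1)[OF that(1)] adm(2)[OF that(1)] x_t] that(2) by (simp add: J_def X_def)
  show ?thesis using opt_adm inf uniq by auto
qed

end
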